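(* Let $G$ be a graph of order $n\ge 5$ with complement $\overline G$ (in (2) and (5), assume also that each of $G$ and $\overline G$ has an edge). For power domination: (1) $5\le \operatorname{th}_{\gamma_P}(G)+\operatorname{th}_{\gamma_P}(\overline G)\le n+2$ and $6\le \operatorname{th}_{\gamma_P}(G)\cdot\operatorname{th}_{\gamma_P}(\overline G)\le 2n$. (2) $3\le \operatorname{th}_{\gamma_P}^{\ast}(G)+\operatorname{th}_{\gamma_P}^{\ast}(\overline G)\le n$ and $2\le \operatorname{th}_{\gamma_P}^{\ast}(G)\cdot\operatorname{th}_{\gamma_P}^{\ast}(\overline G)\le n$. (3) $6\le \operatorname{th}_{\gamma_P}^{\times}(G)+\operatorname{th}_{\gamma_P}^{\times}(\overline G)\le n+3$ and $8\le \operatorname{th}_{\gamma_P}^{\times}(G)\cdot\operatorname{th}_{\gamma_P}^{\times}(\overline G)\le 4n$. For Cops and Robbers: (4) $5\le \operatorname{th}_c(G)+\operatorname{th}_c(\overline G)\le n+2$ and $6\le \operatorname{th}_c(G)\cdot\operatorname{th}_c(\overline G)\le 2n$. (5) $3\le \operatorname{th}_c^{\ast}(G)+\operatorname{th}_c^{\ast}(\overline G)\le n$ and $2\le \operatorname{th}_c^{\ast}(G)\cdot\operatorname{th}_c^{\ast}(\overline G)\le n$. (6) $6\le \operatorname{th}_c^{\times}(G)+\operatorname{th}_c^{\times}(\overline G)\le n+4$ and $8\le \operatorname{th}_c^{\times}(G)\cdot\operatorname{th}_c^{\times}(\overline G)\le 4n$. All these bounds are sharp (attained by infinitely many graphs),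 except the bound $\operatorname{th}_{\gamma_P}^{\times}(G)\cdot\operatorname{th}_{\gamma_P}^{\times}(\overline G)\le 4n$, in which equality holds only for $G\cong K_3\,\Box\,K_3$. Moreover, for each $Y\in\{\gamma_P,c\}$, if neither $G$ nor $\overline G$ has an isolated vertex, then $$\operatorname{th}_Y(G)+\operatorname{th}_Y(\overline G)\le \left\lfloor\frac n2\right\rfloor+4\quad\text{and}\quad \operatorname{th}_Y(G)\cdot\operatorname{th}_Y(\overline G)\le n+\left\lfloor\frac n2\right\rfloor+3.$$
   Context: Graphs are finite, simple, undirected, with nonempty vertex set; the order of $G$ is $|V(G)|$; $\overline G$ is the complement of $G$; $\Box$ denotes the Cartesian product of graphs. Power domination: for $B\subseteq V(G)$ put $B^{[0]}=B$ and $B^{[1]}=N[B]$ (the vertices of $B$ and all their neighbors); for $i\ge1$, $B^{[i+1]}$ is $B^{[i]}$ together with every vertex $w\notin B^{[i]}$ that is the unique neighbor outside $B^{[i]}$ of some vertex $v\in B^{[i]}$. $\operatorname{pt}_{\gamma_P}(G;B)$ is the least $t$ with $B^{[t]}=V(G)$ ($\infty$ if none exists), and $\operatorname{pt}_{\gamma_P}(G,k)=\min_{|B|=k}\operatorname{pt}_{\gamma_P}(G;B)$. Cops and Robbers: $k$ cops are placed on a multiset of $k$ vertices, then one robber is placed on a vertex. Players alternate turns, cops first; a round is one cops' turn followed by one robber's turn; in a turn each cop (respectively the robber) stays or moves to an adjacent vertex; all information is public. The cops win when a cop occupies the robber's vertex (capture). The cop number $c(G)$ is the least number of cops guaranteeing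 capture in finitely many rounds. $\operatorname{capt}_k(G)$ is the minimum number of rounds in which $k\ge c(G)$ cops can capture the robber under optimal play by both sides ($0$ if every vertex is occupied by a cop initially), and $\operatorname{capt}_k(G)=\infty$ for $k<c(G)$. Write $\operatorname{pt}_c(G,k)=\operatorname{capt}_k(G)$. For $Y\in\{\gamma_P,c\}$ and $G$ of order $n$: $\operatorname{th}_Y(G)=\min_{1\le k\le n}(k+\operatorname{pt}_Y(G,k))$; $\operatorname{th}_Y^{\times}(G)=\min_{1\le k\le n}k(1+\operatorname{pt}_Y(G,k))$; and, if $G$ has an edge, $\operatorname{th}_Y^{\ast}(G)=\min_{1\le k\le n-1}k\cdot\operatorname{pt}_Y(G,k)$. *)

theory Defs
  imports "Graph_Theory.Graph_Theory" "HOL-Library.Extended_Nat"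
begin

text \<open>
  Finite simple undirected graphs are the library's \<^const>\<open>pair_graph\<close>s: finite, loopless,
  symmetric digraphs whose arcs are ordered pairs of vertices, so that an edge appears as two
  opposite arcs.  Isomorphism is the library's \<^const>\<open>digraph_iso\<close>.
\<close>

definition order :: "'a pair_pre_digraph \<Rightarrow> nat" where
  "order G = card (pverts G)"

definition has_edge :: "'a pair_pre_digraph \<Rightarrow> bool" where
  "has_edge G \<longleftrightarrow> parcs G \<noteq> {}"

definition neighbors :: "'a pair_pre_digraph \<Rightarrow> 'a \<Rightarrow> 'a set" where
  "neighbors G v = {w. (v, w) \<in> parcs G}"

definition has_isolated_vertex :: "'a pair_pre_digraph \<Rightarrow> bool" where
  "has_isolated_vertex G \<longleftrightarrow> (\<exists>v\<in>pverts G. neighbors G v = {})"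

definition graph_compl :: "'a pair_pre_digraph \<Rightarrow> 'a pair_pre_digraph" where
  "graph_compl G = \<lparr> pverts = pverts G,
     parcs = {(u, v). u \<in> pverts G \<and> v \<in> pverts G \<and> u \<noteq> v \<and> (u, v) \<notin> parcs G} \<rparr>"

definition cartesian_product ::
  "'a pair_pre_digraph \<Rightarrow> 'b pair_pre_digraph \<Rightarrow> ('a \<times> 'b) pair_pre_digraph" where
  "cartesian_product G H = \<lparr> pverts = pverts G \<times> pverts H,
     parcs = {((a, b), (c, d)).
       (a = c \<and> a \<in> pverts G \<and> (b, d) \<in> parcs H) \<or>
       (b = d \<and> b \<in> pverts H \<and> (a, c) \<in> parcs G)} \<rparr>"

definition complete_graph :: "nat \<Rightarrow> nat pair_pre_digraph" where
  "complete_graph n = \<lparr> pverts = {..<n}, parcs = {(u, v). u < n \<and> v < n \<and> u \<noteq> v} \<rparr>"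

fun pd_set :: "'a pair_pre_digraph \<Rightarrow> 'a set \<Rightarrow> nat \<Rightarrow> 'a set" where
  "pd_set G B 0 = B"
| "pd_set G B (Suc 0) = B \<union> (\<Union>v\<in>B. neighbors G v)"
| "pd_set G B (Suc (Suc i)) =
     pd_set G B (Suc i) \<union>
     {w. \<exists>v\<in>pd_set G B (Suc i). neighbors G v - pd_set G B (Suc i) = {w}}"

text \<open>Minima are infima in \<^typ>\<open>enat\<close>; the infimum of the empty set is \<open>\<infinity>\<close>.\<close>

definition pd_time_of_set :: "'a pair_pre_digraph \<Rightarrow> 'a set \<Rightarrow> enat" where
  "pd_time_of_set G B = (INF t\<in>{t. pd_set G B t = pverts G}. enat t)"

definition pd_time :: "'a pair_pre_digraph \<Rightarrow> nat \<Rightarrow> enat" where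
  "pd_time G k = (INF B\<in>{B. B \<subseteq> pverts G \<and> card B = k}. pd_time_of_set G B)"

definition legal_move :: "'a pair_pre_digraph \<Rightarrow> 'a \<Rightarrow> 'a \<Rightarrow> bool" where
  "legal_move G u v \<longleftrightarrow> v = u \<or> v \<in> neighbors G u"

text \<open>
  The robber starts at \<open>\<rho> 0\<close> and is at \<open>\<rho> t\<close> after round \<open>t\<close>.
  Plays are infinite; what happens after the first capture does not matter.
\<close>

definition robber_plays :: "'a pair_pre_digraph \<Rightarrow> (nat \<Rightarrow> 'a) set" where
  "robber_plays G = {\<rho>. \<rho> 0 \<in> pverts G \<and> (\<forall>t. legal_move G (\<rho> t) (\<rho> (Suc t)))}"

text \<open>
  A strategy \<open>\<sigma>\<close> for \<open>k\<close> cops (numbered \<open>0, \<dots>, k - 1\<close>, several of which may share a vertex)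
  gives the position \<open>\<sigma> h i\<close> of cop \<open>i\<close> as a function of the robber positions \<open>h\<close> seen so far:
  \<open>\<sigma> []\<close> is the initial placement, chosen before the robber is placed, and
  \<open>\<sigma> [\<rho> 0, \<dots>, \<rho> (t - 1)]\<close> is the position after the cops' turn of round \<open>t\<close>.
\<close>

definition cop_positions :: "('a list \<Rightarrow> nat \<Rightarrow> 'a) \<Rightarrow> (nat \<Rightarrow> 'a) \<Rightarrow> nat \<Rightarrow> nat \<Rightarrow> 'a" where
  "cop_positions \<sigma> \<rho> t = \<sigma> (map \<rho> [0..<t])"

definition cop_strategies :: "'a pair_pre_digraph \<Rightarrow> nat \<Rightarrow> ('a list \<Rightarrow> nat \<Rightarrow> 'a) set" where
  "cop_strategies G k = {\<sigma>.
     (\<forall>i<k. \<sigma> [] i \<in> pverts G) \<and>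
     (\<forall>\<rho>\<in>robber_plays G. \<forall>t. \<forall>i<k.
        legal_move G (cop_positions \<sigma> \<rho> t i) (cop_positions \<sigma> \<rho> (Suc t) i))}"

text \<open>
  Capture in round \<open>t\<close> happens either on the cops' turn, when the robber is still at
  \<open>\<rho> (t - 1)\<close>, or on the robber's turn; in round \<open>0\<close> only the initial placement counts.
\<close>

definition captured_in_round ::
  "nat \<Rightarrow> ('a list \<Rightarrow> nat \<Rightarrow> 'a) \<Rightarrow> (nat \<Rightarrow> 'a) \<Rightarrow> nat \<Rightarrow> bool" where
  "captured_in_round k \<sigma> \<rho> t \<longleftrightarrow>
     (\<exists>i<k. cop_positions \<sigma> \<rho> t i = \<rho> t \<or> (0 < t \<and> cop_positions \<sigma> \<rho> t i = \<rho> (t - 1)))"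

definition capture_round :: "nat \<Rightarrow> ('a list \<Rightarrow> nat \<Rightarrow> 'a) \<Rightarrow> (nat \<Rightarrow> 'a) \<Rightarrow> enat" where
  "capture_round k \<sigma> \<rho> = (INF t\<in>{t. captured_in_round k \<sigma> \<rho> t}. enat t)"

definition cop_number :: "'a pair_pre_digraph \<Rightarrow> nat" where
  "cop_number G = (LEAST k. \<exists>\<sigma>\<in>cop_strategies G k. \<forall>\<rho>\<in>robber_plays G. capture_round k \<sigma> \<rho> < \<infinity>)"

definition capture_time :: "'a pair_pre_digraph \<Rightarrow> nat \<Rightarrow> enat" where
  "capture_time G k =
     (if k < cop_number G then \<infinity>
      else (INF \<sigma>\<in>cop_strategies G k. SUP \<rho>\<in>robber_plays G. capture_round k \<sigma> \<rho>))"

text \<open>The throttling numbers for a time parameter \<open>pt\<close> such as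
  \<^const>\<open>pd_time\<close> or \<^const>\<open>capture_time\<close>.\<close>

definition th :: "('a pair_pre_digraph \<Rightarrow> nat \<Rightarrow> enat) \<Rightarrow> 'a pair_pre_digraph \<Rightarrow> enat" where
  "th pt G = (INF k\<in>{1..order G}. enat k + pt G k)"

definition th_times :: "('a pair_pre_digraph \<Rightarrow> nat \<Rightarrow> enat) \<Rightarrow> 'a pair_pre_digraph \<Rightarrow> enat" where
  "th_times pt G = (INF k\<in>{1..order G}. enat k * (1 + pt G k))"

text \<open>Meant only for graphs with an edge.\<close>

definition th_star :: "('a pair_pre_digraph \<Rightarrow> nat \<Rightarrow> enat) \<Rightarrow> 'a pair_pre_digraph \<Rightarrow> enat" where
  "th_star pt G = (INF k\<in>{1..order G - 1}. enat k * pt G k)"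

text \<open>Vertices in \<^typ>\<open>nat\<close> lose no generality: every finite graph is isomorphic to such a graph.\<close>

definition infinitely_many_graphs :: "(nat pair_pre_digraph \<Rightarrow> bool) \<Rightarrow> bool" where
  "infinitely_many_graphs P \<longleftrightarrow>
     (\<exists>S. infinite S \<and>
        (\<forall>G\<in>S. pair_graph G \<and> 5 \<le> order G \<and> P G) \<and>
        (\<forall>G\<in>S. \<forall>H\<in>S. G \<noteq> H \<longrightarrow> \<not> digraph_iso (with_proj G) (with_proj H)))"

end

theory Submission
  imports Defs
begin

text \<open>
  Write \<open>\<gamma>\<close> and \<open>\<gamma>'\<close> for the domination numbers of \<open>G\<close> and its complement.  A dominating set takes
  propagation time, respectively capture time, at most one, and only dominating sets do, so the
  upper bounds come from \<open>\<gamma> \<gamma>' \<le> n\<close> (Jaeger and Payan), which implies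
  \<open>2 (\<gamma> + \<gamma>') \<le> n + 4\<close> when both numbers are at least two.

  For power domination the product bound \<open>4 n\<close> requires \<open>\<gamma> \<gamma>' = n\<close>.  If \<open>\<gamma>' = 2\<close>, then either \<open>G\<close> has a
  leaf, which power dominates the complement in two steps, or \<open>G\<close> is a union of four-cycles.  If
  \<open>\<gamma>\<close> and \<open>\<gamma>'\<close> are at least three, then any \<open>\<gamma>' - 1\<close> vertices have a common neighbour and any \<open>\<gamma> - 1\<close>
  vertices a common non-neighbour; greedy lower bounds on degrees and codegrees and double counting
  of paths of length two leave only \<open>n = 9\<close>, where the graph is strongly regular with
  parameters \<open>(9, 4, 1, 2)\<close>.
\<close>

section \<open>Domination in a graph and its complement\<close>

text \<open>Both time parameters enter the general bounds only through very small times: time 0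
  needs every vertex, time at most 1 needs a dominating set, and fewer tokens than components never
  finish. When one domination number is 1, the other graph has an isolated vertex; \<open>th\<close>
  and \<open>th_times\<close> are then capped by \<open>order G\<close>, the cost of a token on
  every vertex. As \<open>th_star\<close> forbids that placement, an edge supplies a dominating set
  of \<open>order G - 1\<close> vertices instead. The two parameters part ways only in
  \<open>th_times\<close>. For a perfect matching, a leaf power dominates the complement in two
  steps, at cost 3, whereas a single cop needs more than two rounds there, at cost at least 4; hence
  n + 3 against n + 4. The value 4n forces \<open>th_times\<close> to be twice the domination number
  in both graphs. The greedy degree bounds of a graph and of its complement compete for the same n -
  1 vertices, which leaves few orders; of these, 12 and 15 resist the plain path count and need
  finer ones, while at order 9 the count is an equality.\<close>

definition dominating :: "'a pair_pre_digraph \<Rightarrow> 'a set \<Rightarrow> bool" where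
  "dominating G D \<longleftrightarrow> D \<subseteq> pverts G \<and> (\<forall>v\<in>pverts G - D. \<exists>d\<in>D. (d, v) \<in> parcs G)"

definition domination_number :: "'a pair_pre_digraph \<Rightarrow> nat" where
  "domination_number G = (LEAST k. \<exists>D. dominating G D \<and> card D = k)"

lemma pair_graphI:
  assumes "finite V" and "E \<subseteq> V \<times> V" and "sym E" and "irrefl E"
  shows "pair_graph \<lparr>pverts = V, parcs = E\<rparr>"
proof unfold_locales
  show "finite (parcs \<lparr>pverts = V, parcs = E\<rparr>)"
    using assms by (auto intro: finite_subset)
qed (use assms in \<open>auto simp: symmetric_def irrefl_def\<close>)

lemma graph_compl_simps [simp]:
  "pverts (graph_compl G) = pverts G"
  "(u, v) \<in> parcs (graph_compl G) \<longleftrightarrow> u \<in> pverts G \<and> v \<in> pverts G \<and> u \<noteq> v \<and> (u, v) \<notin> parcs G"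
  "order (graph_compl G) = order G"
  by (auto simp: graph_compl_def order_def)

lemma neighbors_iff [simp]: "w \<in> neighbors G v \<longleftrightarrow> (v, w) \<in> parcs G"
  by (simp add: neighbors_def)

lemma card_eq_sum_fibres:
  assumes "finite A" "finite D" "\<And>x. x \<in> A \<Longrightarrow> f x \<in> D"
  shows "card A = (\<Sum>d\<in>D. card {x \<in> A. f x = d})"
proof -
  have "card A = (\<Sum>x\<in>A. 1)" by simp
  also have "\<dots> = (\<Sum>d\<in>D. \<Sum>x\<in>{x \<in> A. f x = d}. 1)"
    by (rule sum.group[symmetric]) (use assms in auto)
  finally show ?thesis by simp
qed

context pair_graph
begin

lemma edge_verts: "(u, v) \<in> parcs G \<Longrightarrow> u \<in> pverts G \<and> v \<in> pverts G \<and> u \<noteq> v"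
  using in_arcsD1 in_arcsD2 no_loops' by blast

lemma no_loop [simp]: "(u, u) \<notin> parcs G"
  using edge_verts by blast

lemma edge_commute: "(u, v) \<in> parcs G \<longleftrightarrow> (v, u) \<in> parcs G"
  using arcs_symmetric by blast

lemma pair_graph_compl: "pair_graph (graph_compl G)"
  unfolding graph_compl_def
  by (rule pair_graphI) (auto simp: sym_def irrefl_def edge_commute)

lemma compl_compl [simp]: "graph_compl (graph_compl G) = G"
  by (rule pair_pre_digraph.equality) (auto simp: graph_compl_def dest: edge_verts)

lemma dominating_verts: "dominating G (pverts G)"
  by (auto simp: dominating_def)

lemma dominating_finite: "dominating G D \<Longrightarrow> finite D"
  using finite_subset[OF _ pair_finite_verts] by (auto simp: dominating_def)

lemma domination_number_le: "dominating G D \<Longrightarrow> domination_number G \<le> card D"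
  unfolding domination_number_def by (rule Least_le) blast

lemma ex_minimum_dominating:
  obtains D where "dominating G D" "card D = domination_number G"
proof -
  have "\<exists>D. dominating G D \<and> card D = domination_number G"
    unfolding domination_number_def by (rule LeastI) (use dominating_verts in blast)
  then show ?thesis using that by blast
qed

lemma not_dominating_ex:
  assumes "D \<subseteq> pverts G" "card D < domination_number G"
  obtains v where "v \<in> pverts G" "v \<notin> D" "\<And>d. d \<in> D \<Longrightarrow> (d, v) \<notin> parcs G"
proof -
  have "\<not> dominating G D" using domination_number_le assms(2) by fastforce
  then show ?thesis using assms(1) that by (auto simp: dominating_def)
qed

lemma domination_number_le_order: "domination_number G \<le> order G"
  using domination_number_le[OF dominating_verts] by (simp add: order_def)

lemma domination_number_pos:
  assumes "pverts G \<noteq> {}" shows "1 \<le> domination_number G"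
proof -
  obtain D where D: "dominating G D" "card D = domination_number G" by (rule ex_minimum_dominating)
  then have "D \<noteq> {}" "finite D" using assms by (auto simp: dominating_def intro: finite_subset)
  then show ?thesis using D by (metis One_nat_def Suc_leI card_gt_0_iff)
qed

lemma domination_number_less_order:
  assumes "has_edge G" shows "domination_number G \<le> order G - 1"
proof -
  obtain u v where uv: "(u, v) \<in> parcs G" using assms by (auto simp: has_edge_def)
  then have "dominating G (pverts G - {v})" using edge_verts by (auto simp: dominating_def)
  from domination_number_le[OF this] show ?thesis
    using uv edge_verts[OF uv] by (simp add: order_def)
qed

lemma dominating_vertexE:
  assumes "domination_number G = 1"
  obtains v where "v \<in> pverts G" "\<And>w. w \<in> pverts G \<Longrightarrow> w \<noteq> v \<Longrightarrow> (v, w) \<in> parcs G"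
proof -
  obtain D where D: "dominating G D" "card D = domination_number G" by (rule ex_minimum_dominating)
  then obtain v where "D = {v}" using assms card_1_singletonE by metis
  then show ?thesis using that D by (auto simp: dominating_def)
qed

lemma isolated_compl_if_dominating_vertex:
  assumes "domination_number G = 1" shows "has_isolated_vertex (graph_compl G)"
proof -
  obtain v where "v \<in> pverts G" "\<And>w. w \<in> pverts G \<Longrightarrow> w \<noteq> v \<Longrightarrow> (v, w) \<in> parcs G"
    using dominating_vertexE[OF assms] by blast
  then show ?thesis unfolding has_isolated_vertex_def
    by (intro bexI[of _ v]) (auto simp: neighbors_def)
qed

lemma domination_number_isolated:
  assumes "has_isolated_vertex G" "2 \<le> order G" shows "2 \<le> domination_number G"
proof (rule ccontr)
  obtain v where v: "v \<in> pverts G" "neighbors G v = {}"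
    using assms by (auto simp: has_isolated_vertex_def)
  assume "\<not> 2 \<le> domination_number G"
  then have "domination_number G = 1" using domination_number_pos v(1) by fastforce
  from dominating_vertexE[OF this]
  obtain w where w: "w \<in> pverts G" "\<And>u. u \<in> pverts G \<Longrightarrow> u \<noteq> w \<Longrightarrow> (w, u) \<in> parcs G"
    by blast
  have "w = v" using w v edge_commute by (auto simp: neighbors_def)
  have "card (pverts G) \<noteq> 1" using assms by (simp add: order_def)
  then obtain u where "u \<in> pverts G" "u \<noteq> v"
    using v(1) by (metis card_1_singleton_iff insertI1 is_singletonI' is_singleton_altdef empty_iff)
  then show False using w v \<open>w = v\<close> by (auto simp: neighbors_def)
qed

text \<open>
  The number of vertices that are adjacent to all the other vertices of their own part is
  maximised over the partitions of the vertex set with centres \<open>D\<close>.  Were \<open>x\<close> adjacent to a whole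
  other part, then either \<open>x\<close> replaces two centres, or moving \<open>x\<close> into that part increases this
  number.
\<close>

lemma ex_dominating_partition:
  assumes D: "dominating G D" "card D = domination_number G"
  shows "\<exists>f. (\<forall>x\<in>pverts G. f x \<in> D) \<and> (\<forall>d\<in>D. f d = d) \<and>
    (\<forall>x\<in>pverts G. x \<noteq> f x \<longrightarrow> (f x, x) \<in> parcs G) \<and>
    (\<forall>d\<in>D. dominating (graph_compl G) {x \<in> pverts G. f x = d})"
proof -
  let ?V = "pverts G"
  define good where "good f \<longleftrightarrow> (\<forall>x\<in>?V. f x \<in> D) \<and> (\<forall>d\<in>D. f d = d) \<and>
      (\<forall>x\<in>?V. x \<noteq> f x \<longrightarrow> (f x, x) \<in> parcs G)" for f
  define U where "U f = {x \<in> ?V. \<forall>y\<in>?V. f y = f x \<and> y \<noteq> x \<longrightarrow> (x, y) \<in> parcs G}" for f :: "'a \<Rightarrow> 'a"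
  have DV: "D \<subseteq> ?V" using D by (simp add: dominating_def)
  have finD: "finite D" using DV pair_finite_verts finite_subset by blast
  have "\<exists>f. good f"
  proof -
    have "\<forall>x. \<exists>d. x \<in> ?V \<longrightarrow> d \<in> D \<and> (x \<in> D \<longrightarrow> d = x) \<and> (x \<noteq> d \<longrightarrow> (d, x) \<in> parcs G)"
      using D(1) unfolding dominating_def by (metis DiffI)
    then obtain f where "\<forall>x. x \<in> ?V \<longrightarrow> f x \<in> D \<and> (x \<in> D \<longrightarrow> f x = x) \<and> (x \<noteq> f x \<longrightarrow> (f x, x) \<in> parcs G)"
      by metis
    then show ?thesis unfolding good_def using DV by blast
  qed
  moreover have "\<forall>f. good f \<longrightarrow> card (U f) < Suc (card ?V)"
    unfolding U_def by (auto intro!: card_mono le_imp_less_Suc)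
  ultimately obtain f where f: "good f" and max: "\<And>g. good g \<Longrightarrow> card (U g) \<le> card (U f)"
    using ex_has_greatest_nat[of good _ "\<lambda>f. card (U f)"] by blast
  have fD: "f x \<in> D" if "x \<in> ?V" for x using f that by (simp add: good_def)
  have ff: "f d = d" if "d \<in> D" for d using f that by (simp add: good_def)
  have fe: "(f x, x) \<in> parcs G" if "x \<in> ?V" "x \<noteq> f x" for x using f that by (simp add: good_def)
  have "dominating (graph_compl G) {x \<in> ?V. f x = d}" if d: "d \<in> D" for d
  proof (rule ccontr)
    assume "\<not> ?thesis"
    then obtain x where x: "x \<in> ?V" "f x \<noteq> d" "\<And>y. y \<in> ?V \<Longrightarrow> f y = d \<Longrightarrow> (y, x) \<in> parcs G"
      by (auto simp: dominating_def)
    let ?e = "f x"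
    show False
    proof (cases "x \<in> U f")
      case True
      let ?D = "insert x (D - {d, ?e})"
      have "dominating G ?D"
        unfolding dominating_def
      proof (intro conjI ballI)
        show "?D \<subseteq> ?V" using DV x by auto
        fix y assume y: "y \<in> ?V - ?D"
        consider "f y = d" | "f y = ?e" | "f y \<in> D - {d, ?e}" using fD y by auto
        then show "\<exists>d\<in>?D. (d, y) \<in> parcs G"
        proof cases
          case 1 then show ?thesis using x y edge_commute by blast
        next
          case 2 then show ?thesis using True y by (auto simp: U_def)
        next
          case 3
          have "f y \<noteq> y" using 3 y by auto
          then show ?thesis using 3 fe[of y] y by auto
        qed
      qed
      then have "domination_number G \<le> card ?D" by (rule domination_number_le)
      also have "\<dots> \<le> Suc (card (D - {d, ?e}))" by (rule card_insert_le_m1) auto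
      also have "card (D - {d, ?e}) = card D - 2"
        using d fD[OF x(1)] x(2) finD by (subst card_Diff_subset) auto
      finally have "domination_number G \<le> Suc (card D - 2)" by simp
      moreover have "card {d, ?e} \<le> card D"
        using d fD[OF x(1)] finD by (intro card_mono) auto
      ultimately show False using D x(2) by simp
    next
      case False
      define g where "g = f(x := d)"
      have xD: "x \<notin> D"
      proof
        assume "x \<in> D"
        then have "f x = x" by (rule ff)
        then have "x \<in> U f" using fe x(1) unfolding U_def by auto
        then show False using False by simp
      qed
      have "(d, x) \<in> parcs G" using x(3)[of d] ff[OF d] d DV by blast
      then have "good g" using f x d xD unfolding good_def g_def
        by (auto simp: ff)
      \<comment> \<open>The part that loses x only shrinks, and every member of the part of d is
        adjacent to x by \<open>x(3)\<close>, so no vertex leaves \<open>U\<close>; x itself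
        enters.\<close>
      moreover have "U f \<subset> U g"
      proof
        show "U f \<subseteq> U g"
        proof
          fix y assume y: "y \<in> U f"
          then have "y \<noteq> x" using False by auto
          then show "y \<in> U g" using y x by (auto simp: U_def g_def)
        qed
        have "x \<in> U g" using x edge_commute by (auto simp: U_def g_def)
        then show "U f \<noteq> U g" using False by auto
      qed
      then have "card (U f) < card (U g)" by (intro psubset_card_mono) (auto simp: U_def)
      ultimately show False using max by fastforce
    qed
  qed
  then show ?thesis using fD ff fe by blast
qed

text \<open>The inequality of Jaeger and Payan: there is one part for each vertex of a minimum
  dominating set, and each part, dominating the complement, has at least
  \<open>domination_number (graph_compl G)\<close> vertices.\<close>

theorem domination_numbers_product_le:
  "domination_number G * domination_number (graph_compl G) \<le> order G"
proof -
  interpret C: pair_graph "graph_compl G" by (rule pair_graph_compl)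
  obtain D where D: "dominating G D" "card D = domination_number G" by (rule ex_minimum_dominating)
  obtain f where f: "\<forall>x\<in>pverts G. f x \<in> D"
    "\<forall>d\<in>D. dominating (graph_compl G) {x \<in> pverts G. f x = d}"
    using ex_dominating_partition[OF D] by blast
  have "finite D" using D(1) by (rule dominating_finite)
  then have "order G = (\<Sum>d\<in>D. card {x \<in> pverts G. f x = d})"
    unfolding order_def using f(1) by (intro card_eq_sum_fibres) auto
  also have "\<dots> \<ge> (\<Sum>d\<in>D. domination_number (graph_compl G))"
    using f(2) C.domination_number_le by (intro sum_mono) auto
  finally show ?thesis using D by simp
qed

end

section \<open>Throttling numbers and domination numbers\<close>

text \<open>This is (g - 2)(h - 2) \<ge> 0 expanded; it turns the bound on the product of the
  domination numbers into one on their sum.\<close>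

lemma two_sum_le_product:
  assumes "2 \<le> g" "2 \<le> (h::nat)" shows "2 * (g + h) \<le> g * h + 4"
proof -
  obtain i j where "g = 2 + i" "h = 2 + j" using assms le_Suc_ex by blast
  then show ?thesis by (simp add: algebra_simps)
qed

text \<open>The interface shared by power domination and the cop game. Components are replaced by a
  colouring \<open>c\<close> constant along edges, whose number of colours is at most the number of
  components. \<open>pt_le_oneD\<close> asks only for \<open>card D \<le> k\<close> because several
  cops may share a vertex.\<close>

locale throttling_time =
  fixes pt :: "'a pair_pre_digraph \<Rightarrow> nat \<Rightarrow> enat"
  assumes pt_components: "\<And>G k (c :: 'a \<Rightarrow> 'a). \<lbrakk>pair_graph G;
        \<And>u v. (u, v) \<in> parcs G \<Longrightarrow> c u = c v; k < card (c ` pverts G)\<rbrakk> \<Longrightarrow> pt G k = \<infinity>"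
    and pt_pos: "\<And>G k. pair_graph G \<Longrightarrow> k < order G \<Longrightarrow> 1 \<le> pt G k"
    and pt_le_oneD: "\<And>G k. pair_graph G \<Longrightarrow> pt G k \<le> 1 \<Longrightarrow> \<exists>D. dominating G D \<and> card D \<le> k"
    and pt_dominating: "\<And>G D. pair_graph G \<Longrightarrow> dominating G D \<Longrightarrow> pt G (card D) \<le> 1"
    and pt_order: "\<And>G. pair_graph G \<Longrightarrow> pt G (order G) = 0"
begin

context
  fixes G :: "'a pair_pre_digraph"
  assumes G: "pair_graph G" and ne: "pverts G \<noteq> {}"
begin

interpretation pair_graph G by (rule G)

lemma order_pos: "1 \<le> order G"
  using ne by (auto simp: order_def Suc_le_eq card_gt_0_iff)

lemma pt_domination_number: "pt G (domination_number G) \<le> 1"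
  using pt_dominating[OF G] ex_minimum_dominating by metis

lemma pt_less_domination_number: "k < domination_number G \<Longrightarrow> 2 \<le> pt G k"
  using pt_le_oneD[OF G, of k] domination_number_le
  by (cases "pt G k") (fastforce simp: one_enat_def numeral_eq_enat)+

lemma th_le_domination_number: "th pt G \<le> enat (domination_number G + 1)"
proof -
  have "th pt G \<le> enat (domination_number G) + pt G (domination_number G)"
    unfolding th_def using domination_number_pos[OF ne] domination_number_le_order
    by (intro INF_lower) auto
  also have "\<dots> \<le> enat (domination_number G) + 1" using pt_domination_number by (intro add_mono) auto
  finally show ?thesis by (simp add: one_enat_def)
qed

lemma th_le_order: "th pt G \<le> enat (order G)"
proof -
  have "th pt G \<le> enat (order G) + pt G (order G)"
    unfolding th_def using order_pos by (intro INF_lower) auto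
  then show ?thesis using pt_order[OF G] by simp
qed

lemma th_times_le_domination_number: "th_times pt G \<le> enat (2 * domination_number G)"
proof -
  have "th_times pt G \<le> enat (domination_number G) * (1 + pt G (domination_number G))"
    unfolding th_times_def using domination_number_pos[OF ne] domination_number_le_order
    by (intro INF_lower) auto
  also have "\<dots> \<le> enat (domination_number G) * (1 + 1)"
    using pt_domination_number by (intro mult_left_mono add_mono) auto
  finally show ?thesis by (simp add: one_enat_def mult_2)
qed

lemma th_times_le_order: "th_times pt G \<le> enat (order G)"
proof -
  have "th_times pt G \<le> enat (order G) * (1 + pt G (order G))"
    unfolding th_times_def using order_pos by (intro INF_lower) auto
  then show ?thesis using pt_order[OF G] by simp
qed

lemma th_star_le_domination_number:
  assumes "has_edge G" shows "th_star pt G \<le> enat (domination_number G)"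
proof -
  have "th_star pt G \<le> enat (domination_number G) * pt G (domination_number G)"
    unfolding th_star_def using domination_number_pos[OF ne] domination_number_less_order[OF assms]
    by (intro INF_lower) auto
  also have "\<dots> \<le> enat (domination_number G) * 1"
    using pt_domination_number by (intro mult_left_mono) auto
  finally show ?thesis by simp
qed

lemma th_ge_two: "2 \<le> order G \<Longrightarrow> 2 \<le> th pt G"
  unfolding th_def
proof (rule INF_greatest)
  fix k assume n: "2 \<le> order G" and k: "k \<in> {1..order G}"
  show "2 \<le> enat k + pt G k"
    using pt_pos[OF G, of k] k n
    by (cases "pt G k"; cases "k = 1") (auto simp: one_enat_def numeral_eq_enat)
qed

text \<open>One token needs time 2, as no single vertex dominates, and two tokens need time 1, as
  they do not fill the graph.\<close>

lemma th_ge_three: "3 \<le> order G \<Longrightarrow> 2 \<le> domination_number G \<Longrightarrow> 3 \<le> th pt G"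
  unfolding th_def
proof (rule INF_greatest)
  fix k assume n: "3 \<le> order G" and k: "k \<in> {1..order G}" and g: "2 \<le> domination_number G"
  consider "k = 1" | "k = 2" | "3 \<le> k" using k by force
  then show "3 \<le> enat k + pt G k"
    by cases (use pt_pos[OF G, of k] pt_less_domination_number[of k] n g in
      \<open>cases "pt G k"; auto simp: one_enat_def numeral_eq_enat\<close>)+
qed

lemma th_star_ge_one: "1 \<le> th_star pt G"
  unfolding th_star_def
proof (rule INF_greatest)
  fix k assume k: "k \<in> {1..order G - 1}"
  then have "1 * 1 \<le> enat k * pt G k"
    by (intro mult_mono pt_pos[OF G]) (auto simp: one_enat_def)
  then show "1 \<le> enat k * pt G k" by simp
qed

lemma th_star_ge_two: "2 \<le> domination_number G \<Longrightarrow> 2 \<le> th_star pt G"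
  unfolding th_star_def
proof (rule INF_greatest)
  fix k assume k: "k \<in> {1..order G - 1}" and g: "2 \<le> domination_number G"
  show "2 \<le> enat k * pt G k"
  proof (cases "k = 1")
    case True
    then show ?thesis using pt_less_domination_number[of 1] g by (simp add: one_enat_def[symmetric] flip: One_nat_def)
  next
    case False
    then have "2 * 1 \<le> enat k * pt G k"
      using k by (intro mult_mono pt_pos[OF G]) (auto simp: numeral_eq_enat)
    then show ?thesis by simp
  qed
qed

lemma th_times_ge_two: "2 \<le> order G \<Longrightarrow> 2 \<le> th_times pt G"
  unfolding th_times_def
proof (rule INF_greatest)
  fix k assume n: "2 \<le> order G" and k: "k \<in> {1..order G}"
  show "2 \<le> enat k * (1 + pt G k)"
    using pt_pos[OF G, of k] k n
    by (cases "pt G k"; cases "k = 1") (auto simp: one_enat_def numeral_eq_enat intro: order.trans)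
qed

lemma th_times_ge_three:
  assumes n: "3 \<le> order G" and g: "2 \<le> domination_number G" shows "3 \<le> th_times pt G"
  unfolding th_times_def
proof (rule INF_greatest)
  fix k assume k: "k \<in> {1..order G}"
  consider "k = 1" | "k = 2" | "3 \<le> k" using k by force
  then show "3 \<le> enat k * (1 + pt G k)"
  proof cases
    case 3
    then have "enat 3 * 1 \<le> enat k * (1 + pt G k)" by (intro mult_mono) auto
    then show ?thesis by (simp add: numeral_eq_enat)
  qed (use pt_pos[OF G, of k] pt_less_domination_number[of k] n g in
      \<open>cases "pt G k"; auto simp: one_enat_def numeral_eq_enat\<close>)+
qed

text \<open>The values to beat are 1 * (1 + 3), 2 * (1 + 1) and 4 * 1. The hypothesis on
  \<open>pt G 1\<close> holds with an isolated vertex, and for cops also in the complement of a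
  perfect matching.\<close>

lemma th_times_ge_four:
  assumes n: "4 \<le> order G" and inf: "3 \<le> pt G 1" shows "4 \<le> th_times pt G"
  unfolding th_times_def
proof (rule INF_greatest)
  fix k assume k: "k \<in> {1..order G}"
  consider "k = 1" | "2 \<le> k" "k < 4" | "4 \<le> k" using k by force
  then show "4 \<le> enat k * (1 + pt G k)"
  proof cases
    case 1 then show ?thesis using inf by (cases "pt G 1") (auto simp: one_enat_def numeral_eq_enat)
  next
    case 2
    then have "1 \<le> pt G k" using n by (intro pt_pos[OF G]) auto
    then have "enat 2 * (1 + 1) \<le> enat k * (1 + pt G k)" using 2 by (intro mult_mono add_mono) auto
    then show ?thesis by (simp add: numeral_eq_enat one_enat_def)
  next
    case 3
    then have "enat 4 * 1 \<le> enat k * (1 + pt G k)" by (intro mult_mono) auto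
    then show ?thesis by (simp add: numeral_eq_enat)
  qed
qed

text \<open>The isolated vertex gets a colour of its own and all other vertices share a second one,
  so a single token misses a colour.\<close>

lemma pt_isolated:
  assumes "has_isolated_vertex G" "2 \<le> order G" shows "pt G 1 = \<infinity>"
proof -
  obtain v where v: "v \<in> pverts G" "neighbors G v = {}"
    using assms by (auto simp: has_isolated_vertex_def)
  have "card (pverts G) \<noteq> 1" using assms by (simp add: order_def)
  then obtain w where w: "w \<in> pverts G" "w \<noteq> v"
    using v(1) by (metis card_1_singleton_iff insertI1 is_singletonI' is_singleton_altdef empty_iff)
  let ?c = "\<lambda>x. if x = v then v else w"
  have "?c ` pverts G = {v, w}" using v w by auto
  then have "1 < card (?c ` pverts G)" using w by simp
  moreover have "?c x = ?c y" if "(x, y) \<in> parcs G" for x y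
    using that v edge_commute by (auto simp: neighbors_def)
  ultimately show ?thesis using pt_components[OF G, of ?c] by blast
qed

end

context
  fixes G :: "'a pair_pre_digraph"
  assumes G: "pair_graph G" and n: "5 \<le> order G"
begin

interpretation pair_graph G by (rule G)
interpretation C: pair_graph "graph_compl G" by (rule pair_graph_compl)

lemma verts_nonempty: "pverts G \<noteq> {}" "pverts (graph_compl G) \<noteq> {}"
  using n by (auto simp: order_def)

text \<open>A dominating vertex of one graph is isolated in the other. The first two cases are
  therefore exactly what the hypothesis about isolated vertices excludes.\<close>

lemma domination_numbers_cases:
  obtains "domination_number G = 1" "2 \<le> domination_number (graph_compl G)"
      "has_isolated_vertex (graph_compl G)"
  | "domination_number (graph_compl G) = 1" "2 \<le> domination_number G" "has_isolated_vertex G"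
  | "2 \<le> domination_number G" "2 \<le> domination_number (graph_compl G)"
proof -
  have "1 \<le> domination_number G" "1 \<le> domination_number (graph_compl G)"
    using domination_number_pos C.domination_number_pos verts_nonempty by auto
  then show ?thesis
    using that isolated_compl_if_dominating_vertex C.isolated_compl_if_dominating_vertex
      domination_number_isolated C.domination_number_isolated n by fastforce
qed

lemma th_bounds:
  shows "5 \<le> th pt G + th pt (graph_compl G)"
    and "th pt G + th pt (graph_compl G) \<le> enat (order G + 2)"
    and "6 \<le> th pt G * th pt (graph_compl G)"
    and "th pt G * th pt (graph_compl G) \<le> enat (2 * order G)"
    and "\<lbrakk>\<not> has_isolated_vertex G; \<not> has_isolated_vertex (graph_compl G)\<rbrakk> \<Longrightarrow>
        th pt G + th pt (graph_compl G) \<le> enat (order G div 2 + 4)"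
    and "\<lbrakk>\<not> has_isolated_vertex G; \<not> has_isolated_vertex (graph_compl G)\<rbrakk> \<Longrightarrow>
        th pt G * th pt (graph_compl G) \<le> enat (order G + order G div 2 + 3)"
proof -
  let ?H = "graph_compl G"
  define g h m where gh: "g = domination_number G" "h = domination_number ?H" "m = order G"
  note H = pair_graph_compl
  obtain a b where ab: "th pt G = enat a" "th pt ?H = enat b"
    using th_le_order[OF G verts_nonempty(1)] th_le_order[OF H verts_nonempty(2)] by (metis enat_ile)
  have ub: "a \<le> g + 1" "b \<le> h + 1" "a \<le> m" "b \<le> m"
    using th_le_order[OF G verts_nonempty(1)] th_le_order[OF H verts_nonempty(2)]
      th_le_domination_number[OF G verts_nonempty(1)] th_le_domination_number[OF H verts_nonempty(2)]
    by (auto simp: ab gh)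
  have lb: "2 \<le> a" "2 \<le> b" "2 \<le> g \<Longrightarrow> 3 \<le> a" "2 \<le> h \<Longrightarrow> 3 \<le> b"
    using th_ge_two[OF G verts_nonempty(1)] th_ge_two[OF H verts_nonempty(2)]
      th_ge_three[OF G verts_nonempty(1)] th_ge_three[OF H verts_nonempty(2)] n
    by (auto simp: ab gh numeral_eq_enat)
  have prod: "g * h \<le> m" using domination_numbers_product_le by (simp add: gh)
  have m: "5 \<le> m" using n by (simp add: gh)
  have pab: "a * b \<le> (g + 1) * (h + 1)" using ub by (intro mult_le_mono) auto
  have both: "a + b \<le> m div 2 + 4 \<and> a * b \<le> m + m div 2 + 3" if "2 \<le> g" "2 \<le> h"
  proof -
    \<comment> \<open>The floor comes from halving 2(g + h) \<le> m + 4 over the integers. Expanding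
      (g + 1)(h + 1) as gh + (g + h) + 1 then gives the constant 3 of the product bound.\<close>
    have "g + h \<le> m div 2 + 2" using two_sum_le_product[OF that] prod by presburger
    then show ?thesis using ub pab prod by (simp add: algebra_simps)
  qed
  have 1: "5 \<le> a + b \<and> 6 \<le> a * b \<and> a + b \<le> m + 2 \<and> a * b \<le> 2 * m"
  proof (cases rule: domination_numbers_cases)
    case 1
    then have "a = 2" "3 \<le> b" using ub lb by (auto simp: gh)
    then show ?thesis using ub by auto
  next
    case 2
    then have "b = 2" "3 \<le> a" using ub lb by (auto simp: gh)
    then show ?thesis using ub by auto
  next
    case 3
    then have "3 \<le> a" "3 \<le> b" using lb by (auto simp: gh)
    then have "3 * 3 \<le> a * b" by (intro mult_le_mono) auto
    \<comment> \<open>Here the order must be at least 5: m + m div 2 + 3 \<le> 2m fails for m =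
      4.\<close>
    then show ?thesis using \<open>3 \<le> a\<close> \<open>3 \<le> b\<close> both 3 m by (auto simp: gh(1,2))
  qed
  have 2: "a + b \<le> m div 2 + 4 \<and> a * b \<le> m + m div 2 + 3"
    if "\<not> has_isolated_vertex G" "\<not> has_isolated_vertex ?H"
    by (cases rule: domination_numbers_cases) (use that both in \<open>auto simp: gh(1,2)\<close>)
  show "5 \<le> th pt G + th pt (graph_compl G)"
    and "th pt G + th pt (graph_compl G) \<le> enat (order G + 2)"
    and "6 \<le> th pt G * th pt (graph_compl G)"
    and "th pt G * th pt (graph_compl G) \<le> enat (2 * order G)"
    using 1 by (auto simp: ab numeral_eq_enat gh(3))
  show "\<lbrakk>\<not> has_isolated_vertex G; \<not> has_isolated_vertex (graph_compl G)\<rbrakk> \<Longrightarrow>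
        th pt G + th pt (graph_compl G) \<le> enat (order G div 2 + 4)"
    and "\<lbrakk>\<not> has_isolated_vertex G; \<not> has_isolated_vertex (graph_compl G)\<rbrakk> \<Longrightarrow>
        th pt G * th pt (graph_compl G) \<le> enat (order G + order G div 2 + 3)"
    using 2 by (auto simp: ab gh(3))
qed

lemma th_star_bounds:
  assumes e: "has_edge G" "has_edge (graph_compl G)"
  shows "3 \<le> th_star pt G + th_star pt (graph_compl G)"
    and "th_star pt G + th_star pt (graph_compl G) \<le> enat (order G)"
    and "2 \<le> th_star pt G * th_star pt (graph_compl G)"
    and "th_star pt G * th_star pt (graph_compl G) \<le> enat (order G)"
proof -
  let ?H = "graph_compl G"
  define g h m where gh: "g = domination_number G" "h = domination_number ?H" "m = order G"
  note H = pair_graph_compl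
  obtain a b where ab: "th_star pt G = enat a" "th_star pt ?H = enat b"
    using th_star_le_domination_number[OF G verts_nonempty(1) e(1)] th_star_le_domination_number[OF H verts_nonempty(2) e(2)]
    by (metis enat_ile)
  have ub: "a \<le> g" "b \<le> h"
    using th_star_le_domination_number[OF G verts_nonempty(1) e(1)] th_star_le_domination_number[OF H verts_nonempty(2) e(2)]
    by (auto simp: ab gh)
  have lb: "1 \<le> a" "1 \<le> b" "2 \<le> g \<Longrightarrow> 2 \<le> a" "2 \<le> h \<Longrightarrow> 2 \<le> b"
    using th_star_ge_one[OF G verts_nonempty(1)] th_star_ge_one[OF H verts_nonempty(2)]
      th_star_ge_two[OF G verts_nonempty(1)] th_star_ge_two[OF H verts_nonempty(2)]
    by (auto simp: ab gh one_enat_def numeral_eq_enat)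
  have prod: "g * h \<le> m" using domination_numbers_product_le by (simp add: gh)
  have m: "5 \<le> m" using n by (simp add: gh)
  have gm: "g \<le> m - 1" "h \<le> m - 1"
    using domination_number_less_order[OF e(1)] C.domination_number_less_order[OF e(2)] by (auto simp: gh)
  have pab: "a * b \<le> g * h" using ub by (intro mult_le_mono) auto
  have "3 \<le> a + b \<and> 2 \<le> a * b \<and> a + b \<le> m"
  proof (cases rule: domination_numbers_cases)
    case 1
    then have "a = 1" "2 \<le> b" using ub lb by (auto simp: gh)
    then show ?thesis using ub gm m by auto
  next
    case 2
    then have "b = 1" "2 \<le> a" using ub lb by (auto simp: gh)
    then show ?thesis using ub gm m by auto
  next
    case 3
    then have gh2: "2 \<le> g" "2 \<le> h" "2 \<le> a" "2 \<le> b" using lb by (auto simp: gh)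
    then have "2 * 2 \<le> a * b" by (intro mult_le_mono) auto
    then show ?thesis using gh2 two_sum_le_product[OF gh2(1,2)] prod ub m by auto
  qed
  then show "3 \<le> th_star pt G + th_star pt (graph_compl G)"
    and "th_star pt G + th_star pt (graph_compl G) \<le> enat (order G)"
    and "2 \<le> th_star pt G * th_star pt (graph_compl G)"
    and "th_star pt G * th_star pt (graph_compl G) \<le> enat (order G)"
    using prod pab by (auto simp: ab numeral_eq_enat gh(3))
qed

lemma th_times_bounds:
  shows "6 \<le> th_times pt G + th_times pt (graph_compl G)"
    and "th_times pt G + th_times pt (graph_compl G) \<le> enat (order G + 4)"
    and "8 \<le> th_times pt G * th_times pt (graph_compl G)"
    and "th_times pt G * th_times pt (graph_compl G) \<le> enat (4 * order G)"
proof -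
  let ?H = "graph_compl G"
  define g h m where gh: "g = domination_number G" "h = domination_number ?H" "m = order G"
  note H = pair_graph_compl
  obtain a b where ab: "th_times pt G = enat a" "th_times pt ?H = enat b"
    using th_times_le_order[OF G verts_nonempty(1)] th_times_le_order[OF H verts_nonempty(2)] by (metis enat_ile)
  have ub: "a \<le> 2 * g" "b \<le> 2 * h" "a \<le> m" "b \<le> m"
    using th_times_le_order[OF G verts_nonempty(1)] th_times_le_order[OF H verts_nonempty(2)]
      th_times_le_domination_number[OF G verts_nonempty(1)] th_times_le_domination_number[OF H verts_nonempty(2)]
    by (auto simp: ab gh)
  have lb: "2 \<le> a" "2 \<le> b" "2 \<le> g \<Longrightarrow> 3 \<le> a" "2 \<le> h \<Longrightarrow> 3 \<le> b"
    "has_isolated_vertex G \<Longrightarrow> 4 \<le> a" "has_isolated_vertex ?H \<Longrightarrow> 4 \<le> b"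
    using th_times_ge_two[OF G verts_nonempty(1)] th_times_ge_two[OF H verts_nonempty(2)]
      th_times_ge_three[OF G verts_nonempty(1)] th_times_ge_three[OF H verts_nonempty(2)]
      th_times_ge_four[OF G verts_nonempty(1)] th_times_ge_four[OF H verts_nonempty(2)]
      pt_isolated[OF G verts_nonempty(1)] pt_isolated[OF H verts_nonempty(2)] n
    by (auto simp: ab gh numeral_eq_enat)
  have prod: "g * h \<le> m" using domination_numbers_product_le by (simp add: gh)
  have m: "5 \<le> m" using n by (simp add: gh)
  have "6 \<le> a + b \<and> 8 \<le> a * b \<and> a + b \<le> m + 4 \<and> a * b \<le> 4 * m"
  proof (cases rule: domination_numbers_cases)
    case 1
    \<comment> \<open>The bound is 4 and not 3 because the complement has an isolated vertex, so one
      token never finishes there. This is the source of the lower bounds 6 = 2 + 4 and 8 = 2 *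
      4.\<close>
    then have "a = 2" "4 \<le> b" using ub lb by (auto simp: gh)
    then show ?thesis using ub by auto
  next
    case 2
    then have "b = 2" "4 \<le> a" using ub lb by (auto simp: gh)
    then show ?thesis using ub by auto
  next
    case 3
    then have gh2: "2 \<le> g" "2 \<le> h" "3 \<le> a" "3 \<le> b" using lb by (auto simp: gh)
    then have "3 * 3 \<le> a * b" by (intro mult_le_mono) auto
    moreover have "a * b \<le> (2 * g) * (2 * h)" using ub by (intro mult_le_mono) auto
    ultimately show ?thesis using gh2 two_sum_le_product[OF gh2(1,2)] prod ub by auto
  qed
  then show "6 \<le> th_times pt G + th_times pt (graph_compl G)"
    and "th_times pt G + th_times pt (graph_compl G) \<le> enat (order G + 4)"
    and "8 \<le> th_times pt G * th_times pt (graph_compl G)"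
    and "th_times pt G * th_times pt (graph_compl G) \<le> enat (4 * order G)"
    by (auto simp: ab numeral_eq_enat gh(3))
qed

end

end

section \<open>Power domination and Cops and Robbers\<close>

lemma enat_INF_attained:
  assumes "A \<noteq> {}" obtains a where "a \<in> A" "(INF a\<in>A. f a :: enat) = f a"
proof -
  have "Inf (f ` A) \<in> f ` A"
    unfolding Inf_enat_def using assms by (auto intro: LeastI)
  then show ?thesis using that by blast
qed

lemma Least_enat_attained:
  "(INF t\<in>{t. P t}. enat t) \<noteq> \<infinity> \<Longrightarrow> \<exists>t. P t \<and> (INF t\<in>{t. P t}. enat t) = enat t"
proof -
  assume *: "(INF t\<in>{t. P t}. enat t) \<noteq> \<infinity>"
  have "{t. P t} \<noteq> {}"
  proof
    assume "{t. P t} = {}"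
    then show False using * by (metis image_empty Inf_empty top_enat_def)
  qed
  then show ?thesis using enat_INF_attained[of "{t. P t}" enat] by auto
qed

context pair_graph
begin

text \<open>The initial domination step and every later force follow an edge, so no new colour is
  ever reached.\<close>

lemma pd_set_component:
  assumes "\<And>u v. (u, v) \<in> parcs G \<Longrightarrow> c u = c v"
  shows "c ` pd_set G B t \<subseteq> c ` B"
proof (induction t)
  case (Suc t)
  show ?case
  proof (cases t)
    case 0
    have "c w \<in> c ` B" if "v \<in> B" "(v, w) \<in> parcs G" for v w
      using assms[OF that(2)] that(1) by (metis imageI)
    then show ?thesis using 0 by (auto simp: neighbors_def)
  next
    case (Suc i)
    have "c w \<in> c ` B" if "v \<in> pd_set G B t" "neighbors G v - pd_set G B t = {w}" for v w
    proof -
      have "(v, w) \<in> parcs G" using that(2) by auto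
      then have "c w = c v" using assms by metis
      then show ?thesis using Suc.IH that(1) by auto
    qed
    then show ?thesis using Suc Suc.IH by auto
  qed
qed simp

lemma pd_time_le:
  assumes "B \<subseteq> pverts G" "pd_set G B t = pverts G"
  shows "pd_time G (card B) \<le> enat t"
proof -
  have "pd_time G (card B) \<le> pd_time_of_set G B"
    unfolding pd_time_def using assms(1) by (intro INF_lower) auto
  also have "\<dots> \<le> enat t"
    unfolding pd_time_of_set_def using assms(2) by (intro INF_lower) auto
  finally show ?thesis .
qed

lemma pd_time_attained:
  assumes "pd_time G k \<noteq> \<infinity>"
  obtains B t where "B \<subseteq> pverts G" "card B = k" "pd_set G B t = pverts G" "pd_time G k = enat t"
proof -
  let ?S = "{B. B \<subseteq> pverts G \<and> card B = k}"
  have "?S \<noteq> {}"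
  proof
    assume "?S = {}"
    then show False using assms unfolding pd_time_def by (metis image_empty Inf_empty top_enat_def)
  qed
  then obtain B where B: "B \<in> ?S" "pd_time G k = pd_time_of_set G B"
    unfolding pd_time_def by (rule enat_INF_attained)
  then have "pd_time_of_set G B \<noteq> \<infinity>" using assms by simp
  then obtain t where "pd_set G B t = pverts G" "pd_time_of_set G B = enat t"
    unfolding pd_time_of_set_def using Least_enat_attained by blast
  then show ?thesis using that B by auto
qed

lemma pd_set_Suc_0_dominating: "dominating G D \<Longrightarrow> pd_set G D (Suc 0) = pverts G"
  unfolding pd_set.simps neighbors_def dominating_def using edge_verts by blast

end

interpretation pd: throttling_time pd_time
proof
  fix G :: "'a pair_pre_digraph" and k :: nat and c :: "'a \<Rightarrow> 'a"
  assume G: "pair_graph G"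
  then interpret pair_graph G .
  {
    assume c: "\<And>u v. (u, v) \<in> parcs G \<Longrightarrow> c u = c v" and k: "k < card (c ` pverts G)"
    show "pd_time G k = \<infinity>"
    proof (rule ccontr)
      assume "pd_time G k \<noteq> \<infinity>"
      then obtain B t where B: "B \<subseteq> pverts G" "card B = k" "pd_set G B t = pverts G"
        by (rule pd_time_attained)
      then have "c ` pverts G \<subseteq> c ` B" using pd_set_component[of c B t] c by simp
      then have "card (c ` pverts G) \<le> card (c ` B)"
        using B(1) pair_finite_verts finite_subset by (intro card_mono) blast+
      also have "\<dots> \<le> k" using B(1,2) pair_finite_verts finite_subset card_image_le by metis
      finally show False using k by simp
    qed
  }
  { assume "k < order G"
    show "1 \<le> pd_time G k"
    proof (rule ccontr)
      assume "\<not> 1 \<le> pd_time G k"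
      then have 0: "pd_time G k = 0" using ileI1 one_eSuc not_le by (metis i0_lb order.not_eq_order_implies_strict)
      then have "pd_time G k \<noteq> \<infinity>" by simp
      then obtain B t where "B \<subseteq> pverts G" "card B = k" "pd_set G B t = pverts G" "pd_time G k = enat t"
        by (rule pd_time_attained)
      then show False using \<open>k < order G\<close> 0 by (auto simp: zero_enat_def order_def)
    qed }
  { assume le: "pd_time G k \<le> 1"
    then have "pd_time G k \<noteq> \<infinity>" by (cases "pd_time G k") (auto simp: one_enat_def)
    then obtain B t where B: "B \<subseteq> pverts G" "card B = k" "pd_set G B t = pverts G" "pd_time G k = enat t"
      by (rule pd_time_attained)
    then consider "t = 0" | "t = Suc 0" using le by (auto simp: one_enat_def) linarith
    then have "dominating G B"
    proof cases
      case 1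
      then show ?thesis using B by (simp add: dominating_def)
    next
      case 2
      then have "pverts G \<subseteq> B \<union> (\<Union>v\<in>B. neighbors G v)" using B(3) by simp
      then show ?thesis using B(1) unfolding dominating_def neighbors_def by blast
    qed
    then show "\<exists>D. dominating G D \<and> card D \<le> k" using B(2) by blast }
  { fix D assume "dominating G D"
    then show "pd_time G (card D) \<le> 1"
      using pd_time_le[of D "Suc 0"] pd_set_Suc_0_dominating
      by (simp add: dominating_def one_enat_def) }
  { show "pd_time G (order G) = 0"
      using pd_time_le[of "pverts G" 0] by (simp add: order_def flip: zero_enat_def) }
qed

section \<open>Capture times\<close>

lemma capture_round_le: "captured_in_round k \<sigma> \<rho> t \<Longrightarrow> capture_round k \<sigma> \<rho> \<le> enat t"
  unfolding capture_round_def by (intro INF_lower) auto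

text \<open>The clause for fewer cops than the cop number only raises the value to infinity, so
  answering every strategy by one play suffices.\<close>

lemma capture_time_ge:
  assumes "\<And>\<sigma>. \<sigma> \<in> cop_strategies G k \<Longrightarrow> \<exists>\<rho>\<in>robber_plays G. x \<le> capture_round k \<sigma> \<rho>"
  shows "x \<le> capture_time G k"
proof -
  have "x \<le> (INF \<sigma>\<in>cop_strategies G k. SUP \<rho>\<in>robber_plays G. capture_round k \<sigma> \<rho>)"
    using assms by (intro INF_greatest) (meson SUP_upper2)
  then show ?thesis by (simp add: capture_time_def)
qed

text \<open>A strategy with a uniform finite bound is itself a witness that k is at least the cop
  number, so the infinite clause does not apply.\<close>

lemma capture_time_le:
  assumes "\<sigma> \<in> cop_strategies G k" "\<And>\<rho>. \<rho> \<in> robber_plays G \<Longrightarrow> capture_round k \<sigma> \<rho> \<le> enat t"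
  shows "capture_time G k \<le> enat t"
proof -
  have "\<forall>\<rho>\<in>robber_plays G. capture_round k \<sigma> \<rho> < \<infinity>"
    using assms(2) by (metis enat_ord_code(4) order.strict_trans1)
  then have "cop_number G \<le> k"
    unfolding cop_number_def using assms(1) by (intro Least_le) blast
  moreover have "(INF \<sigma>\<in>cop_strategies G k. SUP \<rho>\<in>robber_plays G. capture_round k \<sigma> \<rho>) \<le> enat t"
    using assms by (intro INF_lower2[OF assms(1)] SUP_least) auto
  ultimately show ?thesis by (simp add: capture_time_def)
qed

lemma capture_round_geI:
  assumes "\<And>s. s < t \<Longrightarrow> \<not> captured_in_round k \<sigma> \<rho> s"
  shows "enat t \<le> capture_round k \<sigma> \<rho>"
  unfolding capture_round_def using assms by (intro INF_greatest) (auto simp: not_less[symmetric])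

context pair_graph
begin

lemma constant_robber_play: "v \<in> pverts G \<Longrightarrow> (\<lambda>_. v) \<in> robber_plays G"
  by (simp add: robber_plays_def legal_move_def)

lemma card_initial_cops: "card (\<sigma> [] ` {..<k}) \<le> k"
  using card_image_le[of "{..<k}" "\<sigma> []"] by simp

lemma cop_first_move:
  assumes "\<sigma> \<in> cop_strategies G k" "\<rho> \<in> robber_plays G" "i < k"
  shows "legal_move G (\<sigma> [] i) (\<sigma> [\<rho> 0] i)"
proof -
  have "legal_move G (cop_positions \<sigma> \<rho> 0 i) (cop_positions \<sigma> \<rho> (Suc 0) i)"
    using assms by (simp add: cop_strategies_def)
  then show ?thesis by (simp add: cop_positions_def)
qed

end

text \<open>Every lower bound here comes from a robber who never moves: in a component without cops
  he is safe forever, on a vertex not occupied at the start he survives round 0, and on a vertex not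
  dominated by the cops he survives round 1.\<close>

interpretation cop: throttling_time capture_time
proof
  fix G :: "'a pair_pre_digraph" and k :: nat and c :: "'a \<Rightarrow> 'a"
  assume G: "pair_graph G"
  then interpret pair_graph G .
  {
    assume c: "\<And>u v. (u, v) \<in> parcs G \<Longrightarrow> c u = c v" and k: "k < card (c ` pverts G)"
    have "\<infinity> \<le> capture_time G k"
    proof (rule capture_time_ge)
      fix \<sigma> assume \<sigma>: "\<sigma> \<in> cop_strategies G k"
      have "card (c ` (\<sigma> [] ` {..<k})) \<le> k"
        using card_initial_cops[of \<sigma> k] card_image_le[of "\<sigma> [] ` {..<k}" c] by simp
      then have "\<not> c ` pverts G \<subseteq> c ` (\<sigma> [] ` {..<k})"
        using k by (metis card_mono finite_imageI finite_lessThan le_trans not_le)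
      then obtain v where v: "v \<in> pverts G" "c v \<notin> c ` (\<sigma> [] ` {..<k})" by blast
      let ?\<rho> = "\<lambda>_::nat. v"
      have "c (cop_positions \<sigma> ?\<rho> t i) = c (\<sigma> [] i)" if "i < k" for t i
      proof (induction t)
        case (Suc t)
        have "legal_move G (cop_positions \<sigma> ?\<rho> t i) (cop_positions \<sigma> ?\<rho> (Suc t) i)"
          using \<sigma> that constant_robber_play[OF v(1)] unfolding cop_strategies_def by blast
        then show ?case using Suc c by (auto simp: legal_move_def)
      qed (simp add: cop_positions_def)
      then have "\<not> captured_in_round k \<sigma> ?\<rho> t" for t
        using v(2) unfolding captured_in_round_def by (metis imageI lessThan_iff)
      then have "capture_round k \<sigma> ?\<rho> = \<infinity>" by (simp add: capture_round_def top_enat_def)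
      then show "\<exists>\<rho>\<in>robber_plays G. \<infinity> \<le> capture_round k \<sigma> \<rho>"
        using constant_robber_play[OF v(1)] by (intro bexI[of _ ?\<rho>]) auto
    qed
    then show "capture_time G k = \<infinity>" by simp
  }
  { assume k: "k < order G"
    have "enat 1 \<le> capture_time G k"
    proof (rule capture_time_ge)
      fix \<sigma> assume \<sigma>: "\<sigma> \<in> cop_strategies G k"
      have "\<not> pverts G \<subseteq> \<sigma> [] ` {..<k}"
        using k card_initial_cops[of \<sigma> k] unfolding order_def
        by (metis card_mono finite_imageI finite_lessThan le_trans not_le)
      then obtain v where v: "v \<in> pverts G" "v \<notin> \<sigma> [] ` {..<k}" by blast
      have "enat 1 \<le> capture_round k \<sigma> (\<lambda>_. v)"
        using v(2) by (intro capture_round_geI) (auto simp: captured_in_round_def cop_positions_def)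
      then show "\<exists>\<rho>\<in>robber_plays G. enat 1 \<le> capture_round k \<sigma> \<rho>"
        using constant_robber_play[OF v(1)] by blast
    qed
    then show "1 \<le> capture_time G k" by (simp add: one_enat_def) }
  { assume le: "capture_time G k \<le> 1"
    show "\<exists>D. dominating G D \<and> card D \<le> k"
    proof (rule ccontr)
      assume no: "\<not> ?thesis"
      have "enat 2 \<le> capture_time G k"
      proof (rule capture_time_ge)
        fix \<sigma> assume \<sigma>: "\<sigma> \<in> cop_strategies G k"
        have "\<sigma> [] ` {..<k} \<subseteq> pverts G" using \<sigma> by (auto simp: cop_strategies_def)
        moreover have "\<not> dominating G (\<sigma> [] ` {..<k})" using no card_initial_cops[of \<sigma> k] by blast
        ultimately obtain v where v: "v \<in> pverts G" "v \<notin> \<sigma> [] ` {..<k}"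
          "\<And>i. i < k \<Longrightarrow> (\<sigma> [] i, v) \<notin> parcs G"
          by (auto simp: dominating_def)
        let ?\<rho> = "\<lambda>_::nat. v"
        have "\<sigma> [v] i \<noteq> v" if "i < k" for i
          using cop_first_move[OF \<sigma> constant_robber_play[OF v(1)] that] v(2) v(3)[OF that] that
          by (auto simp: legal_move_def)
        then have "\<not> captured_in_round k \<sigma> ?\<rho> s" if "s < 2" for s
          using v(2) that by (auto simp: captured_in_round_def cop_positions_def less_2_cases_iff)
        then have "enat 2 \<le> capture_round k \<sigma> ?\<rho>" by (rule capture_round_geI)
        then show "\<exists>\<rho>\<in>robber_plays G. enat 2 \<le> capture_round k \<sigma> \<rho>"
          using constant_robber_play[OF v(1)] by (intro bexI[of _ ?\<rho>]) auto
      qed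
      then show False using le by (cases "capture_time G k") (auto simp: one_enat_def)
    qed }
  { fix D assume D: "dominating G D"
    obtain e where e: "e ` {..<card D} = D"
      using ex_bij_betw_nat_finite[OF dominating_finite[OF D]]
      by (auto simp: bij_betw_def atLeast0LessThan)
    \<comment> \<open>Each cop jumps to the first robber position if it can and otherwise stays at
      its place in D. As only \<open>hd h\<close> matters, the cops stand still after round 1 and
      all later moves are legal.\<close>
    define \<sigma> where "\<sigma> h i = (if h \<noteq> [] \<and> legal_move G (e i) (hd h) then hd h else e i)" for h i
    have eV: "e i \<in> pverts G" if "i < card D" for i
      using that D e unfolding dominating_def by blast
    have pos: "cop_positions \<sigma> \<rho> (Suc t) = \<sigma> [\<rho> 0]" for \<rho> t
      by (simp add: cop_positions_def \<sigma>_def fun_eq_iff hd_map upt_rec)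
    have "\<sigma> \<in> cop_strategies G (card D)"
      unfolding cop_strategies_def
    proof (intro CollectI conjI ballI allI impI)
      fix i assume "i < card D"
      then show "\<sigma> [] i \<in> pverts G" using eV by (simp add: \<sigma>_def)
    next
      fix \<rho> t i assume "\<rho> \<in> robber_plays G" "i < card D"
      show "legal_move G (cop_positions \<sigma> \<rho> t i) (cop_positions \<sigma> \<rho> (Suc t) i)"
      proof (cases t)
        case 0
        show ?thesis unfolding 0 pos by (auto simp: cop_positions_def \<sigma>_def legal_move_def)
      next
        case (Suc s)
        show ?thesis unfolding Suc pos by (simp add: legal_move_def)
      qed
    qed
    moreover have "capture_round (card D) \<sigma> \<rho> \<le> enat 1" if \<rho>: "\<rho> \<in> robber_plays G" for \<rho>
    proof (rule capture_round_le)
      have "\<rho> 0 \<in> pverts G" using \<rho> by (simp add: robber_plays_def)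
      then obtain d where d: "d \<in> D" "legal_move G d (\<rho> 0)"
        using D unfolding dominating_def legal_move_def by (cases "\<rho> 0 \<in> D") auto
      then have "d \<in> e ` {..<card D}" using e by simp
      then obtain i where "i < card D" "legal_move G (e i) (\<rho> 0)" using d(2) by auto
      then show "captured_in_round (card D) \<sigma> \<rho> 1"
        using pos[of \<rho> 0] by (auto simp: captured_in_round_def \<sigma>_def)
    qed
    ultimately show "capture_time G (card D) \<le> 1" unfolding one_enat_def by (rule capture_time_le) }
  { obtain e where e: "e ` {..<order G} = pverts G"
      using ex_bij_betw_nat_finite[OF pair_finite_verts]
      by (auto simp: bij_betw_def atLeast0LessThan order_def)
    have "(\<lambda>_. e) \<in> cop_strategies G (order G)"
      using e by (auto simp: cop_strategies_def legal_move_def cop_positions_def)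
    moreover have "capture_round (order G) (\<lambda>_. e) \<rho> \<le> enat 0" if \<rho>: "\<rho> \<in> robber_plays G" for \<rho>
    proof (rule capture_round_le)
      have "\<rho> 0 \<in> e ` {..<order G}" using \<rho> e by (simp add: robber_plays_def)
      then show "captured_in_round (order G) (\<lambda>_. e) \<rho> 0"
        by (auto simp: captured_in_round_def cop_positions_def)
    qed
    ultimately have "capture_time G (order G) \<le> enat 0" by (rule capture_time_le)
    then show "capture_time G (order G) = 0" by (simp flip: zero_enat_def) }
qed

section \<open>Power domination and four-cycles\<close>

lemma th_times_le_enat:
  assumes "1 \<le> k" "k \<le> order G" "pt G k \<le> enat t"
  shows "th_times pt G \<le> enat (k * (1 + t))"
proof -
  have "th_times pt G \<le> enat k * (1 + pt G k)"
    unfolding th_times_def using assms by (intro INF_lower) auto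
  also have "\<dots> \<le> enat k * (1 + enat t)"
    using assms by (intro mult_left_mono add_mono) auto
  finally show ?thesis by (simp add: one_enat_def)
qed

context pair_graph
begin

lemma pd_set_two_eq:
  assumes "B \<subseteq> pverts G" and S: "S = B \<union> (\<Union>v\<in>B. neighbors G v)"
    and forced: "\<And>w. w \<in> pverts G - S \<Longrightarrow> \<exists>v\<in>S. neighbors G v - S = {w}"
  shows "pd_set G B 2 = pverts G"
proof -
  have nV: "neighbors G v \<subseteq> pverts G" for v using edge_verts by (auto simp: neighbors_def)
  have "pd_set G B 2 = S \<union> {w. \<exists>v\<in>S. neighbors G v - S = {w}}"
    unfolding numeral_2_eq_2 pd_set.simps S ..
  moreover have "S \<subseteq> pverts G" using assms(1) nV by (simp add: S UN_subset_iff)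
  moreover have "w \<in> pverts G" if "neighbors G v - S = {w}" for v w using that nV by blast
  ultimately show ?thesis using forced by auto
qed

text \<open>In the complement the leaf v is adjacent to everything but its one neighbour u. Since u
  alone does not dominate G, some w is adjacent to u in the complement, and u is then the only
  vertex that w can force.\<close>

lemma pd_time_compl_leaf:
  assumes v: "v \<in> pverts G" "neighbors G v = {u}" and g: "2 \<le> domination_number G"
  shows "pd_time (graph_compl G) 1 \<le> enat 2"
proof -
  interpret C: pair_graph "graph_compl G" by (rule pair_graph_compl)
  let ?V = "pverts G" and ?H = "graph_compl G"
  have uv: "(v, u) \<in> parcs G" using v(2) by (auto simp: neighbors_def)
  then have u: "u \<in> ?V" "u \<noteq> v" using edge_verts by auto
  then obtain w where w: "w \<in> ?V" "w \<noteq> u" "(u, w) \<notin> parcs G"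
    using g not_dominating_ex[of "{u}"] by auto
  have "pd_set ?H {v} 2 = pverts ?H"
  proof (rule C.pd_set_two_eq)
    show "?V - {u} = {v} \<union> (\<Union>v\<in>{v}. neighbors ?H v)"
      using u v by (auto simp: neighbors_def)
    have "neighbors ?H w - (?V - {u}) = {u}" using w u edge_commute by (auto simp: neighbors_def)
    then show "\<exists>x\<in>?V - {u}. neighbors ?H x - (?V - {u}) = {y}" if "y \<in> pverts ?H - (?V - {u})" for y
      using w that by auto
  qed (use v in simp)
  then show ?thesis using C.pd_time_le[of "{v}" 2] v(1) by simp
qed

text \<open>
  The parts of the partition in \<open>ex_dominating_partition\<close> have two vertices each, and \<open>\<alpha>\<close> swaps
  them.  Since one vertex from each of the other pairs cannot dominate, the neighbours of \<open>x\<close> and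
  \<open>\<alpha> x\<close> outside \<open>{x, \<alpha> x}\<close> lie in a single pair.
\<close>

lemma ex_four_cycle_maps:
  assumes h: "domination_number (graph_compl G) = 2" and g: "2 * domination_number G = order G"
    and no_leaf: "\<And>v u. v \<in> pverts G \<Longrightarrow> neighbors G v \<noteq> {u}"
  shows "\<exists>\<alpha> \<beta>. \<forall>x\<in>pverts G. neighbors G x = {\<alpha> x, \<beta> x} \<and> \<alpha> x \<noteq> \<beta> x \<and>
    \<alpha> (\<alpha> x) = x \<and> \<beta> (\<beta> x) = x \<and> \<alpha> (\<beta> x) = \<beta> (\<alpha> x)"
proof -
  let ?V = "pverts G"
  interpret C: pair_graph "graph_compl G" by (rule pair_graph_compl)
  obtain D where D: "dominating G D" "card D = domination_number G" by (rule ex_minimum_dominating)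
  obtain f where "\<forall>x\<in>?V. f x \<in> D" "\<forall>d\<in>D. f d = d" "\<forall>x\<in>?V. x \<noteq> f x \<longrightarrow> (f x, x) \<in> parcs G"
    "\<forall>d\<in>D. dominating (graph_compl G) {x \<in> ?V. f x = d}"
    using ex_dominating_partition[OF D] by blast
  note f = this[rule_format]
  have finD: "finite D" using D(1) by (rule dominating_finite)
  have DV: "D \<subseteq> ?V" using D by (simp add: dominating_def)
  define P where "P d = {x \<in> ?V. f x = d}" for d
  have ge: "2 \<le> card (P d)" if "d \<in> D" for d
    using C.domination_number_le[OF f(4)[OF that]] h by (simp add: P_def)
  \<comment> \<open>The parts have at least two vertices each, and by \<open>g\<close> this lower
    bound already adds up to the order, so every part has exactly two.\<close>
  have "(\<Sum>d\<in>D. card (P d)) = (\<Sum>d\<in>D. 2)"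
    using card_eq_sum_fibres[of ?V D f] finD f(1) g D(2) pair_finite_verts by (simp add: order_def P_def)
  then have c2: "card (P d) = 2" if "d \<in> D" for d
    using sum_mono_inv[of "\<lambda>_. 2" D "\<lambda>d. card (P d)" d] ge finD that by auto
  have "\<forall>x. \<exists>y. x \<in> ?V \<longrightarrow> P (f x) = {x, y} \<and> y \<noteq> x"
  proof (intro allI)
    fix x
    show "\<exists>y. x \<in> ?V \<longrightarrow> P (f x) = {x, y} \<and> y \<noteq> x"
    proof (cases "x \<in> ?V")
      case True
      then have "x \<in> P (f x)" by (simp add: P_def)
      moreover obtain a b where "P (f x) = {a, b}" "a \<noteq> b"
        using c2[OF f(1)[OF True]] unfolding card_2_iff by auto
      ultimately show ?thesis by (cases "x = a") (auto simp: doubleton_eq_iff)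
    qed simp
  qed
  then obtain \<alpha> where \<alpha>: "\<And>x. x \<in> ?V \<Longrightarrow> P (f x) = {x, \<alpha> x}" "\<And>x. x \<in> ?V \<Longrightarrow> \<alpha> x \<noteq> x"
    by metis
  have \<alpha>V: "\<alpha> x \<in> ?V" "f (\<alpha> x) = f x" if "x \<in> ?V" for x
    using \<alpha>(1)[OF that] by (auto simp: P_def)
  have \<alpha>2: "\<alpha> (\<alpha> x) = x" if "x \<in> ?V" for x
    using \<alpha>[OF that] \<alpha>[OF \<alpha>V(1)[OF that]] \<alpha>V[OF that] by auto
  have same: "y = x \<or> y = \<alpha> x" if "x \<in> ?V" "y \<in> ?V" "f x = f y" for x y
    using \<alpha>(1)[OF that(1)] that by (auto simp: P_def)
  have \<alpha>e: "(x, \<alpha> x) \<in> parcs G" if x: "x \<in> ?V" for x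
  proof (cases "f x = x")
    case True
    then show ?thesis using f(3)[OF \<alpha>V(1)[OF x]] \<alpha>V[OF x] \<alpha>(2)[OF x] by simp
  next
    case False
    have fx: "f x \<in> ?V" "f (f x) = f x" using f(1)[OF x] f(2) DV by auto
    then have "f x = \<alpha> x" using same[OF x, of "f x"] False by auto
    then show ?thesis using f(3)[OF x] False edge_commute by auto
  qed
  have key: "neighbors G (\<alpha> x) \<subseteq> {x, \<alpha> a}" if x: "x \<in> ?V" and a: "(x, a) \<in> parcs G" "a \<noteq> \<alpha> x" for x a
  proof
    fix b assume "b \<in> neighbors G (\<alpha> x)"
    then have b: "(\<alpha> x, b) \<in> parcs G" by simp
    show "b \<in> {x, \<alpha> a}"
    proof (rule ccontr)
      assume no: "b \<notin> {x, \<alpha> a}"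
      have V: "a \<in> ?V" "b \<in> ?V" "a \<noteq> x" "b \<noteq> \<alpha> x" using a b edge_verts by auto
      have fa: "f a \<noteq> f x" using same[OF x V(1)] V a by auto
      have fb: "f b \<noteq> f x" using same[OF x V(2)] V no by auto
      \<comment> \<open>The centres of three pairs are traded for a and b, which cover their own
        pairs and, between them, both x and \<open>\<alpha> x\<close>. If a and b lie in the same
        pair, then a = b and two centres are traded for one; either way D was not minimum.\<close>
      let ?T = "(D - {f x, f a, f b}) \<union> {a, b}"
      have "dominating G ?T"
        unfolding dominating_def
      proof (intro conjI ballI)
        show "?T \<subseteq> ?V" using DV V by auto
        fix y assume y: "y \<in> ?V - ?T"
        consider "f y = f x" | "f y = f a" | "f y = f b" | "f y \<in> D - {f x, f a, f b}"
          using f(1) y by blast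
        then show "\<exists>d\<in>?T. (d, y) \<in> parcs G"
        proof cases
          case 1
          then have "y = x \<or> y = \<alpha> x" using same[OF x, of y] y by auto
          then show ?thesis using a b edge_commute by blast
        next
          case 2
          then have "y = \<alpha> a" using same[OF V(1), of y] y by auto
          then show ?thesis using \<alpha>e[OF V(1)] by blast
        next
          case 3
          then have "y = \<alpha> b" using same[OF V(2), of y] y by auto
          then show ?thesis using \<alpha>e[OF V(2)] by blast
        next
          case 4
          then have "y \<noteq> f y" using y by auto
          then show ?thesis using 4 f(3)[of y] y by blast
        qed
      qed
      then have "card D \<le> card ?T" using domination_number_le D(2) by simp
      also have "\<dots> \<le> card (D - {f x, f a, f b}) + card {a, b}" by (rule card_Un_le)
      also have "card (D - {f x, f a, f b}) = card D - card {f x, f a, f b}"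
        using f(1) x V by (intro card_Diff_subset) auto
      finally have le: "card D \<le> card D - card {f x, f a, f b} + card {a, b}" .
      have c: "card {f x, f a, f b} \<le> card D" using f(1) x V finD by (intro card_mono) auto
      have "card {a, b} < card {f x, f a, f b}"
      proof (cases "f a = f b")
        case True
        then have "a = b" using same[OF V(1,2)] no by auto
        then show ?thesis using fa fb by auto
      qed (use fa fb in \<open>auto simp: card_insert_if\<close>)
      then show False using le c by linarith
    qed
  qed
  have ex: "\<exists>a. (x, a) \<in> parcs G \<and> a \<noteq> \<alpha> x" if x: "x \<in> ?V" for x
    using no_leaf[OF x, of "\<alpha> x"] \<alpha>e[OF x] by (auto simp: neighbors_def)
  then obtain \<beta> where \<beta>: "\<And>x. x \<in> ?V \<Longrightarrow> (x, \<beta> x) \<in> parcs G" "\<And>x. x \<in> ?V \<Longrightarrow> \<beta> x \<noteq> \<alpha> x"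
    by metis
  have \<beta>V: "\<beta> x \<in> ?V" if "x \<in> ?V" for x using \<beta>(1)[OF that] edge_verts by blast
  have \<beta>a: "\<beta> (\<alpha> x) = \<alpha> (\<beta> x)" if x: "x \<in> ?V" for x
    using key[OF x \<beta>(1)[OF x] \<beta>(2)[OF x]] \<beta>[OF \<alpha>V(1)[OF x]] \<alpha>2[OF x] by auto
  have N: "neighbors G x = {\<alpha> x, \<beta> x}" if x: "x \<in> ?V" for x
  proof -
    have "(\<alpha> x, \<alpha> (\<beta> x)) \<in> parcs G" using \<beta>(1)[OF \<alpha>V(1)[OF x]] \<beta>a[OF x] by simp
    moreover have "\<alpha> (\<beta> x) \<noteq> \<alpha> (\<alpha> x)" using \<beta>(2)[OF x] \<alpha>2 x \<beta>V \<alpha>V by metis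
    ultimately have "neighbors G (\<alpha> (\<alpha> x)) \<subseteq> {\<alpha> x, \<alpha> (\<alpha> (\<beta> x))}"
      using key[OF \<alpha>V(1)[OF x]] by blast
    then show ?thesis using \<alpha>2[OF x] \<alpha>2[OF \<beta>V[OF x]] \<alpha>e[OF x] \<beta>(1)[OF x] by auto
  qed
  have \<beta>2: "\<beta> (\<beta> x) = x" if x: "x \<in> ?V" for x
  proof -
    have "x \<in> neighbors G (\<beta> x)" using \<beta>(1)[OF x] edge_commute by simp
    moreover have "x \<noteq> \<alpha> (\<beta> x)" using \<beta>(2)[OF x] \<alpha>2 \<beta>V[OF x] by metis
    ultimately show ?thesis using N[OF \<beta>V[OF x]] by auto
  qed
  show ?thesis by (intro exI[of _ \<alpha>] exI[of _ \<beta>]) (use N \<beta>(2)[symmetric] \<alpha>2 \<beta>2 \<beta>a in auto)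
qed

text \<open>One vertex is chosen from each four-cycle \<open>Q x\<close>. Its two neighbours are
  reached in the first step and the opposite vertex is forced in the second.\<close>

lemma pd_time_four_cycles:
  assumes N: "\<And>x. x \<in> pverts G \<Longrightarrow> neighbors G x = {\<alpha> x, \<beta> x}"
    and d: "\<And>x. x \<in> pverts G \<Longrightarrow> \<alpha> x \<noteq> \<beta> x"
    and \<alpha>: "\<And>x. x \<in> pverts G \<Longrightarrow> \<alpha> (\<alpha> x) = x" and \<beta>: "\<And>x. x \<in> pverts G \<Longrightarrow> \<beta> (\<beta> x) = x"
    and \<alpha>b: "\<And>x. x \<in> pverts G \<Longrightarrow> \<alpha> (\<beta> x) = \<beta> (\<alpha> x)"
  obtains k where "4 * k = order G" "pd_time G k \<le> enat 2"
proof -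
  let ?V = "pverts G"
  have V: "\<alpha> x \<in> ?V" "\<beta> x \<in> ?V" "\<alpha> x \<noteq> x" "\<beta> x \<noteq> x" if "x \<in> ?V" for x
  proof -
    have "(x, \<alpha> x) \<in> parcs G" "(x, \<beta> x) \<in> parcs G" using N[OF that] by (auto simp: neighbors_def)
    then show "\<alpha> x \<in> ?V" "\<beta> x \<in> ?V" "\<alpha> x \<noteq> x" "\<beta> x \<noteq> x" using edge_verts by metis+
  qed
  define Q where "Q x = {x, \<alpha> x, \<beta> x, \<alpha> (\<beta> x)}" for x
  have QV: "Q x \<subseteq> ?V" if "x \<in> ?V" for x using V that by (auto simp: Q_def)
  have Qc: "card (Q x) = 4" if x: "x \<in> ?V" for x
  proof -
    have "\<alpha> (\<beta> x) \<noteq> x" using d[OF x] \<alpha>[OF V(2)[OF x]] by metis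
    moreover have "\<alpha> (\<beta> x) \<noteq> \<alpha> x" using \<alpha>[OF V(2)[OF x]] \<alpha>[OF x] V(4)[OF x] by metis
    moreover have "\<alpha> (\<beta> x) \<noteq> \<beta> x" using V(3)[OF V(2)[OF x]] .
    ultimately show ?thesis using V[OF x] d[OF x] by (auto simp: Q_def card_insert_if)
  qed
  have Qe: "Q y = Q x" if x: "x \<in> ?V" and y: "y \<in> Q x" for x y
  proof -
    have "\<alpha> (\<beta> (\<alpha> x)) = \<beta> x" "\<beta> (\<alpha> (\<beta> x)) = \<alpha> x" "\<alpha> (\<alpha> (\<beta> x)) = \<beta> x" "\<alpha> (\<beta> (\<alpha> (\<beta> x))) = x"
      using \<alpha> \<beta> \<alpha>b V x by metis+
    then show ?thesis using y \<alpha>[OF x] \<beta>[OF x] \<alpha>b[OF x] by (auto simp: Q_def)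
  qed
  let ?C = "Q ` ?V"
  have "\<Union>?C = ?V" using QV by (auto simp: Q_def)
  have 4: "4 * card ?C = order G"
  proof -
    have "4 * card ?C = card (\<Union>?C)"
    proof (rule card_partition)
      fix A B assume "A \<in> ?C" "B \<in> ?C" "A \<noteq> B"
      then show "A \<inter> B = {}" using Qe by blast
    qed (use Qc \<open>\<Union>?C = ?V\<close> pair_finite_verts in auto)
    then show ?thesis using \<open>\<Union>?C = ?V\<close> by (simp add: order_def)
  qed
  define r where "r A = (SOME x. x \<in> A)" for A :: "'a set"
  have r: "r (Q x) \<in> Q x" for x unfolding r_def by (rule someI[of _ x]) (simp add: Q_def)
  let ?B = "r ` ?C"
  have "Q (r (Q x)) = Q x" if "x \<in> ?V" for x using Qe[OF that r] .
  then have "inj_on r ?C" by (intro inj_on_inverseI[of _ Q]) auto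
  then have cB: "card ?B = card ?C" by (rule card_image)
  have BV: "?B \<subseteq> ?V" using r QV by auto
  define S where "S = ?B \<union> (\<Union>b\<in>?B. neighbors G b)"
  have S: "b \<in> S" "\<alpha> b \<in> S" "\<beta> b \<in> S" if "b \<in> ?B" for b
    using that BV N[of b] unfolding S_def by blast+
  have "pd_set G ?B 2 = ?V"
  proof (rule pd_set_two_eq[OF BV S_def])
    fix y assume y: "y \<in> ?V - S"
    define b where "b = r (Q y)"
    have b: "b \<in> ?B" "b \<in> ?V" using y BV by (auto simp: b_def)
    have "y \<in> Q b" using Qe[OF _ r] y by (simp add: b_def Q_def)
    \<comment> \<open>Only the vertex opposite to b is missing from its cycle. The vertex
      \<open>\<alpha> b\<close> has b and y as its only neighbours, so it forces y.\<close>
    then have "y = \<alpha> (\<beta> b)" using S[OF b(1)] y by (auto simp: Q_def)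
    then have "neighbors G (\<alpha> b) = {b, y}" using N[OF V(1)[OF b(2)]] \<alpha>[OF b(2)] \<alpha>b[OF b(2)] by simp
    then have "neighbors G (\<alpha> b) - S = {y}" using y S(1)[OF b(1)] by auto
    then show "\<exists>x\<in>S. neighbors G x - S = {y}" using S(2)[OF b(1)] by blast
  qed
  then have "pd_time G (card ?B) \<le> enat 2" by (rule pd_time_le[OF BV])
  then show ?thesis using that 4 cB by simp
qed

text \<open>A leaf gives the complement cost 1 * 3; disjoint four-cycles give G cost 3n/4, which is
  less than n. In both cases one factor falls below what domination alone yields.\<close>

lemma pd_th_times_extremal:
  assumes n: "5 \<le> order G" and h: "domination_number (graph_compl G) = 2"
    and g: "2 * domination_number G = order G"
  shows "th_times pd_time G \<le> enat (order G - 1) \<or> th_times pd_time (graph_compl G) \<le> 3"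
proof (cases "\<exists>v\<in>pverts G. \<exists>u. neighbors G v = {u}")
  case True
  then obtain v u where "v \<in> pverts G" "neighbors G v = {u}" by blast
  then have "pd_time (graph_compl G) 1 \<le> enat 2" using g n by (intro pd_time_compl_leaf) auto
  then have "th_times pd_time (graph_compl G) \<le> enat (1 * (1 + 2))"
    using n by (intro th_times_le_enat) auto
  then show ?thesis by (simp add: numeral_eq_enat eval_nat_numeral)
next
  case False
  then obtain \<alpha> \<beta> where "\<forall>x\<in>pverts G. neighbors G x = {\<alpha> x, \<beta> x} \<and> \<alpha> x \<noteq> \<beta> x \<and>
    \<alpha> (\<alpha> x) = x \<and> \<beta> (\<beta> x) = x \<and> \<alpha> (\<beta> x) = \<beta> (\<alpha> x)"
    using ex_four_cycle_maps[OF h g] by blast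
  then obtain k where k: "4 * k = order G" "pd_time G k \<le> enat 2"
    using pd_time_four_cycles[of \<alpha> \<beta>] by blast
  then have "th_times pd_time G \<le> enat (k * (1 + 2))"
    using n by (intro th_times_le_enat) auto
  also have "\<dots> \<le> enat (order G - 1)" using k(1) n by simp
  finally show ?thesis ..
qed

text \<open>Domination alone gives 2(g + h) \<le> gh + 4 \<le> n + 4. One unit is saved in every
  case: if gh < n at the second inequality, if both numbers are at least 3 at the first, and
  otherwise by \<open>pd_th_times_extremal\<close>.\<close>

lemma pd_th_times_bounds:
  assumes n: "5 \<le> order G"
  shows "th_times pd_time G + th_times pd_time (graph_compl G) \<le> enat (order G + 3)"
    and "th_times pd_time G * th_times pd_time (graph_compl G) = enat (4 * order G) \<Longrightarrow>
      3 \<le> domination_number G \<and> 3 \<le> domination_number (graph_compl G) \<and>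
      domination_number G * domination_number (graph_compl G) = order G"
proof -
  let ?H = "graph_compl G"
  interpret C: pair_graph ?H by (rule pair_graph_compl)
  define g h m where gh: "g = domination_number G" "h = domination_number ?H" "m = order G"
  note G = pair_graph and H = pair_graph_compl
  have ne: "pverts G \<noteq> {}" "pverts ?H \<noteq> {}" using n by (auto simp: order_def)
  obtain a b where ab: "th_times pd_time G = enat a" "th_times pd_time ?H = enat b"
    using pd.th_times_le_order[OF G ne(1)] pd.th_times_le_order[OF H ne(2)] by (metis enat_ile)
  have ub: "a \<le> 2 * g" "b \<le> 2 * h" "a \<le> m" "b \<le> m"
    using pd.th_times_le_order[OF G ne(1)] pd.th_times_le_order[OF H ne(2)]
      pd.th_times_le_domination_number[OF G ne(1)] pd.th_times_le_domination_number[OF H ne(2)]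
    by (auto simp: ab gh)
  have prod: "g * h \<le> m" using domination_numbers_product_le by (simp add: gh)
  have pos: "1 \<le> g" "1 \<le> h" using domination_number_pos C.domination_number_pos ne by (auto simp: gh)
  have m: "5 \<le> m" using n by (simp add: gh)
  have extremal: "a \<le> m - 1 \<or> b \<le> 3" if "h = 2" "2 * g = m"
    using pd_th_times_extremal[OF n] that by (auto simp: ab gh numeral_eq_enat)
  have extremal': "b \<le> m - 1 \<or> a \<le> 3" if "g = 2" "2 * h = m"
    using C.pd_th_times_extremal n that by (auto simp: ab gh numeral_eq_enat)
  have "a + b \<le> m + 3 \<and> (a * b = 4 * m \<longrightarrow> 3 \<le> g \<and> 3 \<le> h \<and> g * h = m)"
  proof (cases "g = 1 \<or> h = 1")
    case True
    then have "a \<le> 2 \<or> b \<le> 2" using ub by auto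
    then have "a * b \<le> 2 * m" using ub mult_le_mono[of a 2 b m] mult_le_mono[of a m b 2] by auto
    then show ?thesis using ub m \<open>a \<le> 2 \<or> b \<le> 2\<close> by auto
  next
    case False
    then have 2: "2 \<le> g" "2 \<le> h" using pos by auto
    have ab4: "a * b \<le> 4 * (g * h)" using mult_le_mono[OF ub(1,2)] by simp
    show ?thesis
    proof (cases "g = 2 \<or> h = 2")
      case two: True
      show ?thesis
      proof (cases "g * h = m")
        case True
        then have "(a \<le> m - 1 \<and> b \<le> 4) \<or> (b \<le> 3 \<and> a \<le> m) \<or> (b \<le> m - 1 \<and> a \<le> 4) \<or> (a \<le> 3 \<and> b \<le> m)"
          using two extremal extremal' ub by auto
        then have "a * b < 4 * m \<and> a + b \<le> m + 3"
        proof (elim disjE conjE)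
          assume "a \<le> m - 1" "b \<le> 4"
          then show ?thesis using mult_le_mono[of a "m - 1" b 4] m by auto
        next
          assume "b \<le> 3" "a \<le> m"
          then show ?thesis using mult_le_mono[of a m b 3] m by auto
        next
          assume "b \<le> m - 1" "a \<le> 4"
          then show ?thesis using mult_le_mono[of a 4 b "m - 1"] m by auto
        next
          assume "a \<le> 3" "b \<le> m"
          then show ?thesis using mult_le_mono[of a 3 b m] m by auto
        qed
        then show ?thesis by auto
      next
        case False
        then have "g * h < m" using prod by simp
        then show ?thesis using two_sum_le_product[OF 2] ub ab4 by auto
      qed
    next
      case False
      then obtain i j where ij: "g = 3 + i" "h = 3 + j" using 2 le_Suc_ex[of 3] by (metis One_nat_def Suc_1 Suc_leI le_neq_implies_less numeral_3_eq_3)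
      \<comment> \<open>Now (g - 2)(h - 2) \<ge> 1 improves the general constant 4 to 3.\<close>
      then have "2 * (g + h) \<le> g * h + 3" by (simp add: algebra_simps)
      then show ?thesis using ub prod ab4 ij by auto
    qed
  qed
  then show "th_times pd_time G + th_times pd_time (graph_compl G) \<le> enat (order G + 3)"
    and "th_times pd_time G * th_times pd_time (graph_compl G) = enat (4 * order G) \<Longrightarrow>
      3 \<le> domination_number G \<and> 3 \<le> domination_number (graph_compl G) \<and>
      domination_number G * domination_number (graph_compl G) = order G"
    by (auto simp: ab gh)
qed

end

section \<open>Domination-balanced graphs\<close>

definition common_neighbors :: "'a pair_pre_digraph \<Rightarrow> 'a set \<Rightarrow> 'a set" where
  "common_neighbors G C = {z \<in> pverts G. \<forall>c\<in>C. (c, z) \<in> parcs G}"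

abbreviation degree :: "'a pair_pre_digraph \<Rightarrow> 'a \<Rightarrow> nat" where
  "degree G v \<equiv> card (neighbors G v)"

abbreviation codegree :: "'a pair_pre_digraph \<Rightarrow> 'a \<Rightarrow> 'a \<Rightarrow> nat" where
  "codegree G u v \<equiv> card (common_neighbors G {u, v})"

context pair_graph
begin

lemma neighbors_subset: "neighbors G v \<subseteq> pverts G"
  using edge_verts by (auto simp: neighbors_def)

lemma finite_neighbors: "finite (neighbors G v)"
  using neighbors_subset pair_finite_verts by (rule finite_subset)

lemma common_neighbors_subset: "common_neighbors G C \<subseteq> pverts G"
  by (auto simp: common_neighbors_def)

lemma finite_common_neighbors: "finite (common_neighbors G C)"
  using common_neighbors_subset pair_finite_verts by (rule finite_subset)

lemma common_neighbors_singleton: "v \<in> pverts G \<Longrightarrow> common_neighbors G {v} = neighbors G v"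
  using edge_verts by (auto simp: common_neighbors_def)

lemma common_neighbors_pair: "common_neighbors G {u, v} = neighbors G u \<inter> neighbors G v"
  using edge_verts by (auto simp: common_neighbors_def)

text \<open>A set too small to dominate the complement leaves some outside vertex undominated there,
  and that vertex is adjacent in G to the whole set.\<close>

lemma common_neighbors_nonempty:
  assumes "S \<subseteq> pverts G" "card S < domination_number (graph_compl G)"
  shows "common_neighbors G S \<noteq> {}"
proof -
  interpret C: pair_graph "graph_compl G" by (rule pair_graph_compl)
  obtain v where "v \<in> pverts G" "v \<notin> S" "\<And>d. d \<in> S \<Longrightarrow> (d, v) \<notin> parcs (graph_compl G)"
    using C.not_dominating_ex assms by (metis graph_compl_simps(1))
  then have "v \<in> common_neighbors G S" using assms(1) by (auto simp: common_neighbors_def)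
  then show ?thesis by blast
qed

lemma neighbors_compl: "v \<in> pverts G \<Longrightarrow> neighbors (graph_compl G) v = pverts G - {v} - neighbors G v"
  by (auto simp: neighbors_def)

lemma degree_compl:
  assumes "v \<in> pverts G" shows "degree G v + degree (graph_compl G) v + 1 = order G"
proof -
  have "v \<notin> neighbors G v" by simp
  then have "card (pverts G - {v} - neighbors G v) = card (pverts G - {v}) - degree G v"
    using neighbors_subset finite_neighbors by (intro card_Diff_subset) auto
  moreover have "degree G v \<le> card (pverts G - {v})"
    using neighbors_subset pair_finite_verts \<open>v \<notin> neighbors G v\<close> by (intro card_mono) auto
  moreover have "card (pverts G) \<ge> 1" using assms pair_finite_verts by (simp add: Suc_le_eq card_gt_0_iff) blast
  ultimately show ?thesis using assms neighbors_compl[OF assms] by (simp add: order_def)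
qed

text \<open>Both sides count the paths u - w - v with u \<noteq> v: on the left by the far end u, on
  the right by the midpoint w.\<close>

lemma sum_codegree:
  assumes v: "v \<in> pverts G"
  shows "(\<Sum>u\<in>neighbors G v. codegree G u v) + (\<Sum>u\<in>neighbors (graph_compl G) v. codegree G u v)
    = (\<Sum>w\<in>neighbors G v. degree G w - 1)"
proof -
  let ?N = "neighbors G v" and ?V = "pverts G"
  have split: "?V - {v} = ?N \<union> neighbors (graph_compl G) v"
    using neighbors_compl[OF v] neighbors_subset[of v] by auto
  have "?N \<inter> neighbors (graph_compl G) v = {}" using neighbors_compl[OF v] by auto
  then have "(\<Sum>u\<in>?N. codegree G u v) + (\<Sum>u\<in>neighbors (graph_compl G) v. codegree G u v)
      = (\<Sum>u\<in>?V - {v}. codegree G u v)"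
    unfolding split using finite_neighbors pair_finite_verts neighbors_compl[OF v]
    by (intro sum.union_disjoint[symmetric]) auto
  also have "\<dots> = (\<Sum>u\<in>?V - {v}. \<Sum>w\<in>?N. of_bool ((u, w) \<in> parcs G))"
    using finite_neighbors
    by (intro sum.cong refl) (auto simp: common_neighbors_pair sum_of_bool_eq neighbors_def intro: arg_cong[where f = card])
  also have "\<dots> = (\<Sum>w\<in>?N. \<Sum>u\<in>?V - {v}. of_bool ((u, w) \<in> parcs G))"
    by (rule sum.swap)
  also have "\<dots> = (\<Sum>w\<in>?N. degree G w - 1)"
  proof (rule sum.cong[OF refl])
    fix w assume w: "w \<in> ?N"
    have "(\<Sum>u\<in>?V - {v}. of_bool ((u, w) \<in> parcs G)) = card ((?V - {v}) \<inter> {u. (u, w) \<in> parcs G})"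
      using pair_finite_verts by (simp add: sum_of_bool_eq)
    also have "(?V - {v}) \<inter> {u. (u, w) \<in> parcs G} = neighbors G w - {v}"
      using edge_verts edge_commute by (auto simp: neighbors_def)
    also have "card \<dots> = degree G w - 1"
      using w edge_commute finite_neighbors by (intro card_Diff_singleton) auto
    finally show "(\<Sum>u\<in>?V - {v}. of_bool ((u, w) \<in> parcs G)) = degree G w - 1" .
  qed
  finally show ?thesis .
qed

lemma sum_degree_const:
  assumes "\<And>w. w \<in> pverts G \<Longrightarrow> degree G w = k"
  shows "(\<Sum>w\<in>neighbors G v. degree G w - 1) = degree G v * (k - 1)"
proof -
  have "(\<Sum>w\<in>neighbors G v. degree G w - 1) = (\<Sum>w\<in>neighbors G v. k - 1)"
    using assms neighbors_subset by (intro sum.cong refl) (metis subsetD)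
  then show ?thesis by simp
qed

text \<open>Inclusion and exclusion for the closed neighbourhoods of u and v. Their intersection
  also contains u and v themselves exactly when these are adjacent, which explains the term
  2.\<close>

lemma codegree_compl:
  assumes u: "u \<in> pverts G" and v: "v \<in> pverts G" and "u \<noteq> v"
  shows "codegree (graph_compl G) u v + degree G u + degree G v + 2
    = order G + codegree G u v + (if (u, v) \<in> parcs G then 2 else 0)"
proof -
  interpret C: pair_graph "graph_compl G" by (rule pair_graph_compl)
  let ?A = "insert u (neighbors G u)" and ?B = "insert v (neighbors G v)"
  have fin: "finite ?A" "finite ?B" using finite_neighbors by auto
  have sub: "?A \<union> ?B \<subseteq> pverts G" using u v neighbors_subset by auto
  have "common_neighbors (graph_compl G) {u, v} = pverts G - (?A \<union> ?B)"
    using u v by (auto simp: C.common_neighbors_pair neighbors_compl)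
  then have "codegree (graph_compl G) u v + card (?A \<union> ?B) = order G"
    using card_Diff_subset[OF _ sub] card_mono[OF pair_finite_verts sub] fin
    by (simp add: order_def)
  moreover have "card (?A \<union> ?B) + card (?A \<inter> ?B) = degree G u + degree G v + 2"
    using card_Un_Int[OF fin] finite_neighbors by simp
  moreover have "card (?A \<inter> ?B) = codegree G u v + (if (u, v) \<in> parcs G then 2 else 0)"
  proof (cases "(u, v) \<in> parcs G")
    case True
    then have "?A \<inter> ?B = insert u (insert v (neighbors G u \<inter> neighbors G v))"
      using edge_commute by auto
    then show ?thesis using True \<open>u \<noteq> v\<close> finite_neighbors
      by (simp add: common_neighbors_pair card_insert_if)
  next
    case False
    then have "?A \<inter> ?B = neighbors G u \<inter> neighbors G v"
      using edge_commute \<open>u \<noteq> v\<close> by auto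
    then show ?thesis using False by (simp add: common_neighbors_pair)
  qed
  ultimately show ?thesis by simp
qed

text \<open>The handshake lemma for the subgraph induced on A: a new vertex x contributes its degree
  into A twice.\<close>

lemma even_sum_degrees_within:
  assumes "finite A" shows "even (\<Sum>u\<in>A. card (neighbors G u \<inter> A))"
  using assms
proof induction
  case (insert x A)
  have "card (neighbors G x \<inter> insert x A) = card (neighbors G x \<inter> A)" by simp
  moreover have "(\<Sum>u\<in>A. card (neighbors G u \<inter> insert x A)) =
      (\<Sum>u\<in>A. card (neighbors G u \<inter> A) + of_bool ((x, u) \<in> parcs G))"
    using insert.hyps edge_commute by (intro sum.cong) (auto simp: Int_insert_right)
  moreover have "(\<Sum>u\<in>A. of_bool ((x, u) \<in> parcs G)) = card (neighbors G x \<inter> A)"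
    using insert.hyps by (auto simp: sum_of_bool_eq neighbors_def Int_commute)
  ultimately show ?case using insert by (simp add: sum.distrib)
qed simp

end

section \<open>Possible parameters of a domination-balanced graph\<close>

text \<open>Here r + 1 and s + 1 stand for the domination numbers of the complement and of G. In
  this form the hypotheses are symmetric under complementation with r and s exchanged, so each bound
  comes with a dual.\<close>

locale domination_balanced = pair_graph +
  fixes r s :: nat
  assumes common_neighbor: "\<And>S. S \<subseteq> pverts G \<Longrightarrow> card S \<le> r \<Longrightarrow> common_neighbors G S \<noteq> {}"
    and common_non_neighbor:
      "\<And>S. S \<subseteq> pverts G \<Longrightarrow> card S \<le> s \<Longrightarrow> common_neighbors (graph_compl G) S \<noteq> {}"
    and order_eq: "order G = (r + 1) * (s + 1)"
    and r2: "2 \<le> r" and s2: "2 \<le> s"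
begin

sublocale C: pair_graph "graph_compl G"
  by (rule pair_graph_compl)

lemma domination_balanced_compl: "domination_balanced (graph_compl G) s r"
  by unfold_locales
    (use common_neighbor common_non_neighbor order_eq r2 s2 in \<open>auto simp: mult.commute\<close>)

text \<open>
  A set of \<open>s\<close> common neighbours of \<open>C\<close> has a common non-neighbour \<open>z\<close>, and adding \<open>z\<close> to \<open>C\<close>
  removes all these \<open>s\<close> vertices.
\<close>

lemma card_common_neighbors:
  "C \<subseteq> pverts G \<Longrightarrow> card C + j = r \<Longrightarrow> j * s < card (common_neighbors G C)"
proof (induction j arbitrary: C)
  case 0
  then have "common_neighbors G C \<noteq> {}" by (intro common_neighbor) auto
  then show ?case using finite_common_neighbors by (simp add: card_gt_0_iff)
next
  case (Suc j)
  let ?X = "common_neighbors G C"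
  have "?X \<noteq> {}" using Suc.prems by (intro common_neighbor) auto
  \<comment> \<open>The minimum covers the case of fewer than s common neighbours: R is then all of
    them, and the final estimate reads \<open>j * s < 0\<close>.\<close>
  obtain R where R: "R \<subseteq> ?X" "card R = min s (card ?X)"
    using obtain_subset_with_card_n[of "min s (card ?X)" ?X] by auto
  have "card ?X > 0" using \<open>?X \<noteq> {}\<close> finite_common_neighbors by (simp add: card_gt_0_iff)
  then have "R \<noteq> {}" using R(2) s2 by auto
  have "R \<subseteq> pverts G" using R(1) common_neighbors_subset by blast
  then have "common_neighbors (graph_compl G) R \<noteq> {}" using R(2) by (intro common_non_neighbor) auto
  then obtain z where z: "z \<in> pverts G" "\<And>x. x \<in> R \<Longrightarrow> (x, z) \<notin> parcs G"
    by (auto simp: common_neighbors_def)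
  obtain x where "x \<in> R" using \<open>R \<noteq> {}\<close> by blast
  then have "z \<notin> C" using R(1) z(2)[of x] edge_commute by (auto simp: common_neighbors_def)
  moreover have "finite C" using Suc.prems(1) pair_finite_verts finite_subset by blast
  ultimately have "j * s < card (common_neighbors G (insert z C))"
    using Suc.prems z(1) by (intro Suc.IH) auto
  also have "common_neighbors G (insert z C) \<subseteq> ?X - R"
    using z(2) edge_commute by (auto simp: common_neighbors_def)
  then have "card (common_neighbors G (insert z C)) \<le> card (?X - R)"
    using finite_common_neighbors by (intro card_mono) auto
  also have "card (?X - R) = card ?X - card R"
    using R(1) finite_common_neighbors finite_subset by (intro card_Diff_subset) blast+
  finally show ?case using R(2) by (auto simp: min_def split: if_splits)
qed

lemma degree_ge: "v \<in> pverts G \<Longrightarrow> (r - 1) * s + 1 \<le> degree G v"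
  using card_common_neighbors[of "{v}" "r - 1"] common_neighbors_singleton[of v] r2 by simp

lemma codegree_ge: "u \<in> pverts G \<Longrightarrow> v \<in> pverts G \<Longrightarrow> u \<noteq> v \<Longrightarrow> (r - 2) * s + 1 \<le> codegree G u v"
proof -
  assume uv: "u \<in> pverts G" "v \<in> pverts G" "u \<noteq> v"
  then have "card {u, v} + (r - 2) = r" using r2 by simp
  then show ?thesis using card_common_neighbors[of "{u, v}" "r - 2"] uv by simp
qed

text \<open>The path count of \<open>sum_codegree\<close> at v, with the greedy codegree bound below
  and the maximum degree D above.\<close>

lemma order_minus_one_codegree_le:
  assumes v: "v \<in> pverts G" and D: "\<And>w. w \<in> pverts G \<Longrightarrow> degree G w \<le> D"
  shows "(order G - 1) * ((r - 2) * s + 1) \<le> degree G v * (D - 1)"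
proof -
  let ?c = "(r - 2) * s + 1"
  have *: "u \<in> neighbors G v \<or> u \<in> neighbors (graph_compl G) v \<Longrightarrow> ?c \<le> codegree G u v" for u
    using codegree_ge[of u v] v edge_verts[of v u] by (auto simp del: One_nat_def)
  have "(order G - 1) * ?c = degree G v * ?c + degree (graph_compl G) v * ?c"
    unfolding degree_compl[OF v, symmetric] by (simp add: algebra_simps)
  also have "\<dots> \<le> (\<Sum>u\<in>neighbors G v. codegree G u v) + (\<Sum>u\<in>neighbors (graph_compl G) v. codegree G u v)"
    using * by (intro add_mono sum_bounded_below[where K = ?c, simplified of_nat_id]) auto
  also have "\<dots> = (\<Sum>w\<in>neighbors G v. degree G w - 1)" by (rule sum_codegree[OF v])
  also have "\<dots> \<le> (\<Sum>w\<in>neighbors G v. D - 1)"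
    using D neighbors_subset by (intro sum_mono diff_le_mono) blast
  finally show ?thesis by simp
qed

lemma degree_le:
  assumes "v \<in> pverts G" shows "degree G v + (s - 1) * r + 2 \<le> order G"
proof -
  interpret B: domination_balanced "graph_compl G" s r by (rule domination_balanced_compl)
  show ?thesis using B.degree_ge[of v] degree_compl[OF assms] assms by simp
qed

lemma pverts_nonempty: "pverts G \<noteq> {}"
  using order_eq by (auto simp: order_def)

lemma r_eq_2_or_s_eq_2: "r = 2 \<or> s = 2"
proof (rule ccontr)
  assume neg: "\<not> ?thesis"
  then obtain i j where ij: "r = 2 + i" "s = 2 + j" "1 \<le> i" "1 \<le> j"
    using r2 s2 le_Suc_ex[of 2] by (metis One_nat_def Suc_leI add.right_neutral neq0_conv)
  obtain v where v: "v \<in> pverts G" using pverts_nonempty by blast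
  have n: "order G = (3 + i) * (3 + j)" using order_eq ij by (simp add: algebra_simps)
  \<comment> \<open>The second bound is the first one for the complement. Chaining them removes the
    degree and leaves ij \<le> 2; the three surviving orders fall to the path count, as 60 > 56, 95
    > 72 and 133 > 90.\<close>
  have "(1 + i) * (2 + j) + 1 \<le> degree G v" "degree G v + (1 + j) * (2 + i) + 2 \<le> (3 + i) * (3 + j)"
    using degree_ge[OF v] degree_le[OF v] n ij by auto
  then have "i * j \<le> 2" by (simp add: algebra_simps)
  moreover have "i \<le> i * j" "j \<le> i * j" using ij by auto
  ultimately consider "i = 1" "j = 1" | "i = 1" "j = 2" | "i = 2" "j = 1"
    using ij by (cases "i = 1"; cases "j = 1"; cases "i = 2"; cases "j = 2") auto
  then show False
  proof cases
    case 1
    then have "order G = 16" "r = 3" "s = 3" using n ij by auto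
    then have "15 * 4 \<le> degree G v * 7" "degree G v \<le> 8"
      using order_minus_one_codegree_le[OF v, of 8] degree_le v by fastforce+
    then show ?thesis by simp
  next
    case 2
    then have "order G = 20" "r = 3" "s = 4" using n ij by auto
    then have "19 * 5 \<le> degree G v * 8" "degree G v \<le> 9"
      using order_minus_one_codegree_le[OF v, of 9] degree_le v by fastforce+
    then show ?thesis by simp
  next
    case 3
    then have "order G = 20" "r = 4" "s = 3" using n ij by auto
    then have "19 * 7 \<le> degree G v * 9" "degree G v \<le> 10"
      using order_minus_one_codegree_le[OF v, of 10] degree_le v by fastforce+
    then show ?thesis by simp
  qed
qed

lemma codegree_pos: "u \<in> pverts G \<Longrightarrow> v \<in> pverts G \<Longrightarrow> 1 \<le> codegree G u v"
  using common_neighbor[of "{u, v}"] finite_common_neighbors r2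
  by (auto simp: Suc_le_eq card_gt_0_iff card_insert_if)

text \<open>For u adjacent to v, \<open>codegree G u v\<close> is the degree of u inside the
  neighbourhood of v, so the handshake lemma applies.\<close>

lemma even_sum_codegree: "even (\<Sum>u\<in>neighbors G v. codegree G u v)"
  using even_sum_degrees_within[OF finite_neighbors, of v] by (simp add: common_neighbors_pair)

text \<open>For r = 2 the greedy codegree bound in G is only 1, so the paths are counted in the
  complement, where it is 2s - 3.\<close>

lemma s_le_4_if_r_eq_2:
  assumes r: "r = 2" shows "s \<le> 4"
proof -
  interpret B: domination_balanced "graph_compl G" s r by (rule domination_balanced_compl)
  obtain v where v: "v \<in> pverts G" using pverts_nonempty by blast
  obtain j where j: "s = 2 + j" using s2 le_Suc_ex by blast
  have n: "order G = 3 * (3 + j)" using order_eq j r by simp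
  have D: "degree (graph_compl G) w \<le> 2 * j + 5" if "w \<in> pverts G" for w
    using B.degree_le[of w] that n r j by simp
  have "(3 * j + 8) * (2 * j + 1) \<le> degree (graph_compl G) v * (2 * j + 4)"
    using B.order_minus_one_codegree_le[of v "2 * j + 5"] D v n r j by (simp add: algebra_simps)
  also have "\<dots> \<le> (2 * j + 5) * (2 * j + 4)" using D[OF v] by (rule mult_right_mono) simp
  finally have "2 * (j * j) + j \<le> 12" by (simp add: algebra_simps)
  then have "j \<le> 2" using mult_le_mono[of 3 j 3 j] by (cases "3 \<le> j") auto
  then show ?thesis using j by simp
qed

lemma sum_le_codegree:
  assumes "v \<in> pverts G"
    and "\<And>u. u \<in> neighbors G v \<Longrightarrow> f u \<le> codegree G u v"
    and "\<And>u. u \<in> neighbors (graph_compl G) v \<Longrightarrow> g u \<le> codegree G u v"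
  shows "(\<Sum>u\<in>neighbors G v. f u) + (\<Sum>u\<in>neighbors (graph_compl G) v. g u)
    \<le> (\<Sum>w\<in>neighbors G v. degree G w - 1)"
  unfolding sum_codegree[OF assms(1), symmetric] using assms(2,3) by (intro add_mono sum_mono) auto

text \<open>Counting in the complement makes it 9-regular, hence G is 5-regular. The codegree bound
  5 of the complement becomes 2 for non-adjacent pairs of G, and then at least 5 * 1 + 9 * 2 = 23
  paths would have to fit into 5 * 4 = 20.\<close>

lemma not_r_2_s_4: "\<not> (r = 2 \<and> s = 4)"
proof
  assume rs: "r = 2 \<and> s = 4"
  interpret B: domination_balanced "graph_compl G" s r by (rule domination_balanced_compl)
  have n: "order G = 15" using order_eq rs by simp
  have D: "degree (graph_compl G) w \<le> 9" if "w \<in> pverts G" for w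
    using B.degree_le[of w] that n rs by simp
  have D9: "degree (graph_compl G) w = 9" if w: "w \<in> pverts G" for w
  proof -
    have "14 * 5 \<le> degree (graph_compl G) w * 8"
      using B.order_minus_one_codegree_le[of w 9] D w n rs by simp
    then show ?thesis using D[OF w] by linarith
  qed
  have d5: "degree G w = 5" if "w \<in> pverts G" for w
    using degree_compl[OF that] D9[OF that] n by simp
  obtain v where v: "v \<in> pverts G" using pverts_nonempty by blast
  have "(\<Sum>u\<in>neighbors G v. 1) + (\<Sum>u\<in>neighbors (graph_compl G) v. 2)
    \<le> (\<Sum>w\<in>neighbors G v. degree G w - 1)"
  proof (rule sum_le_codegree[OF v])
    fix u assume "u \<in> neighbors G v"
    then show "1 \<le> codegree G u v" using codegree_pos v edge_verts by (metis neighbors_iff)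
  next
    fix u assume "u \<in> neighbors (graph_compl G) v"
    then have u: "u \<in> pverts G" "u \<noteq> v" "(u, v) \<notin> parcs G" using edge_commute by auto
    then have "5 \<le> codegree (graph_compl G) u v" using B.codegree_ge[of u v] v rs by simp
    then show "2 \<le> codegree G u v" using codegree_compl[OF u(1) v u(2)] u v d5 n by simp
  qed
  also have "\<dots> = degree G v * 4" using sum_degree_const[OF d5] by simp
  finally show False using d5[OF v] D9[OF v] by simp
qed

text \<open>The bounds leave degrees 4 and 5. At a vertex of degree 5 with the most non-neighbours
  of degree 5, parity first yields many neighbours of degree 5; these must then share neighbours
  with it, which exceeds the number of paths.\<close>

lemma degree_4_if_r_2_s_3:
  assumes rs: "r = 2" "s = 3" and "v \<in> pverts G"
  shows "degree G v = 4"
proof -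
  interpret B: domination_balanced "graph_compl G" s r by (rule domination_balanced_compl)
  have n: "order G = 12" using order_eq rs by simp
  have D: "degree (graph_compl G) w \<le> 7" if "w \<in> pverts G" for w
    using B.degree_le[of w] that n rs by simp
  have D6: "6 \<le> degree (graph_compl G) w" if w: "w \<in> pverts G" for w
  proof -
    have "11 * 3 \<le> degree (graph_compl G) w * 6"
      using B.order_minus_one_codegree_le[of w 7] D w n rs by simp
    then show ?thesis by linarith
  qed
  define T where "T = {w \<in> pverts G. degree G w = 5}"
  have d: "degree G w = 4 + of_bool (w \<in> T)" if "w \<in> pverts G" for w
    using degree_compl[OF that] D[OF that] D6[OF that] n that by (auto simp: T_def)
  have "T = {}"
  proof (rule ccontr)
    assume "T \<noteq> {}"
    define b where "b w = card (neighbors (graph_compl G) w \<inter> T)" for w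
    have "finite T" using pair_finite_verts by (simp add: T_def)
    then obtain v where vT: "v \<in> T" and max: "\<And>w. w \<in> T \<Longrightarrow> b w \<le> b v"
      using \<open>T \<noteq> {}\<close> Max_in[of "b ` T"] Max_ge[of "b ` T"] by fastforce
    have v: "v \<in> pverts G" using vT by (simp add: T_def)
    have dv: "degree G v = 5" using vT by (simp add: T_def)
    then have dv': "degree (graph_compl G) v = 6" using degree_compl[OF v] n by simp
    define a where "a = card (neighbors G v \<inter> T)"
    have count: "(\<Sum>u\<in>X. of_bool (u \<in> T)) = card (X \<inter> T)" if "finite X" for X
      using that by (simp add: sum_of_bool_eq)
    have "(\<Sum>w\<in>neighbors G v. degree G w - 1) = (\<Sum>w\<in>neighbors G v. 3 + of_bool (w \<in> T))"
    proof (rule sum.cong[OF refl])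
      fix w assume "w \<in> neighbors G v"
      then have "w \<in> pverts G" using neighbors_subset by blast
      then show "degree G w - 1 = 3 + of_bool (w \<in> T)" using d[of w] by simp
    qed
    also have "\<dots> = 15 + a" using dv finite_neighbors count by (simp add: sum.distrib a_def)
    finally have total: "(\<Sum>w\<in>neighbors G v. degree G w - 1) = 15 + a" .
    have "(\<Sum>u\<in>neighbors (graph_compl G) v. 2 + of_bool (u \<in> T))
        \<le> (\<Sum>u\<in>neighbors (graph_compl G) v. codegree G u v)"
    proof (rule sum_mono)
      fix u assume "u \<in> neighbors (graph_compl G) v"
      then have u: "u \<in> pverts G" "u \<noteq> v" "(u, v) \<notin> parcs G" using edge_commute by auto
      then have "3 \<le> codegree (graph_compl G) u v" using B.codegree_ge[of u v] v rs by simp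
      then show "2 + of_bool (u \<in> T) \<le> codegree G u v"
        using codegree_compl[OF u(1) v u(2)] u d[OF u(1)] dv n by simp
    qed
    moreover have "(\<Sum>u\<in>neighbors (graph_compl G) v. 2 + of_bool (u \<in> T)) = 12 + b v"
      unfolding sum.distrib using dv' C.finite_neighbors count by (simp add: b_def)
    ultimately have far: "12 + b v \<le> (\<Sum>u\<in>neighbors (graph_compl G) v. codegree G u v)" by simp
    have near1: "1 \<le> codegree G u v" if "u \<in> neighbors G v" for u
      using that codegree_pos v edge_verts by (metis neighbors_iff)
    then have "(\<Sum>u\<in>neighbors G v. 1) \<le> (\<Sum>u\<in>neighbors G v. codegree G u v)" by (rule sum_mono)
    then have "5 \<le> (\<Sum>u\<in>neighbors G v. codegree G u v)" using dv by simp
    \<comment> \<open>Parity raises this sum from 5 to 6, and 6 + 12 + b v \<le> 15 + a gives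
      \<open>3 + b v \<le> a\<close>.\<close>
    moreover have "(\<Sum>u\<in>neighbors G v. codegree G u v) \<noteq> 5"
      using even_sum_codegree[of v] by (metis odd_numeral)
    ultimately have ab: "3 + b v \<le> a" using sum_codegree[OF v] total far by linarith
    have "(\<Sum>u\<in>neighbors G v. 1 + of_bool (u \<in> T)) \<le> (\<Sum>u\<in>neighbors G v. codegree G u v)"
    proof (rule sum_mono)
      fix u assume u: "u \<in> neighbors G v"
      show "1 + of_bool (u \<in> T) \<le> codegree G u v"
      proof (cases "u \<in> T")
        case True
        have uV: "u \<in> pverts G" using True by (simp add: T_def)
        \<comment> \<open>Of the a neighbours of v in T, one is u and at most
          \<open>b u \<le> b v\<close> are non-adjacent to u; the rest are common neighbours, at
          least two by \<open>ab\<close>.\<close>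
        have "neighbors G v \<inter> T \<subseteq> insert u (common_neighbors G {u, v} \<union> (neighbors (graph_compl G) u \<inter> T))"
          using uV neighbors_compl[OF uV] by (auto simp: common_neighbors_pair T_def)
        then have "a \<le> card (insert u (common_neighbors G {u, v} \<union> (neighbors (graph_compl G) u \<inter> T)))"
          unfolding a_def using finite_common_neighbors C.finite_neighbors by (intro card_mono) auto
        also have "\<dots> \<le> Suc (card (common_neighbors G {u, v} \<union> (neighbors (graph_compl G) u \<inter> T)))"
          by (rule card_insert_le_m1) auto
        also have "\<dots> \<le> Suc (codegree G u v + b u)"
          unfolding b_def using card_Un_le by simp
        finally show ?thesis using max[OF True] ab True by simp
      qed (use near1[OF u] in simp)
    qed
    moreover have "(\<Sum>u\<in>neighbors G v. 1 + of_bool (u \<in> T)) = 5 + a"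
      unfolding sum.distrib using dv finite_neighbors count by (simp add: a_def)
    ultimately show False using sum_codegree[OF v] total far by simp
  qed
  then show ?thesis using d[OF assms(3)] by simp
qed

text \<open>Non-adjacent pairs almost always have codegree 1: each vertex w has at most one
  exception, collected in \<open>X w\<close>. Two non-adjacent vertices of \<open>M0\<close> are
  shown to be exceptional for each other, which bounds \<open>M0\<close> by 1 + 3 + 1 < 6.\<close>

lemma not_r_2_s_3: "\<not> (r = 2 \<and> s = 3)"
proof
  assume rs: "r = 2 \<and> s = 3"
  then have n: "order G = 12" using order_eq by simp
  have d: "degree G w = 4" if "w \<in> pverts G" for w using degree_4_if_r_2_s_3 rs that by simp
  let ?M = "neighbors (graph_compl G)"
  have cM: "card (?M w) = 7" if "w \<in> pverts G" for w using degree_compl[OF that] d[OF that] n by simp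
  define X where "X w = {u \<in> ?M w. codegree G u w \<noteq> 1}" for w
  \<comment> \<open>There are 4 * 3 = 12 paths, at least 4 of them ending in neighbours; the other 7
    vertices share at most 8, and each needs one.\<close>
  have X: "card (X w) \<le> 1" if w: "w \<in> pverts G" for w
  proof -
    have pos: "1 \<le> codegree G u w" if "u \<in> pverts G" for u using codegree_pos that w by blast
    have "(\<Sum>u\<in>neighbors G w. 1) \<le> (\<Sum>u\<in>neighbors G w. codegree G u w)"
      using pos neighbors_subset by (intro sum_mono) blast
    then have "4 \<le> (\<Sum>u\<in>neighbors G w. codegree G u w)" using d[OF w] by simp
    moreover have "(\<Sum>x\<in>neighbors G w. degree G x - 1) = 12"
      using sum_degree_const[OF d, of w] d[OF w] by simp
    ultimately have 8: "(\<Sum>u\<in>?M w. codegree G u w) \<le> 8" using sum_codegree[OF w] by simp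
    have "(\<Sum>u\<in>?M w. 1 + of_bool (codegree G u w \<noteq> 1)) \<le> (\<Sum>u\<in>?M w. codegree G u w)"
    proof (rule sum_mono)
      fix u assume "u \<in> ?M w"
      then show "1 + of_bool (codegree G u w \<noteq> 1) \<le> codegree G u w"
        using pos[of u] by auto
    qed
    moreover have "(\<Sum>u\<in>?M w. 1 + of_bool (codegree G u w \<noteq> 1)) = 7 + card (X w)"
    proof -
      have "X w = ?M w \<inter> {u. codegree G u w \<noteq> 1}" by (auto simp: X_def)
      then show ?thesis unfolding sum.distrib using cM[OF w] C.finite_neighbors
        by (simp add: sum_of_bool_eq)
    qed
    ultimately show ?thesis using 8 by simp
  qed
  have MV: "?M w \<subseteq> pverts G" for w using C.neighbors_subset by simp
  obtain v where v: "v \<in> pverts G" using pverts_nonempty by blast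
  define M0 where "M0 = ?M v - X v"
  have finX: "finite (X w)" for w using C.finite_neighbors by (simp add: X_def)
  have "X v \<subseteq> ?M v" by (auto simp: X_def)
  then have cM0: "6 \<le> card M0"
    using card_Diff_subset[OF finX] X[OF v] cM[OF v] by (simp add: M0_def)
  have N3: "card (neighbors G x \<inter> ?M v) = 3" if x: "x \<in> M0" for x
  proof -
    have xV: "x \<in> pverts G" "(v, x) \<notin> parcs G" using x by (auto simp: M0_def)
    then have "neighbors G x \<inter> ?M v = neighbors G x - common_neighbors G {x, v}"
      using neighbors_compl[OF v] neighbors_subset[of x] edge_commute
      by (auto simp: common_neighbors_pair)
    moreover have "codegree G x v = 1" using x by (auto simp: M0_def X_def)
    moreover have "common_neighbors G {x, v} \<subseteq> neighbors G x" by (simp add: common_neighbors_pair)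
    ultimately show ?thesis using d[OF xV(1)] card_Diff_subset[OF finite_common_neighbors] by simp
  qed
  have "M0 \<noteq> {}" using cM0 by auto
  then obtain x where x: "x \<in> M0" by blast
  have xV: "x \<in> pverts G" using x by (auto simp: M0_def)
  have "M0 - insert x (neighbors G x) \<subseteq> X x"
  proof
    fix y assume "y \<in> M0 - insert x (neighbors G x)"
    then have y: "y \<in> M0" "y \<noteq> x" "(x, y) \<notin> parcs G" by auto
    have yV: "y \<in> pverts G" using y by (auto simp: M0_def)
    \<comment> \<open>As s = 3, a triple has a common non-neighbour z. The three neighbours of x and
      the three of y among the non-neighbours of v avoid x, y and z, so they lie in a set of four
      and overlap in at least two.\<close>
    have "card {v, x, y} \<le> s" using rs card_length[of "[v, x, y]"] by simp
    then obtain z where "z \<in> common_neighbors (graph_compl G) {v, x, y}"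
      using common_non_neighbor[of "{v, x, y}"] v xV yV by blast
    then have z: "z \<in> ?M v" "z \<noteq> x" "z \<noteq> y" "(x, z) \<notin> parcs G" "(y, z) \<notin> parcs G"
      by (auto simp: common_neighbors_def)
    let ?A = "neighbors G x \<inter> ?M v" and ?B = "neighbors G y \<inter> ?M v"
    have "?A \<union> ?B \<subseteq> ?M v - {x, y, z}" using y z edge_commute by auto
    then have "card (?A \<union> ?B) \<le> card (?M v - {x, y, z})"
      using C.finite_neighbors by (intro card_mono) auto
    also have "\<dots> = 4"
      using x y z cM[OF v] by (subst card_Diff_subset) (auto simp: M0_def)
    finally have "2 \<le> card (?A \<inter> ?B)"
      using card_Un_Int[of ?A ?B] N3[OF x] N3[OF y(1)] finite_neighbors by simp
    also have "card (?A \<inter> ?B) \<le> codegree G y x"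
      using finite_neighbors by (intro card_mono) (auto simp: common_neighbors_pair)
    finally show "y \<in> X x" using y xV yV by (simp add: X_def)
  qed
  then have "card (M0 - insert x (neighbors G x)) \<le> 1"
    using card_mono[OF finX] X[OF xV] le_trans by blast
  moreover have "M0 \<subseteq> (M0 - insert x (neighbors G x)) \<union> insert x (neighbors G x \<inter> ?M v)"
    by (auto simp: M0_def)
  then have "card M0 \<le> card ((M0 - insert x (neighbors G x)) \<union> insert x (neighbors G x \<inter> ?M v))"
    using finite_neighbors C.finite_neighbors by (intro card_mono) (auto simp: M0_def)
  then have "card M0 \<le> card (M0 - insert x (neighbors G x)) + card (insert x (neighbors G x \<inter> ?M v))"
    using card_Un_le le_trans by blast
  moreover have "card (insert x (neighbors G x \<inter> ?M v)) \<le> Suc 3"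
    using N3[OF x] by (intro card_insert_le_m1) auto
  ultimately show False using cM0 by simp
qed

lemma s_eq_2_if_r_eq_2: "r = 2 \<Longrightarrow> s = 2"
  using s_le_4_if_r_eq_2 not_r_2_s_3 not_r_2_s_4 s2 by linarith

theorem balanced_parameters: "r = 2 \<and> s = 2"
proof -
  interpret B: domination_balanced "graph_compl G" s r by (rule domination_balanced_compl)
  show ?thesis using r_eq_2_or_s_eq_2 s_eq_2_if_r_eq_2 B.s_eq_2_if_r_eq_2 by blast
qed

end

section \<open>Recognising the product of two triangles\<close>

text \<open>Reduces the library notion, which also carries maps of arcs, heads and tails, to a
  bijection of vertices preserving adjacency both ways.\<close>

lemma digraph_iso_with_proj_iff:
  assumes "pair_wf_digraph G" "pair_wf_digraph H"
  shows "digraph_iso (with_proj G) (with_proj H) \<longleftrightarrow>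
    (\<exists>f. bij_betw f (pverts G) (pverts H) \<and>
      (\<forall>u\<in>pverts G. \<forall>v\<in>pverts G. (u, v) \<in> parcs G \<longleftrightarrow> (f u, f v) \<in> parcs H))"
proof
  interpret G: pair_wf_digraph G by fact
  interpret H: pair_wf_digraph H by fact
  {
    assume "digraph_iso (with_proj G) (with_proj H)"
    then obtain hom where hom: "pre_digraph.digraph_isomorphism (with_proj G) hom"
      and H: "with_proj H = app_iso hom (with_proj G)"
      unfolding digraph_iso_def by blast
    define f where "f = iso_verts hom"
    have inj: "inj_on f (pverts G)"
      using G.digraph_isomorphism_inj_on_verts[OF hom] by (simp add: f_def)
    have HV: "pverts H = f ` pverts G" and HE: "parcs H = iso_arcs hom ` parcs G"
      and "iso_tail hom = fst" "iso_head hom = snd"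
      using arg_cong[OF H, of verts] arg_cong[OF H, of arcs] arg_cong[OF H, of tail] arg_cong[OF H, of head]
      by (auto simp: f_def)
    then have arc: "iso_arcs hom (u, v) = (f u, f v)" if "(u, v) \<in> parcs G" for u v
      using G.iso_verts_tail[OF hom] G.iso_verts_head[OF hom] that
      by (metis f_def fst_conv prod.collapse snd_conv)
    have "(u, v) \<in> parcs G \<longleftrightarrow> (f u, f v) \<in> parcs H" if uv: "u \<in> pverts G" "v \<in> pverts G" for u v
    proof
      assume "(u, v) \<in> parcs G"
      then show "(f u, f v) \<in> parcs H" unfolding HE using arc by (metis imageI)
    next
      assume "(f u, f v) \<in> parcs H"
      then obtain a b where ab: "(a, b) \<in> parcs G" "(f u, f v) = iso_arcs hom (a, b)"
        unfolding HE by auto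
      then have "f u = f a" "f v = f b" using arc by auto
      then show "(u, v) \<in> parcs G" using ab(1) uv G.in_arcsD1 G.in_arcsD2 inj by (metis inj_onD)
    qed
    then show "\<exists>f. bij_betw f (pverts G) (pverts H) \<and>
      (\<forall>u\<in>pverts G. \<forall>v\<in>pverts G. (u, v) \<in> parcs G \<longleftrightarrow> (f u, f v) \<in> parcs H)"
      using inj HV by (auto simp: bij_betw_def)
  }
  {
    assume "\<exists>f. bij_betw f (pverts G) (pverts H) \<and>
      (\<forall>u\<in>pverts G. \<forall>v\<in>pverts G. (u, v) \<in> parcs G \<longleftrightarrow> (f u, f v) \<in> parcs H)"
    then obtain f where f: "bij_betw f (pverts G) (pverts H)"
      and E: "\<And>u v. u \<in> pverts G \<Longrightarrow> v \<in> pverts G \<Longrightarrow> (u, v) \<in> parcs G \<longleftrightarrow> (f u, f v) \<in> parcs H"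
      by blast
    have inj: "inj_on f (pverts G)" and img: "f ` pverts G = pverts H"
      using f by (auto simp: bij_betw_def)
    let ?hom = "\<lparr>iso_verts = f, iso_arcs = map_prod f f, iso_head = snd, iso_tail = fst\<rparr>"
    have "inj_on (map_prod f f) (parcs G)"
      using G.in_arcsD1 G.in_arcsD2 by (intro inj_on_subset[OF map_prod_inj_on[OF inj inj]]) auto
    then have "pre_digraph.digraph_isomorphism (with_proj G) ?hom"
      unfolding pre_digraph.digraph_isomorphism_def using inj G.wf_digraph by auto
    moreover have "map_prod f f ` parcs G = parcs H"
    proof
      have "(f u, f v) \<in> parcs H" if "(u, v) \<in> parcs G" for u v
        using E[OF G.in_arcsD1[OF that] G.in_arcsD2[OF that]] that by blast
      then show "map_prod f f ` parcs G \<subseteq> parcs H" by auto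
      show "parcs H \<subseteq> map_prod f f ` parcs G"
      proof
        fix e assume e: "e \<in> parcs H"
        obtain x y where xy: "e = (x, y)" by fastforce
        then obtain u v where "u \<in> pverts G" "v \<in> pverts G" "x = f u" "y = f v"
          using e H.in_arcsD1 H.in_arcsD2 img by (metis imageE)
        then show "e \<in> map_prod f f ` parcs G" using e xy E by (auto intro!: image_eqI[of _ _ "(u, v)"])
      qed
    qed
    then have "with_proj H = app_iso ?hom (with_proj G)"
      unfolding app_iso_def using img by (simp add: with_proj_def)
    ultimately show "digraph_iso (with_proj G) (with_proj H)"
      unfolding digraph_iso_def by blast
  }
qed

abbreviation (input) K3_K3 :: "(nat \<times> nat) pair_pre_digraph" where
  "K3_K3 \<equiv> cartesian_product (complete_graph 3) (complete_graph 3)"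

lemma pverts_K3_K3: "pverts K3_K3 = {..<3} \<times> {..<3}"
  by (simp add: cartesian_product_def complete_graph_def)

text \<open>Rook moves on a 3 by 3 board; the inequality of truth values says that exactly one
  coordinate agrees.\<close>

lemma parcs_K3_K3:
  "((a, b), (c, d)) \<in> parcs K3_K3 \<longleftrightarrow> a < 3 \<and> b < 3 \<and> c < 3 \<and> d < 3 \<and> ((a = c) \<noteq> (b = d))"
  by (auto simp: cartesian_product_def complete_graph_def)

lemma pair_wf_digraph_K3_K3: "pair_wf_digraph K3_K3"
  by unfold_locales (auto simp: cartesian_product_def complete_graph_def)

text \<open>The case r = s = 2. Its hypotheses are meant for G and its complement alike, so that
  excluding degree 3 in both also excludes degree 5.\<close>

locale balanced_order_9 = pair_graph +
  assumes common_neighbor_pair: "\<And>u v. u \<in> pverts G \<Longrightarrow> v \<in> pverts G \<Longrightarrow> common_neighbors G {u, v} \<noteq> {}"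
    and common_non_neighbor_pair:
      "\<And>u v. u \<in> pverts G \<Longrightarrow> v \<in> pverts G \<Longrightarrow> common_neighbors (graph_compl G) {u, v} \<noteq> {}"
    and order_9: "order G = 9"
    and degree_le_5: "\<And>v. v \<in> pverts G \<Longrightarrow> degree G v \<le> 5"
begin

lemma common_neighborE:
  assumes "u \<in> pverts G" "v \<in> pverts G"
  obtains w where "w \<in> pverts G" "(w, u) \<in> parcs G" "(w, v) \<in> parcs G"
  using common_neighbor_pair[OF assms] edge_commute by (auto simp: common_neighbors_def)

lemma common_non_neighborE:
  assumes "u \<in> pverts G" "v \<in> pverts G"
  obtains w where "w \<in> pverts G" "w \<noteq> u" "w \<noteq> v" "(w, u) \<notin> parcs G" "(w, v) \<notin> parcs G"
  using common_non_neighbor_pair[OF assms] edge_commute by (auto simp: common_neighbors_def)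

text \<open>Each u_i sees exactly one of x, y, z. If w = w', this vertex has six neighbours.
  Otherwise the nine named vertices are the whole graph, and each of them is w, x, or adjacent to w
  or x, so w and x have no common non-neighbour.\<close>

lemma no_shared_apex:
  assumes v: "v \<in> pverts G" "neighbors G v = {x, y, z}" "distinct [x, y, z]"
    and u: "u1 \<in> pverts G" "u2 \<in> pverts G" "u3 \<in> pverts G"
      "(u1, v) \<notin> parcs G" "(u2, v) \<notin> parcs G" "(u3, v) \<notin> parcs G"
      "(u1, x) \<notin> parcs G" "(u1, y) \<notin> parcs G" "(u1, z) \<in> parcs G"
      "(u2, x) \<notin> parcs G" "(u2, y) \<in> parcs G" "(u2, z) \<notin> parcs G"
      "(u3, x) \<in> parcs G" "(u3, y) \<notin> parcs G" "(u3, z) \<notin> parcs G"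
    and w: "(w, u1) \<in> parcs G" "(w, z) \<in> parcs G" "(w, u2) \<in> parcs G" "(w, y) \<in> parcs G"
    and w': "(w', u3) \<in> parcs G" "(w', x) \<in> parcs G"
  shows False
proof -
  have vx: "(v, x) \<in> parcs G" "(v, y) \<in> parcs G" "(v, z) \<in> parcs G"
    using v(2) by (auto simp: neighbors_def)
  have V: "x \<in> pverts G" "y \<in> pverts G" "z \<in> pverts G" "w \<in> pverts G" "w' \<in> pverts G"
    using vx w w' edge_verts by blast+
  note sym = edge_commute
  show False
  proof (cases "w = w'")
    case True
    have dist: "distinct [u1, u2, u3, x, y, z]"
      using u v(3) vx sym by auto
    have "set [u1, u2, u3, x, y, z] \<subseteq> neighbors G w" using w w' True by auto
    then have "card (set [u1, u2, u3, x, y, z]) \<le> degree G w"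
      using finite_neighbors by (intro card_mono)
    then show False using degree_le_5[OF V(4)] unfolding distinct_card[OF dist] by simp
  next
    case False
    have dist: "distinct [v, x, y, z, u1, u2, u3, w, w']"
      using False u v(3) vx w w' sym no_loop by (auto; metis)
    have "set [v, x, y, z, u1, u2, u3, w, w'] = pverts G"
    proof (rule card_subset_eq[OF pair_finite_verts])
      show "set [v, x, y, z, u1, u2, u3, w, w'] \<subseteq> pverts G" using v(1) u V by simp
      show "card (set [v, x, y, z, u1, u2, u3, w, w']) = card (pverts G)"
        unfolding distinct_card[OF dist] using order_9 by (simp add: order_def)
    qed
    moreover obtain t where t: "t \<in> pverts G" "t \<noteq> w" "t \<noteq> x" "(t, w) \<notin> parcs G" "(t, x) \<notin> parcs G"
      using common_non_neighborE V by metis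
    ultimately have "t \<in> {v, x, y, z, u1, u2, u3, w, w'}" by simp
    moreover have "(w, t) \<notin> parcs G" using t sym by simp
    ultimately show False using t(2-5) vx(1) u(13) w w' by blast
  qed
qed

lemma degree_not_3:
  assumes v: "v \<in> pverts G" shows "degree G v \<noteq> 3"
proof
  assume "degree G v = 3"
  then obtain x y z where N: "neighbors G v = {x, y, z}" and xyz: "distinct [x, y, z]"
    unfolding card_3_iff by auto
  \<comment> \<open>A common non-neighbour of a and b still shares a neighbour with v, and only c is
    left for that role.\<close>
  have exclusive: "\<exists>u\<in>pverts G. (u, v) \<notin> parcs G \<and> (u, a) \<notin> parcs G \<and> (u, b) \<notin> parcs G \<and> (u, c) \<in> parcs G"
    if abc: "neighbors G v = {a, b, c}" "distinct [a, b, c]" for a b c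
  proof -
    have va: "(v, a) \<in> parcs G" "(v, b) \<in> parcs G" "(v, c) \<in> parcs G"
      using abc by (auto simp: neighbors_def)
    then have V: "a \<in> pverts G" "b \<in> pverts G" "c \<in> pverts G" using edge_verts by blast+
    obtain u where u: "u \<in> pverts G" "u \<noteq> a" "u \<noteq> b" "(u, a) \<notin> parcs G" "(u, b) \<notin> parcs G"
      using common_non_neighborE V by metis
    have nb: "w = a \<or> w = b \<or> w = c" if "(w, v) \<in> parcs G" for w
    proof -
      have "w \<in> neighbors G v" using that edge_commute by simp
      then show ?thesis using abc(1) by simp
    qed
    obtain w where w: "(w, u) \<in> parcs G" "(w, v) \<in> parcs G" using common_neighborE u(1) v by metis
    then have uc: "(u, c) \<in> parcs G" using nb[OF w(2)] u edge_commute by auto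
    moreover have "(u, v) \<notin> parcs G" using nb[of u] u uc no_loop by auto
    ultimately show ?thesis using u by blast
  qed
  have xyz': "neighbors G v = {x, z, y}" "neighbors G v = {y, z, x}" using N by auto
  obtain u1 where u1: "u1 \<in> pverts G" "(u1, v) \<notin> parcs G" "(u1, x) \<notin> parcs G" "(u1, y) \<notin> parcs G" "(u1, z) \<in> parcs G"
    using exclusive[OF N xyz] by blast
  obtain u2 where u2: "u2 \<in> pverts G" "(u2, v) \<notin> parcs G" "(u2, x) \<notin> parcs G" "(u2, y) \<in> parcs G" "(u2, z) \<notin> parcs G"
    using exclusive[OF xyz'(1)] xyz by auto
  obtain u3 where u3: "u3 \<in> pverts G" "(u3, v) \<notin> parcs G" "(u3, x) \<in> parcs G" "(u3, y) \<notin> parcs G" "(u3, z) \<notin> parcs G"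
    using exclusive[OF xyz'(2)] xyz by auto
  have vx: "(v, x) \<in> parcs G" "(v, y) \<in> parcs G" "(v, z) \<in> parcs G"
    using N by (auto simp: neighbors_def)
  then have V: "x \<in> pverts G" "y \<in> pverts G" "z \<in> pverts G" using edge_verts by blast+
  obtain w1 where w1: "(w1, u1) \<in> parcs G" "(w1, z) \<in> parcs G" using common_neighborE u1(1) V by metis
  obtain w2 where w2: "(w2, u2) \<in> parcs G" "(w2, y) \<in> parcs G" using common_neighborE u2(1) V by metis
  obtain w3 where w3: "(w3, u3) \<in> parcs G" "(w3, x) \<in> parcs G" using common_neighborE u3(1) V by metis
  note sym = edge_commute
  have dist: "distinct [v, x, y, z, u1, u2, u3]"
    using xyz u1 u2 u3 vx sym no_loop by (auto; metis)
  \<comment> \<open>None of the seven listed vertices can be a \<open>w1\<close>, \<open>w2\<close>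
    or \<open>w3\<close>, so three choices fall on two vertices. The coinciding pair is handled by
    permuting the roles of x, y, z.\<close>
  let ?R = "pverts G - set [v, x, y, z, u1, u2, u3]"
  have "card ?R = 2"
    using v V u1(1) u2(1) u3(1) order_9 distinct_card[OF dist]
    by (subst card_Diff_subset) (auto simp: order_def)
  moreover have "w1 \<in> ?R" "w2 \<in> ?R" "w3 \<in> ?R"
    using w1 w2 w3 u1 u2 u3 vx sym no_loop edge_verts by (auto; metis)+
  then have "card {w1, w2, w3} \<le> card ?R" using pair_finite_verts by (intro card_mono) auto
  ultimately consider "w1 = w2" | "w1 = w3" | "w2 = w3"
    by (auto simp: card_insert_if split: if_splits)
  then show False
  proof cases
    case 1
    then show ?thesis
      using no_shared_apex[OF v N xyz, of u1 u2 u3 w1 w3] u1 u2 u3 w1 w2 w3 by blast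
  next
    case 2
    have "neighbors G v = {y, x, z}" "distinct [y, x, z]" using N xyz by auto
    then show ?thesis
      using no_shared_apex[OF v, of y x z u1 u3 u2 w1 w2] 2 u1 u2 u3 w1 w2 w3 by blast
  next
    case 3
    have "neighbors G v = {z, x, y}" "distinct [z, x, y]" using N xyz by auto
    then show ?thesis
      using no_shared_apex[OF v, of z x y u2 u3 u1 w2 w1] 3 u1 u2 u3 w1 w2 w3 by blast
  qed
qed

end

text \<open>
  Equality in the count of \<open>sum_codegree\<close> makes the graph strongly regular with
  parameters \<open>(9, 4, 1, 2)\<close>.
\<close>

lemma (in balanced_order_9) strongly_regular:
  assumes d: "\<And>v. v \<in> pverts G \<Longrightarrow> degree G v = 4" and v: "v \<in> pverts G"
  shows "(u, v) \<in> parcs G \<Longrightarrow> codegree G u v = 1"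
    and "u \<in> pverts G \<Longrightarrow> u \<noteq> v \<Longrightarrow> (u, v) \<notin> parcs G \<Longrightarrow> codegree G u v = 2"
proof -
  interpret C: pair_graph "graph_compl G" by (rule pair_graph_compl)
  let ?M = "neighbors (graph_compl G) v"
  have near: "1 \<le> codegree G u v" if "u \<in> neighbors G v" for u
  proof -
    have "u \<in> pverts G" using that edge_verts by auto
    then show ?thesis using common_neighbor_pair[OF _ v] finite_common_neighbors
      by (simp add: Suc_le_eq card_gt_0_iff)
  qed
  have far: "2 \<le> codegree G u v" if "u \<in> ?M" for u
  proof -
    have u: "u \<in> pverts G" "u \<noteq> v" "(u, v) \<notin> parcs G" using that edge_commute by auto
    have "1 \<le> codegree (graph_compl G) u v"
      using common_non_neighbor_pair[OF u(1) v] C.finite_common_neighbors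
      by (simp add: Suc_le_eq card_gt_0_iff)
    then show ?thesis using codegree_compl[OF u(1) v u(2)] u d[OF u(1)] d[OF v] order_9 by simp
  qed
  have M4: "card ?M = 4" using degree_compl[OF v] d[OF v] order_9 by simp
  have "(\<Sum>u\<in>neighbors G v. codegree G u v) + (\<Sum>u\<in>?M. codegree G u v) = 12"
    using sum_codegree[OF v] sum_degree_const[OF d, of v] d[OF v] by simp
  moreover have "(\<Sum>u\<in>neighbors G v. 1) \<le> (\<Sum>u\<in>neighbors G v. codegree G u v)"
    using near by (rule sum_mono)
  moreover have "(\<Sum>u\<in>?M. 2) \<le> (\<Sum>u\<in>?M. codegree G u v)"
    using far by (rule sum_mono)
  ultimately have eq: "(\<Sum>u\<in>neighbors G v. 1) = (\<Sum>u\<in>neighbors G v. codegree G u v)"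
    "(\<Sum>u\<in>?M. 2) = (\<Sum>u\<in>?M. codegree G u v)"
    using d[OF v] M4 by simp_all
  show "codegree G u v = 1" if "(u, v) \<in> parcs G"
    using sum_mono_inv[OF eq(1) near, of u] that edge_commute finite_neighbors by simp
  show "codegree G u v = 2" if "u \<in> pverts G" "u \<noteq> v" "(u, v) \<notin> parcs G"
    using sum_mono_inv[OF eq(2) far, of u] that v edge_commute C.finite_neighbors by simp
qed

text \<open>Two triangles meeting only in v become the first row and first column of the board. A
  cell off both is the second common neighbour, besides v, of the vertices heading its row and
  column.\<close>

lemma (in balanced_order_9) iso_K3_K3:
  assumes d: "\<And>v. v \<in> pverts G \<Longrightarrow> degree G v = 4"
  shows "digraph_iso (with_proj G) (with_proj K3_K3)"
proof -
  note sym = edge_commute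
  have one: "c = c'" if "(u, v) \<in> parcs G" "(c, u) \<in> parcs G" "(c, v) \<in> parcs G"
      "(c', u) \<in> parcs G" "(c', v) \<in> parcs G" for u v c c'
  proof -
    have "codegree G u v = 1" using strongly_regular(1)[OF d] that(1) edge_verts by blast
    then obtain e where "common_neighbors G {u, v} = {e}" by (rule card_1_singletonE)
    moreover have "c \<in> common_neighbors G {u, v}" "c' \<in> common_neighbors G {u, v}"
      using that sym by (auto simp: common_neighbors_pair)
    ultimately show ?thesis by simp
  qed
  have triangle: "\<exists>c. (c, u) \<in> parcs G \<and> (c, v) \<in> parcs G" if "(u, v) \<in> parcs G" for u v
    using common_neighborE edge_verts that by metis
  have square: "\<exists>c. (c, a) \<in> parcs G \<and> (c, b) \<in> parcs G \<and> c \<noteq> v"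
    if "a \<in> pverts G" "b \<in> pverts G" "a \<noteq> b" "(a, b) \<notin> parcs G" for a b v
  proof -
    have "codegree G a b = 2" using strongly_regular(2)[OF d] that by blast
    then obtain p q where pq: "common_neighbors G {a, b} = {p, q}" "p \<noteq> q"
      unfolding card_2_iff by auto
    then have "p \<in> common_neighbors G {a, b}" "q \<in> common_neighbors G {a, b}" by auto
    then show ?thesis using pq(2) sym unfolding common_neighbors_pair by (cases "p = v") auto
  qed
  have nbrs: "neighbors G x = {p, q, s, t}"
    if "x \<in> pverts G" "(x, p) \<in> parcs G" "(x, q) \<in> parcs G" "(x, s) \<in> parcs G" "(x, t) \<in> parcs G"
      "distinct [p, q, s, t]" for x p q s t
  proof -
    have "{p, q, s, t} = neighbors G x"
    proof (rule card_subset_eq[OF finite_neighbors])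
      show "{p, q, s, t} \<subseteq> neighbors G x" using that by auto
      show "card {p, q, s, t} = degree G x" using that d[OF that(1)] by simp
    qed
    then show ?thesis ..
  qed
  have "pverts G \<noteq> {}" using order_9 by (auto simp: order_def)
  then obtain v where v: "v \<in> pverts G" by blast
  have "neighbors G v \<noteq> {}" using d[OF v] by auto
  then obtain a where a: "(v, a) \<in> parcs G" by (auto simp: neighbors_def)
  obtain a' where a': "(a', v) \<in> parcs G" "(a', a) \<in> parcs G" using triangle[OF a] by blast
  have "\<not> neighbors G v \<subseteq> {a, a'}"
  proof
    assume "neighbors G v \<subseteq> {a, a'}"
    then have "degree G v \<le> card {a, a'}" by (intro card_mono) auto
    also have "\<dots> \<le> 2" by (simp add: card_insert_if)
    finally show False using d[OF v] by simp
  qed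
  then obtain b where b: "(v, b) \<in> parcs G" "b \<noteq> a" "b \<noteq> a'" by (auto simp: neighbors_def)
  obtain b' where b': "(b', v) \<in> parcs G" "(b', b) \<in> parcs G" using triangle[OF b(1)] by blast
  have ne: "v \<noteq> a" "v \<noteq> a'" "v \<noteq> b" "v \<noteq> b'" "a \<noteq> a'" "b \<noteq> b'"
    using a a' b b' by auto
  have ab: "(a, b) \<notin> parcs G" using one[of v a a' b] a a' b sym by blast
  have a'b: "(a', b) \<notin> parcs G" using one[of v a' a b] a a' b sym by blast
  have b'ne: "b' \<noteq> a" "b' \<noteq> a'" using ab a'b b' sym by auto
  have ab': "(a, b') \<notin> parcs G" using one[of v a a' b'] a a' b' b'ne sym by blast
  have a'b': "(a', b') \<notin> parcs G" using one[of v a' a b'] a a' b' b'ne sym by blast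
  have V: "a \<in> pverts G" "a' \<in> pverts G" "b \<in> pverts G" "b' \<in> pverts G"
    using a a' b b' edge_verts by blast+
  have Nv: "neighbors G v = {a, a', b, b'}"
    using nbrs[OF v, of a a' b b'] a a' b b' b'ne ne sym by auto
  obtain p where p: "(p, a) \<in> parcs G" "(p, b) \<in> parcs G" "p \<noteq> v" using square[OF V(1,3) _ ab, of v] b by auto
  obtain q where q: "(q, a) \<in> parcs G" "(q, b') \<in> parcs G" "q \<noteq> v" using square[OF V(1,4) _ ab', of v] b'ne by auto
  obtain s where s: "(s, a') \<in> parcs G" "(s, b) \<in> parcs G" "s \<noteq> v" using square[OF V(2,3) _ a'b, of v] b by auto
  obtain t where t: "(t, a') \<in> parcs G" "(t, b') \<in> parcs G" "t \<noteq> v" using square[OF V(2,4) _ a'b', of v] b'ne by auto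
  have pV: "p \<in> pverts G" "q \<in> pverts G" "s \<in> pverts G" "t \<in> pverts G"
    using p q s t edge_verts by blast+
  have pN: "p \<notin> neighbors G v" "q \<notin> neighbors G v" "s \<notin> neighbors G v" "t \<notin> neighbors G v"
    using p q s t ab a'b ab' a'b' sym unfolding Nv by auto
  have aa: "c = v" if "(c, a) \<in> parcs G" "(c, a') \<in> parcs G" for c
    using one[of a a' c v] that a a' sym by blast
  have bb: "c = v" if "(c, b) \<in> parcs G" "(c, b') \<in> parcs G" for c
    using one[of b b' c v] that b b' sym by blast
  have pqst: "distinct [p, q, s, t]"
    using aa[of p] aa[of q] bb[of p] bb[of s] p q s t by auto
  have dist: "distinct [v, a, a', b, b', p, q, s, t]"
    using ne b b'ne pN pqst p(3) q(3) s(3) t(3) unfolding Nv by auto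
  have VG: "pverts G = set [v, a, a', b, b', p, q, s, t]"
  proof (rule card_subset_eq[OF pair_finite_verts, symmetric])
    show "set [v, a, a', b, b', p, q, s, t] \<subseteq> pverts G" using v V pV by simp
    show "card (set [v, a, a', b, b', p, q, s, t]) = card (pverts G)"
      unfolding distinct_card[OF dist] using order_9 by (simp add: order_def)
  qed
  have Na: "neighbors G a = {v, a', p, q}" using nbrs[OF V(1), of v a' p q] a a' p q dist sym by auto
  have Na': "neighbors G a' = {v, a, s, t}" using nbrs[OF V(2), of v a s t] a a' s t dist sym by auto
  have Nb: "neighbors G b = {v, b', p, s}" using nbrs[OF V(3), of v b' p s] b b' p s dist sym by auto
  have Nb': "neighbors G b' = {v, b, q, t}" using nbrs[OF V(4), of v b q t] b b' q t dist sym by auto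
  \<comment> \<open>The edge between c and x lies in a triangle whose third vertex is among v, c',
    x, y; all but y are ruled out.\<close>
  have line: "(x, y) \<in> parcs G" if x: "x \<in> pverts G" "x \<noteq> v" "x \<noteq> c'" "x \<noteq> y" "y \<noteq> v"
      "(x, v) \<notin> parcs G" "(x, c') \<notin> parcs G" "neighbors G c = {v, c', x, y}" for c c' x y
  proof -
    have "x \<in> neighbors G c" using x(8) by simp
    then obtain e where e: "(e, c) \<in> parcs G" "(e, x) \<in> parcs G" using triangle[of c x] by auto
    then have "e \<in> neighbors G c" using sym by simp
    then have "e = y" using e x sym by auto
    then show ?thesis using e sym by blast
  qed
  have xv: "(p, v) \<notin> parcs G" "(q, v) \<notin> parcs G" "(s, v) \<notin> parcs G" "(t, v) \<notin> parcs G"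
    using pN sym by auto
  have xc: "(p, a') \<notin> parcs G" "(p, b') \<notin> parcs G" "(s, a) \<notin> parcs G" "(q, b) \<notin> parcs G"
    using aa[of p] bb[of p] aa[of s] bb[of q] p q s by auto
  have pq: "(p, q) \<in> parcs G" using line[of p a' q a] pV xv xc dist Na by auto
  have ps: "(p, s) \<in> parcs G" using line[of p b' s b] pV xv xc dist Nb by auto
  have st: "(s, t) \<in> parcs G" using line[of s a t a'] pV xv xc dist Na' by auto
  have qt: "(q, t) \<in> parcs G" using line[of q b t b'] pV xv xc dist Nb' by auto
  have Np: "neighbors G p = {a, b, q, s}" using nbrs[OF pV(1), of a b q s] p pq ps dist by auto
  have Nq: "neighbors G q = {a, b', p, t}" using nbrs[OF pV(2), of a b' p t] q pq qt dist sym by auto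
  have Ns: "neighbors G s = {a', b, p, t}" using nbrs[OF pV(3), of a' b p t] s ps st dist sym by auto
  have Nt: "neighbors G t = {a', b', q, s}" using nbrs[OF pV(4), of a' b' q s] t st qt dist sym by auto
  define f :: "'a \<Rightarrow> nat \<times> nat" where "f x = (if x = v then (0, 0) else if x = a then (0, 1)
    else if x = a' then (0, 2) else if x = b then (1, 0) else if x = b' then (2, 0)
    else if x = p then (1, 1) else if x = q then (2, 1) else if x = s then (1, 2) else (2, 2))" for x
  have f: "f v = (0, 0)" "f a = (0, 1)" "f a' = (0, 2)" "f b = (1, 0)" "f b' = (2, 0)"
    "f p = (1, 1)" "f q = (2, 1)" "f s = (1, 2)" "f t = (2, 2)"
    using dist by (auto simp: f_def)
  have "{..<3::nat} = {0, 1, 2}" by auto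
  then have K: "pverts K3_K3 = {(0,0), (0,1), (0,2), (1,0), (2,0), (1,1), (2,1), (1,2), (2,2)}"
    unfolding pverts_K3_K3 by auto
  have "bij_betw f (pverts G) (pverts K3_K3)"
    unfolding bij_betw_def
  proof
    show "inj_on f (pverts G)" unfolding VG by (rule inj_onI) (auto simp: f)
    show "f ` pverts G = pverts K3_K3" unfolding VG K by (simp add: f)
  qed
  moreover have "\<forall>x\<in>pverts G. \<forall>y\<in>pverts G. y \<in> neighbors G x \<longleftrightarrow> (f x, f y) \<in> parcs K3_K3"
    unfolding VG using dist by (simp add: Nv Na Na' Nb Nb' Np Nq Ns Nt f parcs_K3_K3 del: neighbors_iff) auto
  ultimately show ?thesis
    unfolding digraph_iso_with_proj_iff[OF pair_wf_digraph_axioms pair_wf_digraph_K3_K3] by auto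
qed

context pair_graph
begin

theorem domination_balanced_iso_K3_K3:
  assumes "3 \<le> domination_number G" "3 \<le> domination_number (graph_compl G)"
    and prod: "domination_number G * domination_number (graph_compl G) = order G"
  shows "digraph_iso (with_proj G) (with_proj K3_K3)"
proof -
  interpret C: pair_graph "graph_compl G" by (rule pair_graph_compl)
  interpret B: domination_balanced G "domination_number (graph_compl G) - 1" "domination_number G - 1"
    by unfold_locales
      (use assms common_neighbors_nonempty C.common_neighbors_nonempty in \<open>auto simp: mult.commute\<close>)
  have rs: "domination_number (graph_compl G) - 1 = 2" "domination_number G - 1 = 2"
    using B.balanced_parameters by auto
  then have dom: "domination_number (graph_compl G) = 3" "domination_number G = 3" by auto
  have card2: "card {u, v} < 3" for u v :: 'a by (simp add: card_insert_if)
  have n: "order G = 9" using prod dom by simp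
  interpret B9: balanced_order_9 G
  proof unfold_locales
    fix u v assume uv: "u \<in> pverts G" "v \<in> pverts G"
    show "common_neighbors G {u, v} \<noteq> {}"
      using common_neighbors_nonempty[of "{u, v}"] uv card2 dom by simp
    show "common_neighbors (graph_compl G) {u, v} \<noteq> {}"
      using C.common_neighbors_nonempty[of "{u, v}"] uv card2 dom by simp
  next
    fix v assume "v \<in> pverts G"
    then show "degree G v \<le> 5" using B.degree_le[of v] rs n by simp
  qed (rule n)
  interpret B9': balanced_order_9 "graph_compl G"
  proof unfold_locales
    fix v assume "v \<in> pverts (graph_compl G)"
    then show "degree (graph_compl G) v \<le> 5"
      using B.degree_ge[of v] degree_compl[of v] rs n by simp
  qed (use B9.common_neighbor_pair B9.common_non_neighbor_pair n in auto)
  have "degree G v = 4" if v: "v \<in> pverts G" for v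
  proof -
    have "degree G v \<noteq> 3" "degree (graph_compl G) v \<noteq> 3"
      using B9.degree_not_3[OF v] B9'.degree_not_3[of v] v by auto
    moreover have "3 \<le> degree G v" "degree G v \<le> 5"
      using B.degree_ge[OF v] B9.degree_le_5[OF v] rs by auto
    ultimately show ?thesis using degree_compl[OF v] n by linarith
  qed
  then show ?thesis by (rule B9.iso_K3_K3)
qed

end

section \<open>Extremal graphs\<close>

lemma ex_other_coordinate: "\<exists>x<3. x \<noteq> a \<and> x \<noteq> (b::nat)"
proof -
  have "(0 \<noteq> a \<and> 0 \<noteq> b) \<or> (1 \<noteq> a \<and> 1 \<noteq> b) \<or> (2 \<noteq> a \<and> 2 \<noteq> b)" by auto
  then show ?thesis
  proof (elim disjE)
    assume "0 \<noteq> a \<and> 0 \<noteq> b" then show ?thesis by (intro exI[of _ 0]) simp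
  next
    assume "1 \<noteq> a \<and> 1 \<noteq> b" then show ?thesis by (intro exI[of _ 1]) simp
  next
    assume "2 \<noteq> a \<and> 2 \<noteq> b" then show ?thesis by (intro exI[of _ 2]) simp
  qed
qed

lemma K3_K3_not_dominated_pair:
  assumes "p \<in> pverts K3_K3" "q \<in> pverts K3_K3"
  shows "\<exists>w\<in>pverts K3_K3. w \<noteq> p \<and> w \<noteq> q \<and> (p, w) \<notin> parcs K3_K3 \<and> (q, w) \<notin> parcs K3_K3"
proof -
  obtain a b c d where pq: "p = (a, b)" "q = (c, d)" by fastforce
  obtain x y where "x < 3" "x \<noteq> a" "x \<noteq> c" "y < 3" "y \<noteq> b" "y \<noteq> d"
    using ex_other_coordinate by metis
  then show ?thesis unfolding pq
    by (intro bexI[of _ "(x, y)"]) (auto simp: parcs_K3_K3 pverts_K3_K3)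
qed

text \<open>The neighbours of q outside the closed neighbourhood of p arise by changing the
  coordinate that p and q share, and there are two values to change it to. No vertex can therefore
  force after one token has dominated its neighbours.\<close>

lemma K3_K3_second_neighbor_outside:
  assumes "q = p \<or> (p, q) \<in> parcs K3_K3" "(q, w) \<in> parcs K3_K3" "w \<noteq> p" "(p, w) \<notin> parcs K3_K3"
  shows "\<exists>w'\<in>pverts K3_K3. (q, w') \<in> parcs K3_K3 \<and> w' \<noteq> p \<and> (p, w') \<notin> parcs K3_K3 \<and> w' \<noteq> w"
proof -
  obtain a b c d x y where e: "p = (a, b)" "q = (c, d)" "w = (x, y)" by (metis surj_pair)
  have lt: "c < 3" "d < 3" using assms by (auto simp: e parcs_K3_K3)
  show ?thesis
  proof (cases "a = c")
    case True
    obtain x' where "x' < 3" "x' \<noteq> a" "x' \<noteq> x" using ex_other_coordinate by metis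
    then show ?thesis using assms True lt unfolding e
      by (intro bexI[of _ "(x', d)"]) (auto simp: parcs_K3_K3 pverts_K3_K3)
  next
    case False
    obtain y' where "y' < 3" "y' \<noteq> b" "y' \<noteq> y" using ex_other_coordinate by metis
    then show ?thesis using assms False lt unfolding e
      by (intro bexI[of _ "(c, y')"]) (auto simp: parcs_K3_K3 pverts_K3_K3)
  qed
qed

lemma K3_K3_self_complementary:
  obtains h where "bij_betw h (pverts K3_K3) (pverts K3_K3)"
    "\<And>p q. p \<in> pverts K3_K3 \<Longrightarrow> q \<in> pverts K3_K3 \<Longrightarrow>
      (h p, h q) \<in> parcs K3_K3 \<longleftrightarrow> p \<noteq> q \<and> (p, q) \<notin> parcs K3_K3"
proof -
  \<comment> \<open>The linear map (x, y) to (x + y, x - y) over the field with three elements. For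
    differences x and y both nonzero, exactly one of x + y and x - y vanishes, so non-adjacent pairs
    become adjacent.\<close>
  define h :: "nat \<times> nat \<Rightarrow> nat \<times> nat" where "h p = ((fst p + snd p) mod 3, (fst p + 2 * snd p) mod 3)" for p
  have cases: "\<forall>a\<in>{0, 1, 2}. \<forall>b\<in>{0, 1, 2}. \<forall>c\<in>{0, 1, 2}. \<forall>d\<in>{0, 1, 2}.
      (((a + b) mod 3 = (c + d) mod 3) \<noteq> ((a + 2 * b) mod 3 = (c + 2 * d) mod 3)
        \<longleftrightarrow> \<not> (a = c \<and> b = d) \<and> (a = c) = (b = d)) \<and>
      ((a + b) mod 3 = (c + d) mod 3 \<and> (a + 2 * b) mod 3 = (c + 2 * d) mod 3 \<longrightarrow> a = c \<and> b = (d::nat))"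
    by simp
  have three: "x \<in> {0, 1, 2}" if "x < 3" for x :: nat using that by auto
  have eq: "(h p, h q) \<in> parcs K3_K3 \<longleftrightarrow> p \<noteq> q \<and> (p, q) \<notin> parcs K3_K3"
    if pq: "p \<in> pverts K3_K3" "q \<in> pverts K3_K3" for p q
  proof -
    obtain a b c d where e: "p = (a, b)" "q = (c, d)" by fastforce
    then have lt: "a < 3" "b < 3" "c < 3" "d < 3" using pq by (auto simp: pverts_K3_K3)
    have "((a + b) mod 3 = (c + d) mod 3) \<noteq> ((a + 2 * b) mod 3 = (c + 2 * d) mod 3)
        \<longleftrightarrow> \<not> (a = c \<and> b = d) \<and> (a = c) = (b = d)"
      using cases three lt by blast
    then show ?thesis using lt by (simp add: e h_def parcs_K3_K3)
  qed
  have "h ` pverts K3_K3 \<subseteq> pverts K3_K3" by (auto simp: pverts_K3_K3 h_def)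
  moreover have "inj_on h (pverts K3_K3)"
  proof (rule inj_onI)
    fix p q assume pq: "p \<in> pverts K3_K3" "q \<in> pverts K3_K3" "h p = h q"
    obtain a b c d where e: "p = (a, b)" "q = (c, d)" by fastforce
    then have lt: "a < 3" "b < 3" "c < 3" "d < 3" using pq by (auto simp: pverts_K3_K3)
    have "(a + b) mod 3 = (c + d) mod 3 \<and> (a + 2 * b) mod 3 = (c + 2 * d) mod 3 \<longrightarrow> a = c \<and> b = d"
      using cases three lt by blast
    then show "p = q" using pq(3) by (simp add: e h_def)
  qed
  ultimately have "bij_betw h (pverts K3_K3) (pverts K3_K3)"
    by (simp add: bij_betw_def endo_inj_surj pverts_K3_K3)
  then show ?thesis using that eq by blast
qed

text \<open>One token stalls forever; two do not dominate, so they cost at least 2 * 3; three or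
  more cost at least 3 * 2, and all nine cost 9. Self-complementarity turns 6 into 6 * 6 = 4 *
  9.\<close>

lemma (in pair_graph) th_times_K3_K3_ge:
  assumes f: "bij_betw f (pverts G) (pverts K3_K3)"
    and E: "\<And>u v. u \<in> pverts G \<Longrightarrow> v \<in> pverts G \<Longrightarrow> (u, v) \<in> parcs G \<longleftrightarrow> (f u, f v) \<in> parcs K3_K3"
  shows "6 \<le> th_times pd_time G"
proof -
  have n: "order G = 9" using bij_betw_same_card[OF f] by (simp add: order_def pverts_K3_K3)
  then have ne: "pverts G \<noteq> {}" by (auto simp: order_def)
  have fV: "f u \<in> pverts K3_K3" if "u \<in> pverts G" for u using f that by (auto simp: bij_betw_def)
  have lift: "\<exists>u\<in>pverts G. f u = p" if "p \<in> pverts K3_K3" for p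
    using f that unfolding bij_betw_def by (metis imageE)
  have inj: "f u = f v \<longleftrightarrow> u = v" if "u \<in> pverts G" "v \<in> pverts G" for u v
    using f that by (auto simp: bij_betw_def dest: inj_onD)
  have g: "3 \<le> domination_number G"
  proof (rule ccontr)
    assume "\<not> ?thesis"
    moreover obtain D where D: "dominating G D" "card D = domination_number G"
      by (rule ex_minimum_dominating)
    moreover have "1 \<le> card D" using domination_number_pos[OF ne] D by simp
    ultimately have "card D = 1 \<or> card D = 2" by linarith
    then obtain u v where uv: "D = {u, v}" by (metis card_1_singletonE card_2_iff insert_absorb2)
    have V: "u \<in> pverts G" "v \<in> pverts G" using D(1) by (auto simp: dominating_def uv)
    obtain p where p: "p \<in> pverts K3_K3" "p \<noteq> f u" "p \<noteq> f v"
      "(f u, p) \<notin> parcs K3_K3" "(f v, p) \<notin> parcs K3_K3"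
      using K3_K3_not_dominated_pair[OF fV[OF V(1)] fV[OF V(2)]] by blast
    then obtain w where "w \<in> pverts G" "f w = p" using lift by blast
    then show False using D(1) p V E by (auto simp: dominating_def uv)
  qed
  have stuck: "pd_set G {v} (Suc t) = insert v (neighbors G v)" if v: "v \<in> pverts G" for v t
  proof (induction t)
    case (Suc t)
    let ?S = "insert v (neighbors G v)"
    have "neighbors G u - ?S \<noteq> {w}" if u: "u \<in> ?S" for u w
    proof
      assume eq: "neighbors G u - ?S = {w}"
      then have "w \<in> neighbors G u - ?S" by simp
      then have w: "(u, w) \<in> parcs G" "w \<noteq> v" "(v, w) \<notin> parcs G" by auto
      have V: "u \<in> pverts G" "w \<in> pverts G" using w edge_verts by auto
      have "f u = f v \<or> (f v, f u) \<in> parcs K3_K3" using u v V E by auto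
      then obtain p where p: "p \<in> pverts K3_K3" "(f u, p) \<in> parcs K3_K3" "p \<noteq> f v"
        "(f v, p) \<notin> parcs K3_K3" "p \<noteq> f w"
        using K3_K3_second_neighbor_outside[of "f u" "f v" "f w"] w v V E inj by blast
      then obtain x where x: "x \<in> pverts G" "f x = p" using lift by blast
      then have "x \<in> neighbors G u - ?S" using p v V E by auto
      then show False using eq x p by auto
    qed
    then have "{w. \<exists>u\<in>?S. neighbors G u - ?S = {w}} = {}" by blast
    then show ?case unfolding pd_set.simps(3) Suc.IH by simp
  qed simp
  have inf: "pd_time G 1 = \<infinity>"
  proof (rule ccontr)
    assume "pd_time G 1 \<noteq> \<infinity>"
    then obtain B t where B: "B \<subseteq> pverts G" "card B = 1" "pd_set G B t = pverts G"
      by (rule pd_time_attained)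
    then obtain v where Bv: "B = {v}" by (metis card_1_singletonE)
    have v: "v \<in> pverts G" using B Bv by simp
    have "pverts G \<subseteq> insert v (neighbors G v)"
      using B(3) stuck[OF v] v unfolding Bv by (cases t) auto
    then have "dominating G {v}" using v by (auto simp: dominating_def)
    then show False using domination_number_le g by fastforce
  qed
  show ?thesis unfolding th_times_def
  proof (rule INF_greatest)
    fix k assume k: "k \<in> {1..order G}"
    consider "k = 1" | "k = 2" | "3 \<le> k" "k < 9" | "k = 9" using k n by force
    then show "6 \<le> enat k * (1 + pd_time G k)"
    proof cases
      case 1
      then show ?thesis using inf by (simp add: one_enat_def)
    next
      case 2
      then have "2 \<le> pd_time G k"
        using pd.pt_less_domination_number[OF pair_graph ne] g by simp
      then have "enat 2 * (1 + 2) \<le> enat k * (1 + pd_time G k)"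
        using 2 by (intro mult_mono add_mono) auto
      then show ?thesis by (simp add: numeral_eq_enat one_enat_def)
    next
      case 3
      then have "1 \<le> pd_time G k" using n by (intro pd.pt_pos pair_graph) auto
      then have "enat 3 * (1 + 1) \<le> enat k * (1 + pd_time G k)"
        using 3 by (intro mult_mono add_mono) auto
      then show ?thesis by (simp add: numeral_eq_enat one_enat_def)
    next
      case 4
      then have "enat 6 * 1 \<le> enat k * (1 + pd_time G k)" by (intro mult_mono) auto
      then show ?thesis by (simp add: numeral_eq_enat)
    qed
  qed
qed

lemma (in pair_graph) pd_th_times_product_eq_iff:
  assumes n: "5 \<le> order G"
  shows "th_times pd_time G * th_times pd_time (graph_compl G) = enat (4 * order G) \<longleftrightarrow>
    digraph_iso (with_proj G) (with_proj K3_K3)"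
proof
  assume "th_times pd_time G * th_times pd_time (graph_compl G) = enat (4 * order G)"
  then show "digraph_iso (with_proj G) (with_proj K3_K3)"
    using pd_th_times_bounds(2)[OF n] domination_balanced_iso_K3_K3 by blast
next
  interpret C: pair_graph "graph_compl G" by (rule pair_graph_compl)
  assume "digraph_iso (with_proj G) (with_proj K3_K3)"
  then obtain f where f: "bij_betw f (pverts G) (pverts K3_K3)"
    and E: "\<forall>u\<in>pverts G. \<forall>v\<in>pverts G. (u, v) \<in> parcs G \<longleftrightarrow> (f u, f v) \<in> parcs K3_K3"
    unfolding digraph_iso_with_proj_iff[OF pair_wf_digraph_axioms pair_wf_digraph_K3_K3] by blast
  obtain h where h: "bij_betw h (pverts K3_K3) (pverts K3_K3)"
    and H: "\<And>p q. p \<in> pverts K3_K3 \<Longrightarrow> q \<in> pverts K3_K3 \<Longrightarrow>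
      (h p, h q) \<in> parcs K3_K3 \<longleftrightarrow> p \<noteq> q \<and> (p, q) \<notin> parcs K3_K3"
    using K3_K3_self_complementary by blast
  have fV: "f u \<in> pverts K3_K3" if "u \<in> pverts G" for u using f that by (auto simp: bij_betw_def)
  have inj: "f u = f v \<longleftrightarrow> u = v" if "u \<in> pverts G" "v \<in> pverts G" for u v
    using f that by (auto simp: bij_betw_def dest: inj_onD)
  have "6 \<le> th_times pd_time G" using th_times_K3_K3_ge[OF f] E by blast
  moreover have "6 \<le> th_times pd_time (graph_compl G)"
  proof (rule C.th_times_K3_K3_ge[of "h \<circ> f"])
    show "bij_betw (h \<circ> f) (pverts (graph_compl G)) (pverts K3_K3)"
      using bij_betw_trans[OF f h] by simp
  qed (use E H fV inj in simp)
  ultimately have "6 * 6 \<le> th_times pd_time G * th_times pd_time (graph_compl G)"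
    by (intro mult_mono) auto
  moreover have "order G = 9" using bij_betw_same_card[OF f] by (simp add: order_def pverts_K3_K3)
  moreover have "th_times pd_time G * th_times pd_time (graph_compl G) \<le> enat (4 * order G)"
    by (rule pd.th_times_bounds(4)[OF pair_graph n])
  ultimately show "th_times pd_time G * th_times pd_time (graph_compl G) = enat (4 * order G)"
    by (simp add: numeral_eq_enat)
qed

section \<open>Infinite families attaining the bounds\<close>

lemma infinitely_many_graphsI:
  assumes "\<And>i::nat. pair_graph (F i)" "\<And>i. order (F i) = c i" "\<And>i. 5 \<le> c i" "inj c" "\<And>i. P (F i)"
  shows "infinitely_many_graphs P"
  unfolding infinitely_many_graphs_def
proof (intro exI[of _ "range F"] conjI ballI impI)
  have "inj F" using assms(2,4) by (metis injD injI)
  then show "infinite (range F)" by (simp add: finite_image_iff)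
next
  fix G H assume "G \<in> range F" "H \<in> range F" "G \<noteq> H"
  then obtain i j where ij: "G = F i" "H = F j" "i \<noteq> j" by auto
  show "\<not> digraph_iso (with_proj G) (with_proj H)"
  proof
    assume iso: "digraph_iso (with_proj G) (with_proj H)"
    interpret G: pair_graph G using assms(1) ij by simp
    interpret H: pair_graph H using assms(1) ij by simp
    have "card (pverts G) = card (pverts H)"
      using iso bij_betw_same_card
      unfolding digraph_iso_with_proj_iff[OF G.pair_wf_digraph_axioms H.pair_wf_digraph_axioms] by blast
    then show False using assms(2,4) ij by (metis injD order_def)
  qed
qed (use assms in auto)

definition star_graph :: "nat \<Rightarrow> nat pair_pre_digraph" where
  "star_graph n = \<lparr>pverts = {..<n}, parcs = {(u, v). u < n \<and> v < n \<and> u \<noteq> v \<and> (u = 0 \<or> v = 0)}\<rparr>"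

text \<open>For 2m \<le> n these are the m disjoint edges {2i, 2i + 1} together with isolated
  vertices. The values m = 0, m = 1 and n = 2m cover edgeless graphs, a single edge and perfect
  matchings.\<close>

definition matching_graph :: "nat \<Rightarrow> nat \<Rightarrow> nat pair_pre_digraph" where
  "matching_graph n m = \<lparr>pverts = {..<n},
    parcs = {(u, v). u < n \<and> v < n \<and> u \<noteq> v \<and> u < 2 * m \<and> v < 2 * m \<and> u div 2 = v div 2}\<rparr>"

lemma pair_graph_star: "pair_graph (star_graph n)"
  unfolding star_graph_def by (rule pair_graphI) (auto simp: sym_def irrefl_def)

lemma pair_graph_matching: "pair_graph (matching_graph n m)"
  unfolding matching_graph_def by (rule pair_graphI) (auto simp: sym_def irrefl_def)

lemma order_star: "order (star_graph n) = n"
  by (simp add: star_graph_def order_def)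

lemma order_matching: "order (matching_graph n m) = n"
  by (simp add: matching_graph_def order_def)

context throttling_time
begin

lemma th_ge_components:
  assumes "\<And>k. k < N \<Longrightarrow> pt G k = \<infinity>" shows "enat N \<le> th pt G"
  unfolding th_def
proof (rule INF_greatest)
  fix k
  show "enat N \<le> enat k + pt G k"
    using assms[of k] by (cases "k < N"; cases "pt G k") auto
qed

lemma th_star_ge_components:
  assumes G: "pair_graph G" and "\<And>k. k < N \<Longrightarrow> pt G k = \<infinity>" shows "enat N \<le> th_star pt G"
  unfolding th_star_def
proof (rule INF_greatest)
  fix k assume k: "k \<in> {1..order G - 1}"
  show "enat N \<le> enat k * pt G k"
  proof (cases "k < N")
    case True
    then show ?thesis using assms(2) k by (simp add: zero_enat_def)
  next
    case False
    have "enat N * 1 \<le> enat k * pt G k"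
      using k False by (intro mult_mono pt_pos[OF G]) auto
    then show ?thesis by simp
  qed
qed

text \<open>From N tokens on, every placement short of all vertices takes time at least 1, so its
  factor is at least 2 and the cost at least 2N.\<close>

lemma th_times_ge_components:
  assumes G: "pair_graph G" and "\<And>k. k < N \<Longrightarrow> pt G k = \<infinity>" and n: "order G \<le> 2 * N"
  shows "enat (order G) \<le> th_times pt G"
  unfolding th_times_def
proof (rule INF_greatest)
  fix k assume k: "k \<in> {1..order G}"
  consider "k < N" | "N \<le> k" "k < order G" | "k = order G" using k by force
  then show "enat (order G) \<le> enat k * (1 + pt G k)"
  proof cases
    case 1
    then show ?thesis using assms(2) k by (simp add: zero_enat_def)
  next
    case 2
    have "enat (order G) \<le> enat k * (1 + 1)" using 2 n by (simp add: one_enat_def)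
    also have "\<dots> \<le> enat k * (1 + pt G k)"
      using 2 by (intro mult_mono add_mono pt_pos[OF G]) auto
    finally show ?thesis .
  next
    case 3
    have "enat k * 1 \<le> enat k * (1 + pt G k)" by (intro mult_mono) auto
    then show ?thesis using 3 by simp
  qed
qed

end

text \<open>Colouring each edge by its even end and each isolated vertex by itself uses m + (n - 2m)
  = n - m colours.\<close>

lemma matching_components:
  assumes "throttling_time pt" "2 * m \<le> n" "k < n - m"
  shows "pt (matching_graph n m) k = \<infinity>"
proof -
  interpret throttling_time pt by fact
  let ?G = "matching_graph n m"
  define c where "c u = (if u < 2 * m then 2 * (u div 2) else u)" for u
  have V: "pverts ?G = {..<n}" by (simp add: matching_graph_def)
  have "(\<lambda>i. 2 * i) ` {..<m} \<union> {2 * m..<n} \<subseteq> c ` pverts ?G"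
  proof
    fix x assume "x \<in> (\<lambda>i. 2 * i) ` {..<m} \<union> {2 * m..<n}"
    then have "x < n" "x = c x" using assms(2) by (auto simp: c_def)
    then show "x \<in> c ` pverts ?G" unfolding V by blast
  qed
  then have "card ((\<lambda>i. 2 * i) ` {..<m} \<union> {2 * m..<n}) \<le> card (c ` pverts ?G)"
    by (intro card_mono) (simp_all add: V)
  moreover have "card ((\<lambda>i. 2 * i) ` {..<m} \<union> {2 * m..<n}) = m + (n - 2 * m)"
  proof -
    have "(\<lambda>i. 2 * i) ` {..<m} \<inter> {2 * m..<n} = {}" by auto
    then show ?thesis by (simp add: card_Un_disjoint card_image inj_on_def)
  qed
  ultimately have "k < card (c ` pverts ?G)" using assms(2,3) by simp
  moreover have "c u = c v" if "(u, v) \<in> parcs ?G" for u v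
    using that by (simp add: matching_graph_def c_def)
  ultimately show ?thesis using pt_components[OF pair_graph_matching] by blast
qed

lemma domination_number_star: "5 \<le> n \<Longrightarrow> domination_number (star_graph n) \<le> 1"
proof -
  assume n: "5 \<le> n"
  interpret pair_graph "star_graph n" by (rule pair_graph_star)
  have "dominating (star_graph n) {0}" using n by (auto simp: dominating_def star_graph_def)
  then show ?thesis using domination_number_le by fastforce
qed

lemma domination_number_compl_star: "5 \<le> n \<Longrightarrow> domination_number (graph_compl (star_graph n)) \<le> 2"
proof -
  assume n: "5 \<le> n"
  interpret pair_graph "graph_compl (star_graph n)"
    by (rule pair_graph.pair_graph_compl[OF pair_graph_star])
  have "dominating (graph_compl (star_graph n)) {0, 1}"
    using n by (auto simp: dominating_def star_graph_def graph_compl_def)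
  then show ?thesis using domination_number_le by fastforce
qed

lemma has_edge_star:
  assumes "5 \<le> n" shows "has_edge (star_graph n)" "has_edge (graph_compl (star_graph n))"
proof -
  have "(0, 1) \<in> parcs (star_graph n)" "(1, 2) \<in> parcs (graph_compl (star_graph n))"
    using assms by (auto simp: star_graph_def graph_compl_def)
  then show "has_edge (star_graph n)" "has_edge (graph_compl (star_graph n))"
    unfolding has_edge_def by blast+
qed

lemma has_edge_matching:
  assumes "5 \<le> n" "1 \<le> m"
  shows "has_edge (matching_graph n m)" "has_edge (graph_compl (matching_graph n m))"
proof -
  have "(0, 1) \<in> parcs (matching_graph n m)" "(0, 2) \<in> parcs (graph_compl (matching_graph n m))"
    using assms by (auto simp: matching_graph_def graph_compl_def)
  then show "has_edge (matching_graph n m)" "has_edge (graph_compl (matching_graph n m))"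
    unfolding has_edge_def by blast+
qed

definition mate :: "nat \<Rightarrow> nat" where
  "mate u = (if even u then u + 1 else u - 1)"

lemma mate_mate: "mate (mate u) = u"
  by (auto simp: mate_def)

lemma mate_neq: "mate u \<noteq> u"
  by (auto simp: mate_def dest: odd_pos)

lemma mate_less: "u < 2 * m \<Longrightarrow> mate u < 2 * m"
  by (auto simp: mate_def elim!: evenE)

lemma div_2_eq_iff_mate: "u div 2 = v div 2 \<longleftrightarrow> v = u \<or> v = mate u"
  by (cases "even u"; cases "even v") (auto simp: mate_def elim!: evenE oddE)

lemma parcs_compl_perfect_matching:
  "(u, v) \<in> parcs (graph_compl (matching_graph (2 * m) m)) \<longleftrightarrow>
    u < 2 * m \<and> v < 2 * m \<and> v \<noteq> u \<and> v \<noteq> mate u"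
  using div_2_eq_iff_mate[of u v] by (auto simp: matching_graph_def graph_compl_def)

lemma domination_number_compl_perfect_matching:
  assumes "3 \<le> m" shows "2 \<le> domination_number (graph_compl (matching_graph (2 * m) m))"
proof -
  let ?G = "matching_graph (2 * m) m"
  interpret pair_graph ?G by (rule pair_graph_matching)
  interpret C: pair_graph "graph_compl ?G" by (rule pair_graph_compl)
  have "(v, mate v) \<in> parcs ?G" if "v \<in> pverts ?G" for v
    using that mate_less[of v m] div_2_eq_iff_mate[of v "mate v"] mate_neq[of v]
    by (simp add: matching_graph_def)
  then have "\<not> has_isolated_vertex ?G"
    unfolding has_isolated_vertex_def neighbors_def by blast
  then have "domination_number (graph_compl ?G) \<noteq> 1"
    using C.isolated_compl_if_dominating_vertex by auto
  moreover have "0 \<in> pverts (graph_compl ?G)" using assms by (simp add: matching_graph_def)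
  then have "pverts (graph_compl ?G) \<noteq> {}" by blast
  ultimately show ?thesis using C.domination_number_pos by fastforce
qed

text \<open>The robber always moves to the only vertex that is not adjacent to the cop.\<close>

lemma capture_time_compl_perfect_matching:
  "3 \<le> capture_time (graph_compl (matching_graph (2 * m) m)) 1"
proof -
  let ?H = "graph_compl (matching_graph (2 * m) m)"
  interpret G: pair_graph "matching_graph (2 * m) m" by (rule pair_graph_matching)
  interpret pair_graph ?H by (rule G.pair_graph_compl)
  have V: "pverts ?H = {..<2 * m}" by (simp add: matching_graph_def)
  have avoid: "d < 2 * m \<and> d \<noteq> mate c" if "c < 2 * m" "legal_move ?H c d" for c d
    using that mate_neq[of c] parcs_compl_perfect_matching[of c d m] by (auto simp: legal_move_def simp del: graph_compl_simps)
  have escape: "legal_move ?H (mate c) (mate d)" if "c < 2 * m" "d < 2 * m" "d \<noteq> mate c" for c d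
  proof -
    have "mate d \<noteq> mate (mate c)" using that(3) mate_mate by metis
    then show ?thesis using that mate_less parcs_compl_perfect_matching[of "mate c" "mate d" m]
      by (auto simp: legal_move_def simp del: graph_compl_simps)
  qed
  have "enat 3 \<le> capture_time ?H 1"
  proof (rule capture_time_ge)
    fix \<sigma> assume \<sigma>: "\<sigma> \<in> cop_strategies ?H 1"
    define c0 where "c0 = \<sigma> [] 0"
    define c1 where "c1 = \<sigma> [mate c0] 0"
    define c2 where "c2 = \<sigma> [mate c0, mate c1] 0"
    define play where "play t = (if t = 0 then mate c0 else if t = 1 then mate c1 else mate c2)" for t :: nat
    have c0: "c0 < 2 * m" using \<sigma> V by (auto simp: cop_strategies_def c0_def)
    have move: "legal_move ?H (cop_positions \<sigma> \<rho> t 0) (cop_positions \<sigma> \<rho> (Suc t) 0)"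
      if "\<rho> \<in> robber_plays ?H" for \<rho> t
      using \<sigma> that by (simp add: cop_strategies_def)
    have "(\<lambda>_. mate c0) \<in> robber_plays ?H" using mate_less[OF c0] V by (intro constant_robber_play) simp
    from move[OF this, of 0] have c1: "c1 < 2 * m" "c1 \<noteq> mate c0"
      using avoid[OF c0, of c1] by (auto simp: cop_positions_def c0_def c1_def)
    \<comment> \<open>Cop moves are known to be legal only along legal plays, while the legality of
      \<open>play\<close> depends on the cop's second move. This auxiliary play has the same first
      two positions and yields that move first.\<close>
    let ?r1 = "\<lambda>t::nat. if t = 0 then mate c0 else mate c1"
    have "?r1 \<in> robber_plays ?H"
      using mate_less[OF c0] V escape[OF c0 c1]
      by (auto simp: robber_plays_def legal_move_def simp del: graph_compl_simps(2))
    from move[OF this, of 1] have c2: "c2 < 2 * m" "c2 \<noteq> mate c1"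
      using avoid[OF c1(1), of c2] by (auto simp: cop_positions_def c1_def c2_def)
    have play: "play \<in> robber_plays ?H"
      unfolding robber_plays_def
    proof (intro CollectI conjI allI)
      show "play 0 \<in> pverts ?H" using mate_less[OF c0] V by (simp add: play_def)
      fix t :: nat
      consider "t = 0" | "t = 1" | "2 \<le> t" by linarith
      then show "legal_move ?H (play t) (play (Suc t))"
        by cases (use escape[OF c0 c1] escape[OF c1(1) c2] in \<open>auto simp: play_def legal_move_def simp del: graph_compl_simps(2)\<close>)
    qed
    have "\<not> captured_in_round 1 \<sigma> play s" if "s < 3" for s
    proof -
      consider "s = 0" | "s = 1" | "s = 2" using \<open>s < 3\<close> by linarith
      then show ?thesis
      proof cases
        case 1
        then show ?thesis using mate_neq[of c0]
          by (auto simp: captured_in_round_def cop_positions_def play_def c0_def)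
      next
        case 2
        have "cop_positions \<sigma> play 1 0 = c1" by (simp add: cop_positions_def play_def c1_def)
        then show ?thesis using 2 mate_neq[of c1] c1 by (auto simp: captured_in_round_def play_def)
      next
        case 3
        have "cop_positions \<sigma> play 2 0 = c2" by (simp add: cop_positions_def play_def c2_def upt_rec)
        then show ?thesis using 3 mate_neq[of c2] c2 by (auto simp: captured_in_round_def play_def)
      qed
    qed
    then have "enat 3 \<le> capture_round 1 \<sigma> play" by (rule capture_round_geI)
    then show "\<exists>\<rho>\<in>robber_plays ?H. enat 3 \<le> capture_round 1 \<sigma> \<rho>" using play by blast
  qed
  then show ?thesis by (simp add: numeral_eq_enat)
qed

text \<open>The domination numbers 1 and 2 give upper estimates whose sums and products meet the
  general lower bounds: 2 and 3 for \<open>th\<close>, 1 and 2 for \<open>th_star\<close>, 2 and 4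
  for \<open>th_times\<close>.\<close>

lemma star_sharp:
  assumes pt: "throttling_time pt" and n: "5 \<le> n"
  defines "G \<equiv> star_graph n"
  shows "th pt G + th pt (graph_compl G) = 5" "th pt G * th pt (graph_compl G) = 6"
    "th_star pt G + th_star pt (graph_compl G) = 3" "th_star pt G * th_star pt (graph_compl G) = 2"
    "th_times pt G + th_times pt (graph_compl G) = 6" "th_times pt G * th_times pt (graph_compl G) = 8"
proof -
  interpret throttling_time pt by fact
  interpret pair_graph G unfolding G_def by (rule pair_graph_star)
  interpret C: pair_graph "graph_compl G" by (rule pair_graph_compl)
  have n': "5 \<le> order G" using n by (simp add: G_def order_star)
  note nonempty = verts_nonempty[OF pair_graph n']
  note e = has_edge_star[OF n, folded G_def]
  have g: "domination_number G \<le> 1" "domination_number (graph_compl G) \<le> 2"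
    using domination_number_star[OF n] domination_number_compl_star[OF n] by (auto simp: G_def)
  have a: "th pt G \<le> enat 2" "th pt (graph_compl G) \<le> enat 3"
    using order.trans[OF th_le_domination_number[OF pair_graph nonempty(1)]]
      order.trans[OF th_le_domination_number[OF pair_graph_compl nonempty(2)]] g by auto
  have b: "th_star pt G \<le> enat 1" "th_star pt (graph_compl G) \<le> enat 2"
    using order.trans[OF th_star_le_domination_number[OF pair_graph nonempty(1) e(1)]]
      order.trans[OF th_star_le_domination_number[OF pair_graph_compl nonempty(2) e(2)]] g by auto
  have c: "th_times pt G \<le> enat 2" "th_times pt (graph_compl G) \<le> enat 4"
    using order.trans[OF th_times_le_domination_number[OF pair_graph nonempty(1)]]
      order.trans[OF th_times_le_domination_number[OF pair_graph_compl nonempty(2)]] g by auto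
  show "th pt G + th pt (graph_compl G) = 5" "th pt G * th pt (graph_compl G) = 6"
    using add_mono[OF a] mult_mono[OF a] th_bounds(1,3)[OF pair_graph n']
    by (auto simp: numeral_eq_enat intro: order.antisym)
  show "th_star pt G + th_star pt (graph_compl G) = 3" "th_star pt G * th_star pt (graph_compl G) = 2"
    using add_mono[OF b] mult_mono[OF b] th_star_bounds(1,3)[OF pair_graph n' e]
    by (auto simp: numeral_eq_enat eval_nat_numeral intro: order.antisym)
  show "th_times pt G + th_times pt (graph_compl G) = 6" "th_times pt G * th_times pt (graph_compl G) = 8"
    using add_mono[OF c] mult_mono[OF c] th_times_bounds(1,3)[OF pair_graph n']
    by (auto simp: numeral_eq_enat intro: order.antisym)
qed

lemma empty_sharp:
  assumes pt: "throttling_time pt" and n: "5 \<le> n"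
  defines "G \<equiv> matching_graph n 0"
  shows "th pt G + th pt (graph_compl G) = enat (order G + 2)"
    "th pt G * th pt (graph_compl G) = enat (2 * order G)"
proof -
  interpret throttling_time pt by fact
  interpret pair_graph G unfolding G_def by (rule pair_graph_matching)
  have o: "order G = n" by (simp add: G_def order_matching)
  then have n': "5 \<le> order G" using n by simp
  have a: "enat n \<le> th pt G" unfolding G_def by (rule th_ge_components) (use matching_components[OF pt] in simp)
  have b: "enat 2 \<le> th pt (graph_compl G)"
    using th_ge_two[OF pair_graph_compl verts_nonempty(2)[OF pair_graph n']] n' by (simp add: numeral_eq_enat)
  show "th pt G + th pt (graph_compl G) = enat (order G + 2)"
    using add_mono[OF a b] th_bounds(2)[OF pair_graph n'] by (simp add: o)
  show "th pt G * th pt (graph_compl G) = enat (2 * order G)"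
    using mult_mono[OF a b] th_bounds(4)[OF pair_graph n'] by (simp add: o mult.commute)
qed

lemma single_edge_sharp:
  assumes pt: "throttling_time pt" and n: "5 \<le> n"
  defines "G \<equiv> matching_graph n 1"
  shows "th_star pt G + th_star pt (graph_compl G) = enat (order G)"
proof -
  interpret throttling_time pt by fact
  interpret pair_graph G unfolding G_def by (rule pair_graph_matching)
  have o: "order G = n" by (simp add: G_def order_matching)
  then have n': "5 \<le> order G" using n by simp
  note e = has_edge_matching[OF n, of 1, folded G_def, simplified]
  have a: "enat (n - 1) \<le> th_star pt G"
    unfolding G_def by (rule th_star_ge_components[OF pair_graph_matching]) (use matching_components[OF pt] n in simp)
  have b: "enat 1 \<le> th_star pt (graph_compl G)"
    using th_star_ge_one[OF pair_graph_compl verts_nonempty(2)[OF pair_graph n']] by (simp add: one_enat_def)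
  show ?thesis
    using add_mono[OF a b] th_star_bounds(2)[OF pair_graph n' e] n by (simp add: o)
qed

lemma perfect_matching_sharp:
  assumes pt: "throttling_time pt" and m: "3 \<le> m"
  defines "G \<equiv> matching_graph (2 * m) m"
  shows "th_star pt G * th_star pt (graph_compl G) = enat (order G)"
    "enat (order G) \<le> th_times pt G" "3 \<le> th_times pt (graph_compl G)"
proof -
  interpret throttling_time pt by fact
  interpret pair_graph G unfolding G_def by (rule pair_graph_matching)
  have o: "order G = 2 * m" by (simp add: G_def order_matching)
  then have n': "5 \<le> order G" using m by simp
  have e: "has_edge G" "has_edge (graph_compl G)"
    using has_edge_matching[of "2 * m" m] m by (auto simp: G_def)
  note g = domination_number_compl_perfect_matching[OF m, folded G_def]
  have inf: "pt G k = \<infinity>" if "k < m" for k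
    using matching_components[OF pt, of m "2 * m" k] that by (simp add: G_def)
  have a: "enat m \<le> th_star pt G" by (rule th_star_ge_components[OF pair_graph inf])
  have b: "enat 2 \<le> th_star pt (graph_compl G)"
    using th_star_ge_two[OF pair_graph_compl verts_nonempty(2)[OF pair_graph n'] g] by (simp add: numeral_eq_enat)
  show "th_star pt G * th_star pt (graph_compl G) = enat (order G)"
    using mult_mono[OF a b] th_star_bounds(4)[OF pair_graph n' e] by (simp add: o mult.commute)
  show "enat (order G) \<le> th_times pt G"
    by (rule th_times_ge_components[OF pair_graph, of m]) (simp_all add: o inf)
  show "3 \<le> th_times pt (graph_compl G)"
    using th_times_ge_three[OF pair_graph_compl verts_nonempty(2)[OF pair_graph n']] g n' by simp
qed

lemma pd_perfect_matching_sharp: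
  assumes m: "3 \<le> m"
  defines "G \<equiv> matching_graph (2 * m) m"
  shows "th_times pd_time G + th_times pd_time (graph_compl G) = enat (order G + 3)"
proof -
  interpret pair_graph G unfolding G_def by (rule pair_graph_matching)
  have n: "5 \<le> order G" using m by (simp add: G_def order_matching)
  have "enat (order G) + 3 \<le> th_times pd_time G + th_times pd_time (graph_compl G)"
    using perfect_matching_sharp(2,3)[OF pd.throttling_time_axioms m, folded G_def] by (rule add_mono)
  then show ?thesis using pd_th_times_bounds(1)[OF n] by (simp add: numeral_eq_enat)
qed

lemma cop_perfect_matching_sharp:
  assumes m: "3 \<le> m"
  defines "G \<equiv> matching_graph (2 * m) m"
  shows "th_times capture_time G + th_times capture_time (graph_compl G) = enat (order G + 4)"
    "th_times capture_time G * th_times capture_time (graph_compl G) = enat (4 * order G)"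
proof -
  interpret pair_graph G unfolding G_def by (rule pair_graph_matching)
  have n: "5 \<le> order G" using m by (simp add: G_def order_matching)
  have a: "enat (order G) \<le> th_times capture_time G"
    using perfect_matching_sharp(2)[OF cop.throttling_time_axioms m, folded G_def] .
  have b: "enat 4 \<le> th_times capture_time (graph_compl G)"
    using cop.th_times_ge_four[OF pair_graph_compl cop.verts_nonempty(2)[OF pair_graph n]]
      capture_time_compl_perfect_matching[of m, folded G_def] n by (simp add: numeral_eq_enat)
  show "th_times capture_time G + th_times capture_time (graph_compl G) = enat (order G + 4)"
    using add_mono[OF a b] cop.th_times_bounds(2)[OF pair_graph n] by simp
  show "th_times capture_time G * th_times capture_time (graph_compl G) = enat (4 * order G)"
    using mult_mono[OF a b] cop.th_times_bounds(4)[OF pair_graph n] by (simp add: mult.commute)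
qed

lemma infinitely_many_stars: "(\<And>n. 5 \<le> n \<Longrightarrow> P (star_graph n)) \<Longrightarrow> infinitely_many_graphs P"
  by (rule infinitely_many_graphsI[of "\<lambda>i. star_graph (i + 5)" "\<lambda>i. i + 5"])
    (auto simp: pair_graph_star order_star inj_def)

lemma infinitely_many_matchings: "(\<And>n. 5 \<le> n \<Longrightarrow> P (matching_graph n m)) \<Longrightarrow> infinitely_many_graphs P"
  by (rule infinitely_many_graphsI[of "\<lambda>i. matching_graph (i + 5) m" "\<lambda>i. i + 5"])
    (auto simp: pair_graph_matching order_matching inj_def)

lemma infinitely_many_perfect_matchings:
  assumes "\<And>m. 3 \<le> m \<Longrightarrow> P (matching_graph (2 * m) m)" shows "infinitely_many_graphs P"
  by (rule infinitely_many_graphsI[of "\<lambda>i. matching_graph (2 * (i + 3)) (i + 3)" "\<lambda>i. 2 * (i + 3)"])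
    (rule pair_graph_matching order_matching assms | simp add: inj_def)+

text \<open>Stars attain every lower bound, edgeless graphs both upper bounds for \<open>th\<close>,
  a single edge the upper sum for \<open>th_star\<close>, and perfect matchings the upper product
  for \<open>th_star\<close>. The upper bounds for \<open>th_times\<close> are absent because they
  depend on the parameter.\<close>

lemma throttling_bounds_sharp:
  assumes pt: "throttling_time (pt :: nat pair_pre_digraph \<Rightarrow> nat \<Rightarrow> enat)"
  shows "infinitely_many_graphs (\<lambda>G. th pt G + th pt (graph_compl G) = 5)"
    "infinitely_many_graphs (\<lambda>G. th pt G + th pt (graph_compl G) = enat (order G + 2))"
    "infinitely_many_graphs (\<lambda>G. th pt G * th pt (graph_compl G) = 6)"
    "infinitely_many_graphs (\<lambda>G. th pt G * th pt (graph_compl G) = enat (2 * order G))"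
    "infinitely_many_graphs (\<lambda>G. has_edge G \<and> has_edge (graph_compl G) \<and>
        th_star pt G + th_star pt (graph_compl G) = 3)"
    "infinitely_many_graphs (\<lambda>G. has_edge G \<and> has_edge (graph_compl G) \<and>
        th_star pt G + th_star pt (graph_compl G) = enat (order G))"
    "infinitely_many_graphs (\<lambda>G. has_edge G \<and> has_edge (graph_compl G) \<and>
        th_star pt G * th_star pt (graph_compl G) = 2)"
    "infinitely_many_graphs (\<lambda>G. has_edge G \<and> has_edge (graph_compl G) \<and>
        th_star pt G * th_star pt (graph_compl G) = enat (order G))"
    "infinitely_many_graphs (\<lambda>G. th_times pt G + th_times pt (graph_compl G) = 6)"
    "infinitely_many_graphs (\<lambda>G. th_times pt G * th_times pt (graph_compl G) = 8)"
  by (rule infinitely_many_stars infinitely_many_matchings[where m = 0]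
      infinitely_many_matchings[where m = 1] infinitely_many_perfect_matchings,
      (intro conjI)?; (rule star_sharp empty_sharp single_edge_sharp perfect_matching_sharp(1) has_edge_star
        has_edge_matching pt); simp add: pt)+

theorem theorem4p10:
  shows
    "(\<forall>G :: 'a pair_pre_digraph. pair_graph G \<and> 5 \<le> order G \<longrightarrow>
      5 \<le> th pd_time G + th pd_time (graph_compl G) \<and>
      th pd_time G + th pd_time (graph_compl G) \<le> enat (order G + 2) \<and>
      6 \<le> th pd_time G * th pd_time (graph_compl G) \<and>
      th pd_time G * th pd_time (graph_compl G) \<le> enat (2 * order G) \<and>
      (has_edge G \<and> has_edge (graph_compl G) \<longrightarrow>
        3 \<le> th_star pd_time G + th_star pd_time (graph_compl G) \<and>
        th_star pd_time G + th_star pd_time (graph_compl G) \<le> enat (order G) \<and>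
        2 \<le> th_star pd_time G * th_star pd_time (graph_compl G) \<and>
        th_star pd_time G * th_star pd_time (graph_compl G) \<le> enat (order G)) \<and>
      6 \<le> th_times pd_time G + th_times pd_time (graph_compl G) \<and>
      th_times pd_time G + th_times pd_time (graph_compl G) \<le> enat (order G + 3) \<and>
      8 \<le> th_times pd_time G * th_times pd_time (graph_compl G) \<and>
      th_times pd_time G * th_times pd_time (graph_compl G) \<le> enat (4 * order G) \<and>
      5 \<le> th capture_time G + th capture_time (graph_compl G) \<and>
      th capture_time G + th capture_time (graph_compl G) \<le> enat (order G + 2) \<and>
      6 \<le> th capture_time G * th capture_time (graph_compl G) \<and>
      th capture_time G * th capture_time (graph_compl G) \<le> enat (2 * order G) \<and>
      (has_edge G \<and> has_edge (graph_compl G) \<longrightarrow>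
        3 \<le> th_star capture_time G + th_star capture_time (graph_compl G) \<and>
        th_star capture_time G + th_star capture_time (graph_compl G) \<le> enat (order G) \<and>
        2 \<le> th_star capture_time G * th_star capture_time (graph_compl G) \<and>
        th_star capture_time G * th_star capture_time (graph_compl G) \<le> enat (order G)) \<and>
      6 \<le> th_times capture_time G + th_times capture_time (graph_compl G) \<and>
      th_times capture_time G + th_times capture_time (graph_compl G) \<le> enat (order G + 4) \<and>
      8 \<le> th_times capture_time G * th_times capture_time (graph_compl G) \<and>
      th_times capture_time G * th_times capture_time (graph_compl G) \<le> enat (4 * order G) \<and>
      (th_times pd_time G * th_times pd_time (graph_compl G) = enat (4 * order G) \<longleftrightarrow>
        digraph_iso (with_proj G)
          (with_proj (cartesian_product (complete_graph 3) (complete_graph 3)))) \<and>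
      (\<not> has_isolated_vertex G \<and> \<not> has_isolated_vertex (graph_compl G) \<longrightarrow>
        th pd_time G + th pd_time (graph_compl G) \<le> enat (order G div 2 + 4) \<and>
        th pd_time G * th pd_time (graph_compl G) \<le> enat (order G + order G div 2 + 3) \<and>
        th capture_time G + th capture_time (graph_compl G) \<le> enat (order G div 2 + 4) \<and>
        th capture_time G * th capture_time (graph_compl G) \<le> enat (order G + order G div 2 + 3))) \<and>
    infinitely_many_graphs (\<lambda>G. th pd_time G + th pd_time (graph_compl G) = 5) \<and>
    infinitely_many_graphs (\<lambda>G. th pd_time G + th pd_time (graph_compl G) = enat (order G + 2)) \<and>
    infinitely_many_graphs (\<lambda>G. th pd_time G * th pd_time (graph_compl G) = 6) \<and>
    infinitely_many_graphs (\<lambda>G. th pd_time G * th pd_time (graph_compl G) = enat (2 * order G)) \<and>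
    infinitely_many_graphs (\<lambda>G. has_edge G \<and> has_edge (graph_compl G) \<and>
        th_star pd_time G + th_star pd_time (graph_compl G) = 3) \<and>
    infinitely_many_graphs (\<lambda>G. has_edge G \<and> has_edge (graph_compl G) \<and>
        th_star pd_time G + th_star pd_time (graph_compl G) = enat (order G)) \<and>
    infinitely_many_graphs (\<lambda>G. has_edge G \<and> has_edge (graph_compl G) \<and>
        th_star pd_time G * th_star pd_time (graph_compl G) = 2) \<and>
    infinitely_many_graphs (\<lambda>G. has_edge G \<and> has_edge (graph_compl G) \<and>
        th_star pd_time G * th_star pd_time (graph_compl G) = enat (order G)) \<and>
    infinitely_many_graphs (\<lambda>G. th_times pd_time G + th_times pd_time (graph_compl G) = 6) \<and>
    infinitely_many_graphs (\<lambda>G. th_times pd_time G + th_times pd_time (graph_compl G) = enat (order G + 3)) \<and>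
    infinitely_many_graphs (\<lambda>G. th_times pd_time G * th_times pd_time (graph_compl G) = 8) \<and>
    infinitely_many_graphs (\<lambda>G. th capture_time G + th capture_time (graph_compl G) = 5) \<and>
    infinitely_many_graphs (\<lambda>G. th capture_time G + th capture_time (graph_compl G) = enat (order G + 2)) \<and>
    infinitely_many_graphs (\<lambda>G. th capture_time G * th capture_time (graph_compl G) = 6) \<and>
    infinitely_many_graphs (\<lambda>G. th capture_time G * th capture_time (graph_compl G) = enat (2 * order G)) \<and>
    infinitely_many_graphs (\<lambda>G. has_edge G \<and> has_edge (graph_compl G) \<and>
        th_star capture_time G + th_star capture_time (graph_compl G) = 3) \<and>
    infinitely_many_graphs (\<lambda>G. has_edge G \<and> has_edge (graph_compl G) \<and>
        th_star capture_time G + th_star capture_time (graph_compl G) = enat (order G)) \<and>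
    infinitely_many_graphs (\<lambda>G. has_edge G \<and> has_edge (graph_compl G) \<and>
        th_star capture_time G * th_star capture_time (graph_compl G) = 2) \<and>
    infinitely_many_graphs (\<lambda>G. has_edge G \<and> has_edge (graph_compl G) \<and>
        th_star capture_time G * th_star capture_time (graph_compl G) = enat (order G)) \<and>
    infinitely_many_graphs (\<lambda>G. th_times capture_time G + th_times capture_time (graph_compl G) = 6) \<and>
    infinitely_many_graphs (\<lambda>G. th_times capture_time G + th_times capture_time (graph_compl G) = enat (order G + 4)) \<and>
    infinitely_many_graphs (\<lambda>G. th_times capture_time G * th_times capture_time (graph_compl G) = 8) \<and>
    infinitely_many_graphs (\<lambda>G. th_times capture_time G * th_times capture_time (graph_compl G) = enat (4 * order G))"
proof (intro conjI allI impI)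
  fix G :: "'a pair_pre_digraph"
  assume "pair_graph G \<and> 5 \<le> order G"
  then have G: "pair_graph G" and n: "5 \<le> order G" by auto
  interpret pair_graph G by (rule G)
  show "(th_times pd_time G * th_times pd_time (graph_compl G) = enat (4 * order G)) =
      digraph_iso (with_proj G) (with_proj K3_K3)"
    by (rule pd_th_times_product_eq_iff[OF n])
qed ((rule pd.th_bounds(1-4) pd.th_star_bounds pd.th_times_bounds(1,3,4) cop.th_bounds(1-4) cop.th_star_bounds
    cop.th_times_bounds pair_graph.pd_th_times_bounds(1)
    pd.th_bounds(5,6) cop.th_bounds(5,6)
    throttling_bounds_sharp[OF pd.throttling_time_axioms] throttling_bounds_sharp[OF cop.throttling_time_axioms]
    infinitely_many_perfect_matchings pd_perfect_matching_sharp cop_perfect_matching_sharp; blast?)+)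

end
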